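(* In the $\beta$-model, let $r$ be a fixed positive integer and assume $b_n^3/c_n=o\big(n^{1/6}/\log n\big)$. (a) Under the specified null $H_0:\beta_i=\beta_i^0$, $i=1,\dots,r$ (true $\boldsymbol\beta$ satisfying it), with $\hat{\boldsymbol\beta}^0$ the maximizer of $\ell$ over $\{\boldsymbol\gamma\in\mathbb R^n:\gamma_i=\beta_i^0,\ i=1,\dots,r\}$, the statistic $2\{\ell(\hat{\boldsymbol\beta})-\ell(\hat{\boldsymbol\beta}^0)\}$ converges in distribution to $\chi^2_r$ as $n\to\infty$. (b) If $r\ge2$, under the homogeneous null $H_0:\beta_1=\cdots=\beta_r$ (true $\boldsymbol\beta$ satisfying it), with $\hat{\boldsymbol\beta}^0$ the maximizer of $\ell$ over $\{\boldsymbol\gamma\in\mathbb R^n:\gamma_1=\cdots=\gamma_r\}$, $2\{\ell(\hat{\boldsymbol\beta})-\ell(\hat{\boldsymbol\beta}^0)\}$ converges in distribution to $\chi^2_{r-1}$ as $n\to\infty$. (In both cases the MLEs exist with probability tending to one.)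
   Context: All quantities may depend on $n$; asymptotics are as $n\to\infty$. $\beta$-model: for $\boldsymbol\beta=(\beta_1,\dots,\beta_n)^\top\in\mathbb R^n$, the symmetric adjacency matrix $A=(a_{ij})$ of an undirected graph on nodes $\{1,\dots,n\}$ has $a_{ii}=0$, $a_{ji}=a_{ij}$, and $a_{ij}$ ($1\le i<j\le n$) mutually independent Bernoulli with $P(a_{ij}=1)=\mu(\beta_i+\beta_j)$, where $\mu(x)=e^x/(1+e^x)$. Degrees: $d_i=\sum_{j\ne i}a_{ij}$. Log-likelihood: $\ell(\boldsymbol\gamma)=\sum_{i=1}^n\gamma_id_i-\sum_{1\le i<j\le n}\log(1+e^{\gamma_i+\gamma_j})$; $\hat{\boldsymbol\beta}$ is its maximizer over $\mathbb R^n$. $b_n=\max_{i\ne j}(1+e^{\beta_i+\beta_j})^2/e^{\beta_i+\beta_j}$, $c_n=\min_{i\ne j}(1+e^{\beta_i+\beta_j})^2/e^{\beta_i+\beta_j}$ at the true $\boldsymbol\beta$. $\chi^2_k$ denotes the chi-square distribution with $k$ degrees of freedom. *)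

theory Defs
  imports "HOL-Probability.Probability" "HOL-Library.Landau_Symbols"
begin

definition mu :: "real \<Rightarrow> real" where
  "mu x = exp x / (1 + exp x)"

definition pairs :: "nat \<Rightarrow> (nat \<times> nat) set" where
  "pairs n = {(i, j). 1 \<le> i \<and> i < j \<and> j \<le> n}"

(* law of the upper triangle (a_ij)_{i<j} of the adjacency matrix in the beta-model *)
definition beta_graph :: "nat \<Rightarrow> (nat \<Rightarrow> real) \<Rightarrow> (nat \<times> nat \<Rightarrow> bool) pmf" where
  "beta_graph n \<beta> = Pi_pmf (pairs n) False (\<lambda>(i, j). bernoulli_pmf (mu (\<beta> i + \<beta> j)))"

definition adj :: "(nat \<times> nat \<Rightarrow> bool) \<Rightarrow> nat \<Rightarrow> nat \<Rightarrow> real" where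
  "adj A i j = (if i < j then of_bool (A (i, j)) else if j < i then of_bool (A (j, i)) else 0)"

definition deg :: "nat \<Rightarrow> (nat \<times> nat \<Rightarrow> bool) \<Rightarrow> nat \<Rightarrow> real" where
  "deg n A i = (\<Sum>j\<in>{1..n} - {i}. adj A i j)"

definition loglik :: "nat \<Rightarrow> (nat \<times> nat \<Rightarrow> bool) \<Rightarrow> (nat \<Rightarrow> real) \<Rightarrow> real" where
  "loglik n A \<gamma> = (\<Sum>i=1..n. \<gamma> i * deg n A i)
      - (\<Sum>(i, j)\<in>pairs n. ln (1 + exp (\<gamma> i + \<gamma> j)))"

definition bn :: "nat \<Rightarrow> (nat \<Rightarrow> real) \<Rightarrow> real" where
  "bn n \<beta> = Max {(1 + exp (\<beta> i + \<beta> j))\<^sup>2 / exp (\<beta> i + \<beta> j) | i j.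
                  i \<in> {1..n} \<and> j \<in> {1..n} \<and> i \<noteq> j}"

definition cn :: "nat \<Rightarrow> (nat \<Rightarrow> real) \<Rightarrow> real" where
  "cn n \<beta> = Min {(1 + exp (\<beta> i + \<beta> j))\<^sup>2 / exp (\<beta> i + \<beta> j) | i j.
                  i \<in> {1..n} \<and> j \<in> {1..n} \<and> i \<noteq> j}"

definition has_max :: "('a \<Rightarrow> real) \<Rightarrow> 'a set \<Rightarrow> bool" where
  "has_max f S \<longleftrightarrow> (\<exists>x\<in>S. \<forall>y\<in>S. f y \<le> f x)"

(* likelihood-ratio statistic 2{ l(hat beta) - l(hat beta^0) }, with the maxima written as suprema
   (they coincide with the maxima whenever the MLEs exist) *)
definition LRT :: "nat \<Rightarrow> (nat \<times> nat \<Rightarrow> bool) \<Rightarrow> (nat \<Rightarrow> real) set \<Rightarrow> real" where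
  "LRT n A S = 2 * (Sup (loglik n A ` UNIV) - Sup (loglik n A ` S))"

definition fixed_null_set :: "nat \<Rightarrow> (nat \<Rightarrow> real) \<Rightarrow> (nat \<Rightarrow> real) set" where
  "fixed_null_set r \<beta>0 = {\<gamma>. \<forall>i\<in>{1..r}. \<gamma> i = \<beta>0 i}"

definition homog_null_set :: "nat \<Rightarrow> (nat \<Rightarrow> real) set" where
  "homog_null_set r = {\<gamma>. \<forall>i\<in>{1..r}. \<gamma> i = \<gamma> 1}"

definition chi_sq_density :: "nat \<Rightarrow> real \<Rightarrow> real" where
  "chi_sq_density k x = (if x > 0 then x powr (real k / 2 - 1) * exp (- x / 2)
       / (2 powr (real k / 2) * Gamma (real k / 2)) else 0)"

definition chi_sq :: "nat \<Rightarrow> real measure" where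
  "chi_sq k = density lborel (\<lambda>x. ennreal (chi_sq_density k x))"

definition LRT_law :: "nat \<Rightarrow> (nat \<Rightarrow> real) \<Rightarrow> (nat \<Rightarrow> real) set \<Rightarrow> real measure" where
  "LRT_law n \<beta> S = distr (measure_pmf (beta_graph n \<beta>)) borel (\<lambda>A. LRT n A S)"

definition prob_mle_exist :: "nat \<Rightarrow> (nat \<Rightarrow> real) \<Rightarrow> (nat \<Rightarrow> real) set \<Rightarrow> real" where
  "prob_mle_exist n \<beta> S = measure_pmf.prob (beta_graph n \<beta>)
      {A. has_max (loglik n A) UNIV \<and> has_max (loglik n A) S}"

end

theory Submission
  imports Defs
begin

text \<open>
  Let \<open>V\<close> be the Fisher information, with entries \<open>v\<^sub>j\<^sub>k = \<mu>'(\<beta>\<^sub>j + \<beta>\<^sub>k)\<close> off the diagonal and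
  \<open>v\<^sub>j\<^sub>j = \<Sum>k\<noteq>j. v\<^sub>j\<^sub>k\<close>, and let \<open>g\<^sub>j\<close> be the score at the true parameter. Maximising the concave
  likelihood over a small box around \<open>\<beta>\<close> and excluding active constraints shows that with high
  probability the full and the restricted maximum likelihood estimates exist within
  \<open>O(b sqrt (ln n / n))\<close> of \<open>\<beta>\<close>. The difference \<open>h\<close> of the two estimates satisfies
  \<open>2 (\<ell>(full) - \<ell>(restricted)) = (1 + o(1)) \<Sum>i\<le>r. h\<^sub>i s\<^sub>i\<close>, where \<open>s\<close> is the score at the restricted
  estimate. For \<open>i \<le> r\<close> every such estimate \<open>\<beta> + d\<close> satisfies \<open>s\<^sub>i = g\<^sub>i - v\<^sub>i\<^sub>i d\<^sub>i + O(b\<^sup>3 ln n)\<close>: the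
  nuisance term \<open>\<Sum>k. v\<^sub>i\<^sub>k d\<^sub>k\<close> is evaluated by pairing the score equations with the solution \<open>w\<close> of
  \<open>V w = (v\<^sub>i\<^sub>k)\<close>, \<open>k \<noteq> i\<close>, whose entries are \<open>O(b / n)\<close>, so only the weighted noise \<open>\<Sum>k. w\<^sub>k g\<^sub>k\<close> and quadratic
  remainders are left. Hence the statistic is \<open>\<Sum>i\<le>r. g\<^sub>i\<^sup>2 / v\<^sub>i\<^sub>i\<close>, respectively its centred version,
  up to \<open>O(b\<^sup>4 (ln n)\<^sup>2 / sqrt n)\<close>. Dropping the edges among the first \<open>r\<close> nodes makes the \<open>g\<^sub>i\<close> independent,
  and each is asymptotically normal.
\<close>

section \<open>The logistic function\<close>

text \<open>The number of nuisance parameters grows with \<open>n\<close>, so V is a matrix of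
  growing size; it is never inverted. It is a weighted signless Laplacian: (V x)_j is the sum over k
  of v_jk (x_j + x_k), and its quadratic form is at least 1/b times that of the complete graph,
  whose least eigenvalue is n - 2. One box lemma built on this coercivity serves four times: with
  softplus potentials for the full estimate, the fixed null and the homogeneous null (only the
  labelling \<open>p\<close> of nodes by free coordinates changes), and with quadratic potentials
  for the system defining w. It delivers existence together with a sup-norm bound. Because
  \<open>b\<close> may grow with \<open>n\<close>, curvature is controlled in relative terms: a
  shift by \<open>t\<close> changes \<open>dmu\<close> by a factor 1 + O(t), however small
  \<open>dmu\<close> is. \<open>LRT\<close> is defined through suprema and therefore total; its
  values on graphs without estimates are absorbed in the exceptional event of
  \<open>weak_conv_close\<close>.\<close>

definition dmu :: "real \<Rightarrow> real" where
  "dmu x = exp x / (1 + exp x)\<^sup>2"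

lemma one_plus_exp_pos [simp]: "0 < 1 + exp (x::real)" "1 + exp x \<noteq> 0"
  by (simp_all add: add_pos_pos add_nonneg_eq_0_iff)

lemma softplus_has_derivative: "((\<lambda>x. ln (1 + exp x)) has_real_derivative mu x) (at x)"
  unfolding mu_def by (auto intro!: derivative_eq_intros simp: add_pos_pos)

lemma mu_has_derivative: "(mu has_real_derivative dmu x) (at x)"
  unfolding mu_def[abs_def] dmu_def
  by (auto intro!: derivative_eq_intros simp: power2_eq_square divide_simps) (simp add: algebra_simps)

lemma mu_bounds: "0 \<le> mu x" "mu x \<le> 1"
  unfolding mu_def by (auto simp: divide_simps add_pos_pos)

lemma dmu_eq_mu: "dmu x = mu x * (1 - mu x)"
  unfolding dmu_def mu_def by (simp add: field_simps power2_eq_square)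

lemma dmu_pos: "0 < dmu x"
  unfolding dmu_def by simp

lemma dmu_le_quarter: "dmu x \<le> 1 / 4"
proof -
  have "0 \<le> (mu x - 1/2)\<^sup>2" by simp
  thus ?thesis unfolding dmu_eq_mu by (simp add: power2_eq_square algebra_simps)
qed

lemma dmu_eq_prod: "dmu x = 1 / ((1 + exp x) * (1 + exp (- x)))"
  unfolding dmu_def by (simp add: exp_minus field_simps power2_eq_square)

text \<open>The logarithm of \<open>dmu\<close> has derivative 1 - 2 \<open>mu\<close>, of modulus
  at most 1. The product form yields the resulting log-Lipschitz bound without calculus: a shift
  enlarges one factor by at most its exponential while the other one shrinks.\<close>

lemma dmu_ratio: "dmu y \<le> exp \<bar>x - y\<bar> * dmu x"
proof -
  have "(1 + exp x) * (1 + exp (- x)) \<le> exp \<bar>x - y\<bar> * ((1 + exp y) * (1 + exp (- y)))"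
  proof (cases "y \<le> x")
    case True
    have "1 + exp x \<le> exp (x - y) * (1 + exp y)"
      using True by (simp add: distrib_left flip: exp_add)
    moreover have "1 + exp (- x) \<le> 1 + exp (- y)" using True by simp
    ultimately have "(1 + exp x) * (1 + exp (- x)) \<le> (exp (x - y) * (1 + exp y)) * (1 + exp (- y))"
      by (intro mult_mono) (auto simp: add_nonneg_nonneg)
    with True show ?thesis by (simp add: mult_ac)
  next
    case False
    have "1 + exp (- x) \<le> exp (y - x) * (1 + exp (- y))"
      using False by (simp add: distrib_left flip: exp_add)
    moreover have "1 + exp x \<le> 1 + exp y" using False by simp
    ultimately have "(1 + exp x) * (1 + exp (- x)) \<le> (1 + exp y) * (exp (y - x) * (1 + exp (- y)))"
      by (intro mult_mono) (auto simp: add_nonneg_nonneg)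
    with False show ?thesis by (simp add: mult_ac)
  qed
  moreover have "0 < (1 + exp x) * (1 + exp (- x))" "0 < (1 + exp y) * (1 + exp (- y))"
    by (auto intro!: mult_pos_pos)
  ultimately show ?thesis unfolding dmu_eq_prod by (simp add: divide_simps mult_ac)
qed

lemma dmu_ratio_linear:
  assumes "\<bar>x - y\<bar> \<le> t" "t \<le> 1"
  shows "\<bar>dmu y - dmu x\<bar> \<le> 2 * t * dmu x"
proof -
  have t: "0 \<le> t" using assms(1) by linarith
  have "exp t \<le> 1 + t + t\<^sup>2" using exp_bound[of t] t assms(2) by auto
  also have "\<dots> \<le> 1 + 2 * t" using t assms(2) by (simp add: power2_eq_square mult_left_le)
  finally have e: "exp t \<le> 1 + 2 * t" .
  have "dmu y \<le> exp t * dmu x"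
    by (rule order_trans[OF dmu_ratio[of y x]])
       (use assms dmu_pos[of x] in \<open>auto intro!: mult_right_mono\<close>)
  also have "\<dots> \<le> (1 + 2 * t) * dmu x" using e dmu_pos[of x] by (intro mult_right_mono) auto
  finally have 1: "dmu y \<le> dmu x + 2 * t * dmu x" by (simp add: algebra_simps)
  have "dmu x \<le> exp t * dmu y"
    by (rule order_trans[OF dmu_ratio[of x y]])
       (use assms dmu_pos[of y] in \<open>auto intro!: mult_right_mono\<close>)
  hence "exp (- t) * dmu x \<le> dmu y" by (simp add: exp_minus divide_simps mult_ac)
  moreover have "(1 - t) * dmu x \<le> exp (- t) * dmu x"
    using exp_ge_add_one_self[of "- t"] dmu_pos[of x] by (intro mult_right_mono) auto
  ultimately have "dmu x - t * dmu x \<le> dmu y" by (simp add: algebra_simps)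
  moreover have "0 \<le> t * dmu x" using t dmu_pos[of x] by simp
  ultimately show ?thesis using 1 by linarith
qed

text \<open>The distances of \<open>z\<close> to both endpoints replace membership in an interval,
  so both signs of \<open>t\<close> are covered at once and \<open>softplus_bregman\<close> can
  compare such a point with a second intermediate point.\<close>

lemma mu_diff_mvt: "\<exists>z. \<bar>z - x\<bar> \<le> \<bar>t\<bar> \<and> \<bar>z - (x + t)\<bar> \<le> \<bar>t\<bar> \<and> mu (x + t) - mu x = dmu z * t"
proof -
  consider "t > 0" | "t = 0" | "t < 0" by linarith
  thus ?thesis
  proof cases
    case 1
    obtain z where "x < z" "z < x + t" "mu (x + t) - mu x = (x + t - x) * dmu z"
      using MVT2[of x "x + t" mu dmu] 1 mu_has_derivative by auto
    thus ?thesis using 1 by (intro exI[of _ z]) auto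
  next
    case 3
    obtain z where "x + t < z" "z < x" "mu x - mu (x + t) = (x - (x + t)) * dmu z"
      using MVT2[of "x + t" x mu dmu] 3 mu_has_derivative by auto
    thus ?thesis using 3 by (intro exI[of _ z]) (auto simp: algebra_simps)
  qed auto
qed

lemma mu_lipschitz: "\<bar>mu (x + t) - mu x\<bar> \<le> \<bar>t\<bar>"
proof -
  obtain z where "mu (x + t) - mu x = dmu z * t" using mu_diff_mvt by blast
  thus ?thesis using dmu_pos[of z] dmu_le_quarter[of z]
    by (simp add: abs_mult mult_left_le_one_le)
qed

text \<open>A shift by at most 1/2 cannot reduce the slope below one half, because exp (1/2) \<le>
  2. A secant slope \<open>c\<close> is returned instead of an inequality for \<open>mu\<close>,
  since it can be multiplied by \<open>t\<close> of either sign.\<close>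

lemma mu_diff_half:
  assumes "\<bar>t\<bar> \<le> 1 / 2"
  shows "\<exists>c. dmu x / 2 \<le> c \<and> mu (x + t) - mu x = c * t"
proof -
  obtain z where z: "\<bar>z - x\<bar> \<le> \<bar>t\<bar>" "mu (x + t) - mu x = dmu z * t" using mu_diff_mvt by blast
  have "dmu x \<le> exp (1 / 2) * dmu z"
    by (rule order_trans[OF dmu_ratio[of x z]])
       (use z assms dmu_pos[of z] in \<open>auto intro!: mult_right_mono\<close>)
  also have "exp (1 / 2) \<le> (2::real)"
    using exp_bound[of "1/2"] by (simp add: power2_eq_square)
  hence "exp (1 / 2) * dmu z \<le> 2 * dmu z" using dmu_pos[of z] by (intro mult_right_mono) auto
  finally show ?thesis using z by (intro exI[of _ "dmu z"]) auto
qed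

lemma mu_taylor:
  assumes "\<bar>t\<bar> \<le> 1"
  shows "\<bar>mu (x + t) - mu x - dmu x * t\<bar> \<le> t\<^sup>2"
proof -
  obtain z where z: "\<bar>z - x\<bar> \<le> \<bar>t\<bar>" "mu (x + t) - mu x = dmu z * t" using mu_diff_mvt by blast
  have "\<bar>dmu z - dmu x\<bar> \<le> 2 * \<bar>t\<bar> * dmu x"
    using z assms by (intro dmu_ratio_linear) auto
  also have "\<dots> \<le> 2 * \<bar>t\<bar> * (1 / 4)" by (intro mult_left_mono dmu_le_quarter) auto
  finally have "\<bar>dmu z - dmu x\<bar> \<le> \<bar>t\<bar>" by linarith
  hence "\<bar>dmu z - dmu x\<bar> * \<bar>t\<bar> \<le> \<bar>t\<bar> * \<bar>t\<bar>" by (intro mult_right_mono) auto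
  thus ?thesis using z by (simp add: power2_eq_square abs_mult[symmetric] algebra_simps)
qed

text \<open>The Bregman divergence of the softplus function is half its symmetrisation, up to a factor
  \<open>1 + O(t)\<close>, because both are \<open>t\<^sup>2\<close> times a value of \<open>\<mu>'\<close> on the same interval.\<close>

lemma softplus_bregman:
  assumes "\<bar>t\<bar> \<le> 1"
  shows "\<bar>2 * (ln (1 + exp x) - ln (1 + exp (x + t)) + mu (x + t) * t) - (mu (x + t) - mu x) * t\<bar>
           \<le> 2 * \<bar>t\<bar> * ((mu (x + t) - mu x) * t)"
proof (cases "t = 0")
  case False
  define d :: "nat \<Rightarrow> real \<Rightarrow> real"
    where "d m = (if m = 0 then (\<lambda>x. ln (1 + exp x)) else if m = 1 then mu else dmu)" for m
  define y where "y = x + t"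
  \<comment> \<open>The expansion is about the far endpoint \<open>y\<close>, because the divergence
    evaluates \<open>mu\<close> there.\<close>
  have "\<exists>z. (if x < y then x < z \<and> z < y else y < z \<and> z < x) \<and>
     ln (1 + exp x) = (\<Sum>m<2. d m y / fact m * (x - y) ^ m) + d 2 z / fact 2 * (x - y)\<^sup>2"
    by (rule Taylor[where a = "min x y" and b = "max x y"])
       (use False in \<open>auto simp: d_def y_def less_2_cases_iff softplus_has_derivative
          mu_has_derivative\<close>)
  then obtain z where z: "if x < y then x < z \<and> z < y else y < z \<and> z < x"
    "ln (1 + exp x) = ln (1 + exp y) - mu y * t + dmu z / 2 * t\<^sup>2"
    by (auto simp: d_def y_def numeral_2_eq_2 power2_eq_square)
  obtain s where s: "\<bar>s - x\<bar> \<le> \<bar>t\<bar>" "\<bar>s - (x + t)\<bar> \<le> \<bar>t\<bar>" "mu (x + t) - mu x = dmu s * t"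
    using mu_diff_mvt by blast
  have "\<bar>s - z\<bar> \<le> \<bar>t\<bar>" using z(1) s(1,2) unfolding y_def by (auto split: if_splits)
  hence "\<bar>dmu z - dmu s\<bar> \<le> 2 * \<bar>t\<bar> * dmu s" by (intro dmu_ratio_linear assms)
  hence "\<bar>(dmu z - dmu s) * t\<^sup>2\<bar> \<le> 2 * \<bar>t\<bar> * dmu s * t\<^sup>2"
    unfolding abs_mult by (auto intro!: mult_right_mono)
  moreover have "2 * (ln (1 + exp x) - ln (1 + exp (x + t)) + mu (x + t) * t) - (mu (x + t) - mu x) * t
      = (dmu z - dmu s) * t\<^sup>2"
    unfolding s(3) using z(2) by (simp add: y_def power2_eq_square algebra_simps)
  ultimately have "\<bar>2 * (ln (1 + exp x) - ln (1 + exp (x + t)) + mu (x + t) * t) - (mu (x + t) - mu x) * t\<bar>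
      \<le> 2 * \<bar>t\<bar> * dmu s * t\<^sup>2" by simp
  thus ?thesis unfolding s(3) by (simp only: power2_eq_square mult_ac)
qed simp

lemma softplus_convex: "ln (1 + exp x) + mu x * (y - x) \<le> ln (1 + exp (y::real))"
proof -
  have "mu x * (y - x) \<le> ln (1 + exp y) - ln (1 + exp x)"
  proof (rule convex_on_imp_above_tangent[where A = UNIV])
    show "convex_on UNIV (\<lambda>x::real. ln (1 + exp x))"
      by (rule f''_ge0_imp_convex[where f' = mu and f'' = dmu])
         (auto simp: softplus_has_derivative mu_has_derivative dmu_pos less_imp_le)
    show "((\<lambda>x. ln (1 + exp x)) has_real_derivative mu x) (at x within UNIV)"
      by (rule softplus_has_derivative)
  qed auto
  thus ?thesis by simp
qed

section \<open>Sums over ordered pairs of distinct nodes\<close>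

abbreviation odsum :: "nat \<Rightarrow> (nat \<Rightarrow> nat \<Rightarrow> real) \<Rightarrow> real" where
  "odsum n F \<equiv> (\<Sum>j\<in>{1..n}. \<Sum>k\<in>{1..n} - {j}. F j k)"

lemma odsum_swap: "odsum n F = odsum n (\<lambda>j k. F k j)"
proof -
  have "odsum n F = (\<Sum>j\<in>{1..n}. \<Sum>k\<in>{k \<in> {1..n}. k \<noteq> j}. F j k)"
    by (intro sum.cong) auto
  also have "\<dots> = (\<Sum>k\<in>{1..n}. \<Sum>j\<in>{j \<in> {1..n}. k \<noteq> j}. F j k)"
    by (rule sum.swap_restrict) auto
  also have "\<dots> = odsum n (\<lambda>j k. F k j)" by (intro sum.cong) auto
  finally show ?thesis .
qed

lemma finite_pairs [simp]: "finite (pairs n)"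
  by (rule finite_subset[of _ "{1..n} \<times> {1..n}"]) (auto simp: pairs_def)

lemma odsum_pairs: "odsum n F = (\<Sum>(j, k)\<in>pairs n. F j k + F k j)"
proof -
  have "odsum n F = (\<Sum>(j, k)\<in>Sigma {1..n} (\<lambda>j. {1..n} - {j}). F j k)"
    by (rule sum.Sigma) auto
  also have "Sigma {1..n} (\<lambda>j. {1..n} - {j}) = pairs n \<union> prod.swap ` pairs n"
    by (auto simp: pairs_def image_iff)
  also have "(\<Sum>(j, k)\<in>pairs n \<union> prod.swap ` pairs n. F j k) =
      (\<Sum>(j, k)\<in>pairs n. F j k) + (\<Sum>(j, k)\<in>prod.swap ` pairs n. F j k)"
    by (rule sum.union_disjoint) (simp, simp, auto simp: pairs_def)
  also have "(\<Sum>(j, k)\<in>prod.swap ` pairs n. F j k) = (\<Sum>(j, k)\<in>pairs n. F k j)"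
    by (subst sum.reindex) (auto simp: case_prod_beta intro: inj_onI)
  finally show ?thesis by (simp add: sum.distrib case_prod_beta)
qed

text \<open>Averaging the sum with its transpose. This passes from vertex form (row sums weighted by
  \<open>x j\<close>) to edge form (weight \<open>x j + x k\<close>), in which the quadratic form of
  a signless Laplacian is a sum of squares.\<close>

lemma odsum_symmetric_weight:
  assumes "\<And>j k. f j k = f k j"
  shows "odsum n (\<lambda>j k. x j * f j k) = odsum n (\<lambda>j k. (x j + x k) * f j k) / 2"
proof -
  have "odsum n (\<lambda>j k. (x j + x k) * f j k) = odsum n (\<lambda>j k. x j * f j k) + odsum n (\<lambda>j k. x k * f j k)"
    by (simp add: distrib_right sum.distrib)
  also have "odsum n (\<lambda>j k. x k * f j k) = odsum n (\<lambda>j k. x j * f j k)"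
    by (subst odsum_swap) (simp add: assms)
  finally show ?thesis by simp
qed

text \<open>Coercivity. With the diagonal included, the double sum is 2n times the squared norm plus
  twice the square of the sum of all \<open>x j\<close>; that last square is dropped, and the
  diagonal costs 4 times the squared norm. Hence the signless Laplacian of the complete graph has no
  eigenvalue below n - 2.\<close>

lemma odsum_square_ge:
  "real (2 * n) * (\<Sum>j=1..n. (x j)\<^sup>2) - 4 * (\<Sum>j=1..n. (x j)\<^sup>2) \<le> odsum n (\<lambda>j k. (x j + x k)\<^sup>2)"
proof -
  have "odsum n (\<lambda>j k. (x j + x k)\<^sup>2) = (\<Sum>j=1..n. (\<Sum>k=1..n. (x j + x k)\<^sup>2) - (x j + x j)\<^sup>2)"
    by (intro sum.cong refl) (simp add: sum_diff1)
  also have "\<dots> = (\<Sum>j=1..n. \<Sum>k=1..n. (x j)\<^sup>2 + (x k)\<^sup>2 + 2 * (x j * x k)) - 4 * (\<Sum>j=1..n. (x j)\<^sup>2)"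
    by (simp add: sum_subtractf sum_distrib_left power2_eq_square algebra_simps)
  also have "(\<Sum>j=1..n. \<Sum>k=1..n. (x j)\<^sup>2 + (x k)\<^sup>2 + 2 * (x j * x k)) =
      real (2 * n) * (\<Sum>j=1..n. (x j)\<^sup>2) + 2 * (\<Sum>j=1..n. x j)\<^sup>2"
    by (simp add: sum.distrib power2_eq_square sum_product flip: sum_distrib_left)
  finally show ?thesis by simp
qed

text \<open>Tychonoff in the product topology on functions: every coordinate is boxed, also one that
  labels no node. Coordinate 0 is pinned at 0 and later carries the parameters fixed by the
  null.\<close>

lemma compact_coordinate_box:
  assumes "0 \<le> t"
  shows "compact {x :: nat \<Rightarrow> real. x 0 = 0 \<and> (\<forall>m. \<bar>x m\<bar> \<le> t)}"
proof -
  let ?B = "\<lambda>m::nat. if m = 0 then {0} else {- t..t}"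
  have "compactin (product_topology (\<lambda>i. euclidean) UNIV) (PiE UNIV ?B)"
    by (subst compactin_PiE) auto
  hence "compact (PiE UNIV ?B)" by (simp add: euclidean_product_topology)
  moreover have "x \<in> PiE UNIV ?B \<longleftrightarrow> x 0 = 0 \<and> (\<forall>m. \<bar>x m\<bar> \<le> t)" for x
  proof
    assume x: "x \<in> PiE UNIV ?B"
    have xm: "x m \<in> ?B m" for m by (rule PiE_mem[OF x]) simp
    have "\<bar>x m\<bar> \<le> t" for m using xm[of m] assms by (cases "m = 0") auto
    thus "x 0 = 0 \<and> (\<forall>m. \<bar>x m\<bar> \<le> t)" using xm[of 0] by auto
  qed (auto simp: abs_le_iff minus_le_iff)
  hence "PiE UNIV ?B = {x :: nat \<Rightarrow> real. x 0 = 0 \<and> (\<forall>m. \<bar>x m\<bar> \<le> t)}" by blast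
  ultimately show ?thesis by simp
qed

text \<open>A maximiser over the box satisfies the one-sided first-order conditions. Pairing them with the
  point itself bounds its \<open>\<ell>\<^sub>1\<close> norm, and that bound rules out active box constraints.\<close>

lemma box_critical_point:
  fixes \<Phi> \<phi> :: "nat \<Rightarrow> nat \<Rightarrow> real \<Rightarrow> real" and g :: "nat \<Rightarrow> real" and p :: "nat \<Rightarrow> nat"
  assumes n: "4 \<le> n" and b: "0 < b" and t: "0 < t"
    and g: "\<And>j. j \<in> {1..n} \<Longrightarrow> \<bar>g j\<bar> \<le> G"
    and deriv: "\<And>j k y. (\<Phi> j k has_real_derivative \<phi> j k y) (at y)"
    and sym: "\<And>j k. \<phi> j k = \<phi> k j"
    and lower: "\<And>j k y. \<lbrakk>j \<in> {1..n}; k \<in> {1..n}; j \<noteq> k; 0 \<le> y; y \<le> 2 * t\<rbrakk> \<Longrightarrow> y / (2 * b) \<le> \<phi> j k y"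
    and upper: "\<And>j k y. \<lbrakk>j \<in> {1..n}; k \<in> {1..n}; j \<noteq> k; y \<le> 0; - 2 * t \<le> y\<rbrakk> \<Longrightarrow> \<phi> j k y \<le> y / (2 * b)"
    and large: "6 * b * G < (real n - 1) * t"
  obtains x where "x 0 = 0" "\<And>m. \<bar>x m\<bar> \<le> t"
    "\<And>m. 1 \<le> m \<Longrightarrow>
       (\<Sum>j\<in>{j\<in>{1..n}. p j = m}. g j - (\<Sum>k\<in>{1..n} - {j}. \<phi> j k (x (p j) + x (p k)))) = 0"
proof -
  define X where "X = {x :: nat \<Rightarrow> real. x 0 = 0 \<and> (\<forall>m. \<bar>x m\<bar> \<le> t)}"
  \<comment> \<open>The objective in reduced coordinates: node \<open>j\<close> is displaced by
    \<open>x (p j)\<close>. The factor 1/2 compensates that ordered pairs count each edge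
    twice.\<close>
  define F where "F x = (\<Sum>j\<in>{1..n}. g j * x (p j)) - odsum n (\<lambda>j k. \<Phi> j k (x (p j) + x (p k))) / 2"
    for x :: "nat \<Rightarrow> real"
  have coord: "continuous_on X (\<lambda>x. x i)" for i
    by (rule continuous_on_subset[OF continuous_on_product_coordinates]) simp
  have "continuous_on UNIV (\<Phi> j k)" for j k
    by (auto intro!: continuous_at_imp_continuous_on DERIV_isCont[OF deriv])
  hence "continuous_on X (\<lambda>x. \<Phi> j k (x (p j) + x (p k)))" for j k
    by (rule continuous_on_compose2)
       (auto intro!: continuous_intros coord)
  hence "continuous_on X F"
    unfolding F_def by (intro continuous_intros coord) auto
  moreover have "compact X" unfolding X_def using t by (intro compact_coordinate_box) simp
  moreover have "(\<lambda>_. 0) \<in> X" unfolding X_def using t by simp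
  ultimately obtain x where xX: "x \<in> X" and xmax: "\<And>y. y \<in> X \<Longrightarrow> F y \<le> F x"
    using continuous_attains_sup[of X F] by blast
  have x0: "x 0 = 0" and xt: "\<And>m. \<bar>x m\<bar> \<le> t" using xX unfolding X_def by auto
  define d where "d j = x (p j)" for j
  have dt: "\<bar>d j\<bar> \<le> t" for j unfolding d_def by (rule xt)
  define s where "s j = g j - (\<Sum>k\<in>{1..n} - {j}. \<phi> j k (d j + d k))" for j
  define D where "D m = (\<Sum>j\<in>{j\<in>{1..n}. p j = m}. s j)" for m
  have derivF: "((\<lambda>y. F (x(m := y))) has_real_derivative D m) (at (x m))" for m
  proof -
    let ?e = "\<lambda>j. if p j = m then 1 else 0 :: real"
    have upd: "((\<lambda>y. (x(m := y)) (p j)) has_real_derivative ?e j) (at (x m))" for j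
      by (cases "p j = m") auto
    have "((\<lambda>y. \<Phi> j k ((x(m := y)) (p j) + (x(m := y)) (p k))) has_real_derivative
         \<phi> j k (d j + d k) * (?e j + ?e k)) (at (x m))" for j k
    proof -
      have "((\<lambda>y. \<Phi> j k ((x(m := y)) (p j) + (x(m := y)) (p k))) has_real_derivative
         \<phi> j k ((x(m := x m)) (p j) + (x(m := x m)) (p k)) * (?e j + ?e k)) (at (x m))"
        by (rule DERIV_chain2[OF deriv DERIV_add[OF upd upd]])
      thus ?thesis by (simp add: d_def)
    qed
    hence "((\<lambda>y. F (x(m := y))) has_real_derivative (\<Sum>j\<in>{1..n}. g j * ?e j) -
         odsum n (\<lambda>j k. \<phi> j k (d j + d k) * (?e j + ?e k)) / 2) (at (x m))"
      unfolding F_def by (intro DERIV_diff DERIV_sum DERIV_cmult DERIV_cdivide upd)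
    also have "odsum n (\<lambda>j k. \<phi> j k (d j + d k) * (?e j + ?e k)) / 2 =
       odsum n (\<lambda>j k. ?e j * \<phi> j k (d j + d k))"
      by (subst odsum_symmetric_weight) (simp_all only: sym add.commute mult.commute)
    also have "(\<Sum>j\<in>{1..n}. g j * ?e j) - \<dots> = (\<Sum>j\<in>{1..n}. ?e j * s j)"
      by (simp only: s_def sum_subtractf right_diff_distrib sum_distrib_left mult.commute)
    also have "\<dots> = D m"
      unfolding D_def by (subst sum.inter_filter) (auto intro!: sum.cong)
    finally show ?thesis .
  qed
  have upX: "x(m := y) \<in> X" if "1 \<le> m" "\<bar>y\<bar> \<le> t" for m y
    using that xX unfolding X_def by auto
  have kkt1: "D m \<le> 0" if m: "1 \<le> m" and "x m < t" for m
  proof (rule ccontr)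
    assume "\<not> D m \<le> 0"
    then obtain e where e: "e > 0" "\<And>h. 0 < h \<Longrightarrow> h < e \<Longrightarrow> F (x(m := x m)) < F (x(m := x m + h))"
      using DERIV_pos_inc_right[OF derivF[of m]] by force
    define h where "h = min (e / 2) (t - x m)"
    have "0 < h" "h < e" "x m + h \<le> t" unfolding h_def using e that by auto
    moreover have "- t \<le> x m + h" using xt[of m] \<open>0 < h\<close> by linarith
    ultimately have "F x < F (x(m := x m + h))" "x(m := x m + h) \<in> X"
      using e(2)[of h] upX[OF m] by auto
    thus False using xmax by force
  qed
  have kkt2: "D m \<ge> 0" if m: "1 \<le> m" and "- t < x m" for m
  proof (rule ccontr)
    assume "\<not> D m \<ge> 0"
    then obtain e where e: "e > 0" "\<And>h. 0 < h \<Longrightarrow> h < e \<Longrightarrow> F (x(m := x m)) < F (x(m := x m - h))"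
      using DERIV_neg_dec_left[OF derivF[of m]] by force
    define h where "h = min (e / 2) (t + x m)"
    have "0 < h" "h < e" "- t \<le> x m - h" unfolding h_def using e that by auto
    moreover have "x m - h \<le> t" using xt[of m] \<open>0 < h\<close> by linarith
    ultimately have "F x < F (x(m := x m - h))" "x(m := x m - h) \<in> X"
      using e(2)[of h] upX[OF m] by auto
    thus False using xmax by force
  qed
  \<comment> \<open>Complementary slackness: interior coordinates have \<open>D m = 0\<close>, and
    at a face the sign of \<open>D m\<close> agrees with that of \<open>x m\<close>. Nothing is
    known about \<open>D 0\<close>, but \<open>x 0 = 0\<close>.\<close>
  have "0 \<le> x m * D m" for m
  proof (cases "m = 0")
    case False
    consider "x m > 0" | "x m < 0" | "x m = 0" by linarith
    thus ?thesis
      using kkt1[of m] kkt2[of m] t False by cases (auto intro: mult_nonneg_nonneg mult_nonpos_nonpos)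
  qed (simp add: x0)
  hence "0 \<le> (\<Sum>m\<in>p ` {1..n}. x m * D m)" by (intro sum_nonneg) auto
  also have "\<dots> = (\<Sum>m\<in>p ` {1..n}. \<Sum>j\<in>{j\<in>{1..n}. p j = m}. d j * s j)"
    unfolding D_def sum_distrib_left by (intro sum.cong refl) (auto simp: d_def)
  also have "\<dots> = (\<Sum>j\<in>{1..n}. d j * s j)"
    by (rule sum.image_gen[symmetric]) simp
  also have "\<dots> = (\<Sum>j\<in>{1..n}. d j * g j) - odsum n (\<lambda>j k. d j * \<phi> j k (d j + d k))"
    by (simp add: s_def right_diff_distrib sum_subtractf sum_distrib_left)
  also have "odsum n (\<lambda>j k. d j * \<phi> j k (d j + d k)) = odsum n (\<lambda>j k. (d j + d k) * \<phi> j k (d j + d k)) / 2"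
    by (rule odsum_symmetric_weight) (simp add: sym add.commute)
  finally have 1: "odsum n (\<lambda>j k. (d j + d k) * \<phi> j k (d j + d k)) / 2 \<le> (\<Sum>j\<in>{1..n}. d j * g j)" by simp
  define N1 N2 where "N1 = (\<Sum>j\<in>{1..n}. \<bar>d j\<bar>)" and "N2 = (\<Sum>j\<in>{1..n}. (d j)\<^sup>2)"
  have N1: "0 \<le> N1" unfolding N1_def by (intro sum_nonneg) auto
  have G: "0 \<le> G" using g[of 1] n by fastforce
  have pt: "(d j + d k)\<^sup>2 / (2 * b) \<le> (d j + d k) * \<phi> j k (d j + d k)"
    if "j \<in> {1..n}" "k \<in> {1..n} - {j}" for j k
  proof (cases "0 \<le> d j + d k")
    case True
    have "(d j + d k) * ((d j + d k) / (2 * b)) \<le> (d j + d k) * \<phi> j k (d j + d k)"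
      using True that dt[of j] dt[of k] by (intro mult_left_mono lower) auto
    thus ?thesis by (simp add: power2_eq_square)
  next
    case False
    have "(d j + d k) * ((d j + d k) / (2 * b)) \<le> (d j + d k) * \<phi> j k (d j + d k)"
      using False that dt[of j] dt[of k] by (intro mult_left_mono_neg upper) auto
    thus ?thesis by (simp add: power2_eq_square)
  qed
  have "(real (2 * n) * N2 - 4 * N2) / (2 * b) \<le> odsum n (\<lambda>j k. (d j + d k)\<^sup>2) / (2 * b)"
    unfolding N2_def using b by (intro divide_right_mono odsum_square_ge) auto
  also have "\<dots> = odsum n (\<lambda>j k. (d j + d k)\<^sup>2 / (2 * b))" by (simp add: sum_divide_distrib)
  also have "\<dots> \<le> odsum n (\<lambda>j k. (d j + d k) * \<phi> j k (d j + d k))" by (intro sum_mono pt)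
  also have "\<dots> \<le> 2 * (\<Sum>j\<in>{1..n}. d j * g j)" using 1 by simp
  also have "(\<Sum>j\<in>{1..n}. d j * g j) \<le> (\<Sum>j\<in>{1..n}. \<bar>d j\<bar> * G)"
  proof (intro sum_mono)
    fix j assume "j \<in> {1..n}"
    have "d j * g j \<le> \<bar>d j\<bar> * \<bar>g j\<bar>" by (metis abs_ge_self abs_mult)
    also have "\<dots> \<le> \<bar>d j\<bar> * G" using g \<open>j \<in> {1..n}\<close> by (intro mult_left_mono) auto
    finally show "d j * g j \<le> \<bar>d j\<bar> * G" .
  qed
  also have "(\<Sum>j\<in>{1..n}. \<bar>d j\<bar> * G) = N1 * G" by (simp add: N1_def sum_distrib_right)
  finally have "(real (2 * n) * N2 - 4 * N2) \<le> 2 * (N1 * G) * (2 * b)"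
    using b by (simp add: pos_divide_le_eq mult_ac)
  hence 2: "(real n - 2) * N2 \<le> 2 * b * G * N1" by (simp add: algebra_simps)
  have "N1\<^sup>2 \<le> real n * N2"
  proof -
    have "(\<Sum>j\<in>{1..n}. \<bar>d j\<bar> * 1)\<^sup>2 \<le> (\<Sum>j\<in>{1..n}. \<bar>d j\<bar>\<^sup>2) * (\<Sum>j\<in>{1..n}. 1\<^sup>2)"
      by (rule Cauchy_Schwarz_ineq_sum)
    thus ?thesis by (simp add: N1_def N2_def mult.commute)
  qed
  hence "(real n - 2) * N1\<^sup>2 \<le> real n * ((real n - 2) * N2)"
    using n by (simp add: mult_left_mono mult.left_commute)
  also have "\<dots> \<le> real n * (2 * b * G * N1)" using 2 by (intro mult_left_mono) auto
  \<comment> \<open>Here \<open>n \<ge> 4\<close> gives n \<le> 2 (n - 2).\<close>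
  also have "\<dots> \<le> (2 * (real n - 2)) * (2 * b * G * N1)"
    using n b G N1 by (intro mult_right_mono) auto
  finally have "(real n - 2) * N1\<^sup>2 \<le> (real n - 2) * (4 * b * G * N1)" by (simp add: mult_ac)
  hence "N1 * N1 \<le> (4 * b * G) * N1" using n by (simp add: power2_eq_square)
  hence N1le: "N1 \<le> 4 * b * G" using N1 b G by (cases "N1 = 0") auto
  \<comment> \<open>Origin of the 6 in \<open>large\<close>: 2bG outweighs the noise at one node,
    and 4bG is the bound on the l1 norm.\<close>
  have large': "G < ((real n - 1) * t - 4 * b * G) / (2 * b)"
    using large b by (simp add: field_simps)
  have abs_rest: "(\<Sum>k\<in>{1..n} - {j}. \<bar>d k\<bar>) \<le> 4 * b * G" for j
    by (rule order_trans[OF _ N1le]) (auto simp: N1_def intro!: sum_mono2)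
  have cardj: "real (card ({1..n} - {j})) = real n - 1" if "j \<in> {1..n}" for j
    using that n by (simp add: card_Diff_singleton of_nat_diff)
  have lo: "(\<Sum>k\<in>{1..n} - {j}. (t - \<bar>d k\<bar>) / (2 * b)) > G" if "j \<in> {1..n}" for j
  proof -
    have "(\<Sum>k\<in>{1..n} - {j}. (t - \<bar>d k\<bar>) / (2 * b)) =
        ((real n - 1) * t - (\<Sum>k\<in>{1..n} - {j}. \<bar>d k\<bar>)) / (2 * b)"
      using cardj[OF that] by (simp add: sum_subtractf flip: sum_divide_distrib)
    also have "\<dots> \<ge> ((real n - 1) * t - 4 * b * G) / (2 * b)"
      using abs_rest[of j] b by (intro divide_right_mono) auto
    finally show ?thesis using large' by simp
  qed
  \<comment> \<open>At the upper face \<open>d j + d k\<close> is at least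
    \<open>t - \<bar>d k\<bar>\<close>, which is nonnegative, so \<open>lower\<close> applies to
    every neighbour. The total exceeds the noise bound \<open>G\<close> and makes the score
    negative, contradicting \<open>kkt2\<close> for a block at that face.\<close>
  have at_top: "s j < 0" if j: "j \<in> {1..n}" "d j = t" for j
  proof -
    have "G < (\<Sum>k\<in>{1..n} - {j}. (t - \<bar>d k\<bar>) / (2 * b))" by (rule lo[OF j(1)])
    also have "\<dots> \<le> (\<Sum>k\<in>{1..n} - {j}. \<phi> j k (d j + d k))"
    proof (rule sum_mono)
      fix k assume k: "k \<in> {1..n} - {j}"
      have "(t - \<bar>d k\<bar>) / (2 * b) \<le> (d j + d k) / (2 * b)"
        using b j by (intro divide_right_mono) auto
      also have "\<dots> \<le> \<phi> j k (d j + d k)"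
        using j k dt[of k] by (intro lower) auto
      finally show "(t - \<bar>d k\<bar>) / (2 * b) \<le> \<phi> j k (d j + d k)" .
    qed
    finally show ?thesis unfolding s_def using g[OF j(1)] by linarith
  qed
  have at_bot: "s j > 0" if j: "j \<in> {1..n}" "d j = - t" for j
  proof -
    have "G < (\<Sum>k\<in>{1..n} - {j}. (t - \<bar>d k\<bar>) / (2 * b))" by (rule lo[OF j(1)])
    also have "\<dots> \<le> (\<Sum>k\<in>{1..n} - {j}. - \<phi> j k (d j + d k))"
    proof (rule sum_mono)
      fix k assume k: "k \<in> {1..n} - {j}"
      have "\<phi> j k (d j + d k) \<le> (d j + d k) / (2 * b)"
        using j k dt[of k] by (intro upper) auto
      also have "\<dots> \<le> - ((t - \<bar>d k\<bar>) / (2 * b))"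
        unfolding minus_divide_left using b j by (intro divide_right_mono) auto
      finally show "(t - \<bar>d k\<bar>) / (2 * b) \<le> - \<phi> j k (d j + d k)" by simp
    qed
    finally show ?thesis unfolding s_def using g[OF j(1)] by (simp add: sum_negf)
  qed
  have D0: "D m = 0" if m: "1 \<le> m" for m
  proof (cases "{j\<in>{1..n}. p j = m} = {}")
    case False
    have "x m \<noteq> t"
    proof
      assume xm: "x m = t"
      have "D m < (\<Sum>j\<in>{j\<in>{1..n}. p j = m}. 0)"
        unfolding D_def using False xm by (intro sum_strict_mono) (auto intro!: at_top simp: d_def)
      thus False using kkt2[OF m] xm t by simp
    qed
    moreover have "x m \<noteq> - t"
    proof
      assume xm: "x m = - t"
      have "(\<Sum>j\<in>{j\<in>{1..n}. p j = m}. 0) < D m"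
        unfolding D_def using False xm by (intro sum_strict_mono) (auto intro!: at_bot simp: d_def)
      thus False using kkt1[OF m] xm t by simp
    qed
    ultimately have "- t < x m" "x m < t" using xt[of m] by auto
    thus ?thesis using kkt1[OF m] kkt2[OF m] by force
  qed (simp only: D_def sum.empty)
  show thesis
    by (rule that[of x]) (use x0 xt D0 in \<open>simp_all add: D_def s_def d_def\<close>)
qed

section \<open>Score equations and maximum likelihood estimates\<close>

definition score :: "nat \<Rightarrow> (nat \<times> nat \<Rightarrow> bool) \<Rightarrow> (nat \<Rightarrow> real) \<Rightarrow> nat \<Rightarrow> real" where
  "score n A \<gamma> j = deg n A j - (\<Sum>k\<in>{1..n} - {j}. mu (\<gamma> j + \<gamma> k))"

lemma score_shift:
  "score n A (\<lambda>j. \<beta> j + d j) j =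
     score n A \<beta> j - (\<Sum>k\<in>{1..n} - {j}. mu (\<beta> j + \<beta> k + (d j + d k)) - mu (\<beta> j + \<beta> k))"
  unfolding score_def by (simp add: sum_subtractf add_ac)

lemma loglik_odsum:
  "loglik n A \<gamma> = (\<Sum>j\<in>{1..n}. \<gamma> j * deg n A j) - odsum n (\<lambda>j k. ln (1 + exp (\<gamma> j + \<gamma> k))) / 2"
proof -
  have "odsum n (\<lambda>j k. ln (1 + exp (\<gamma> j + \<gamma> k))) = (\<Sum>(j, k)\<in>pairs n. 2 * ln (1 + exp (\<gamma> j + \<gamma> k)))"
    unfolding odsum_pairs by (intro sum.cong) (auto simp: add.commute)
  thus ?thesis unfolding loglik_def by (simp add: case_prod_beta flip: sum_distrib_left)
qed

lemma sum_mult_score: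
  "(\<Sum>j\<in>{1..n}. h j * score n A \<gamma> j) =
     (\<Sum>j\<in>{1..n}. h j * deg n A j) - odsum n (\<lambda>j k. (h j + h k) * mu (\<gamma> j + \<gamma> k)) / 2"
proof -
  have "(\<Sum>j\<in>{1..n}. h j * score n A \<gamma> j) =
     (\<Sum>j\<in>{1..n}. h j * deg n A j) - odsum n (\<lambda>j k. h j * mu (\<gamma> j + \<gamma> k))"
    unfolding score_def by (simp add: right_diff_distrib sum_subtractf sum_distrib_left)
  also have "odsum n (\<lambda>j k. h j * mu (\<gamma> j + \<gamma> k)) = odsum n (\<lambda>j k. (h j + h k) * mu (\<gamma> j + \<gamma> k)) / 2"
    by (rule odsum_symmetric_weight) (simp add: add.commute)
  finally show ?thesis .
qed

text \<open>Concavity, edge by edge. It turns a critical point found inside a small box into a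
  maximiser over the whole parameter set.\<close>

lemma loglik_le_tangent:
  "loglik n A \<gamma>' \<le> loglik n A \<gamma> + (\<Sum>j\<in>{1..n}. (\<gamma>' j - \<gamma> j) * score n A \<gamma> j)"
proof -
  have "odsum n (\<lambda>j k. ln (1 + exp (\<gamma> j + \<gamma> k)) + ((\<gamma>' j - \<gamma> j) + (\<gamma>' k - \<gamma> k)) * mu (\<gamma> j + \<gamma> k))
      \<le> odsum n (\<lambda>j k. ln (1 + exp (\<gamma>' j + \<gamma>' k)))"
  proof (intro sum_mono)
    fix j k
    show "ln (1 + exp (\<gamma> j + \<gamma> k)) + ((\<gamma>' j - \<gamma> j) + (\<gamma>' k - \<gamma> k)) * mu (\<gamma> j + \<gamma> k)
         \<le> ln (1 + exp (\<gamma>' j + \<gamma>' k))"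
      using softplus_convex[of "\<gamma> j + \<gamma> k" "\<gamma>' j + \<gamma>' k"] by (simp add: algebra_simps)
  qed
  thus ?thesis
    unfolding loglik_odsum sum_mult_score by (simp add: sum.distrib left_diff_distrib sum_subtractf field_simps)
qed

text \<open>The critical point equation eliminates the degree term. Twice the likelihood gap becomes
  an ordered-pair sum of Bregman divergences and the score pairing becomes half the sum of their
  symmetrisations, so \<open>softplus_bregman\<close> compares them term by term. Since
  \<open>h j + h k\<close> is at most 2e in modulus, the relative error is 4e.\<close>

lemma loglik_gap:
  assumes crit: "(\<Sum>j\<in>{1..n}. h j * score n A (\<lambda>j. \<gamma> j + h j) j) = 0"
    and h: "\<And>j. j \<in> {1..n} \<Longrightarrow> \<bar>h j\<bar> \<le> e" and e: "e \<le> 1 / 2"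
  shows "0 \<le> (\<Sum>j\<in>{1..n}. h j * score n A \<gamma> j)"
    and "\<bar>2 * (loglik n A (\<lambda>j. \<gamma> j + h j) - loglik n A \<gamma>) - (\<Sum>j\<in>{1..n}. h j * score n A \<gamma> j)\<bar>
       \<le> 4 * e * (\<Sum>j\<in>{1..n}. h j * score n A \<gamma> j)"
proof -
  define x where "x j k = \<gamma> j + \<gamma> k" for j k
  define t where "t j k = h j + h k" for j k
  define S where "S = (\<Sum>j\<in>{1..n}. h j * score n A \<gamma> j)"
  define D where "D j k = ln (1 + exp (x j k)) - ln (1 + exp (x j k + t j k)) + mu (x j k + t j k) * t j k" for j k
  define E where "E j k = (mu (x j k + t j k) - mu (x j k)) * t j k" for j k
  have xt: "(\<gamma> j + h j) + (\<gamma> k + h k) = x j k + t j k" for j k by (simp add: x_def t_def)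
  have d: "(\<Sum>j\<in>{1..n}. h j * deg n A j) = odsum n (\<lambda>j k. mu (x j k + t j k) * t j k) / 2"
    using crit unfolding sum_mult_score xt by (simp add: t_def mult.commute)
  have S: "S = odsum n E / 2"
    unfolding S_def sum_mult_score d E_def x_def[symmetric] t_def[symmetric]
    by (simp add: left_diff_distrib sum_subtractf mult.commute[of "t _ _"] diff_divide_distrib)
  have L: "2 * (loglik n A (\<lambda>j. \<gamma> j + h j) - loglik n A \<gamma>) = odsum n D"
  proof -
    have "(\<Sum>j\<in>{1..n}. (\<gamma> j + h j) * deg n A j) = (\<Sum>j\<in>{1..n}. \<gamma> j * deg n A j) + (\<Sum>j\<in>{1..n}. h j * deg n A j)"
      by (simp add: distrib_right sum.distrib)
    thus ?thesis unfolding loglik_odsum xt d D_def x_def[symmetric]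
      by (simp add: sum.distrib sum_subtractf field_simps)
  qed
  have tb: "\<bar>t j k\<bar> \<le> 2 * e" if "j \<in> {1..n}" "k \<in> {1..n}" for j k
    using h[OF that(1)] h[OF that(2)] unfolding t_def by linarith
  have E0: "0 \<le> E j k" for j k
  proof -
    obtain z where "mu (x j k + t j k) - mu (x j k) = dmu z * t j k" using mu_diff_mvt by blast
    thus ?thesis unfolding E_def using dmu_pos[of z] by (simp add: mult.assoc)
  qed
  thus "0 \<le> (\<Sum>j\<in>{1..n}. h j * score n A \<gamma> j)" unfolding S_def[symmetric] S by (simp add: sum_nonneg)
  have pt: "\<bar>D j k - E j k / 2\<bar> \<le> 2 * e * E j k" if "j \<in> {1..n}" "k \<in> {1..n} - {j}" for j k
  proof -
    have tb': "\<bar>t j k\<bar> \<le> 2 * e" using that by (intro tb) auto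
    have "\<bar>2 * D j k - E j k\<bar> \<le> 2 * \<bar>t j k\<bar> * E j k"
      unfolding D_def E_def by (rule softplus_bregman) (use tb' e in linarith)
    also have "\<dots> \<le> 2 * (2 * e) * E j k" using tb' E0[of j k] by (intro mult_right_mono) auto
    finally show ?thesis by (simp add: abs_le_iff)
  qed
  have "\<bar>odsum n D - S\<bar> = \<bar>odsum n (\<lambda>j k. D j k - E j k / 2)\<bar>"
    unfolding S by (simp add: sum_subtractf sum_divide_distrib)
  also have "\<dots> \<le> odsum n (\<lambda>j k. \<bar>D j k - E j k / 2\<bar>)"
    by (rule order_trans[OF sum_abs]) (intro sum_mono sum_abs)
  also have "\<dots> \<le> odsum n (\<lambda>j k. 2 * e * E j k)" by (intro sum_mono pt)
  also have "\<dots> = 4 * e * S" unfolding S by (simp flip: sum_distrib_left)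
  finally show "\<bar>2 * (loglik n A (\<lambda>j. \<gamma> j + h j) - loglik n A \<gamma>) - (\<Sum>j\<in>{1..n}. h j * score n A \<gamma> j)\<bar>
       \<le> 4 * e * (\<Sum>j\<in>{1..n}. h j * score n A \<gamma> j)"
    unfolding L S_def .
qed

text \<open>Used for i \<le> r, where i < k holds throughout, so that \<open>A (i, k)\<close> is the
  stored upper-triangle entry of the edge.\<close>

definition edge_noise :: "nat \<Rightarrow> nat \<Rightarrow> (nat \<Rightarrow> real) \<Rightarrow> (nat \<times> nat \<Rightarrow> bool) \<Rightarrow> nat \<Rightarrow> real" where
  "edge_noise n r \<beta> A i = (\<Sum>k\<in>{r+1..n}. of_bool (A (i, k)) - mu (\<beta> i + \<beta> k))"

lemma score_minus_edge_noise:
  assumes i: "i \<in> {1..r}" and r: "r \<le> n"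
  shows "\<bar>score n A \<beta> i - edge_noise n r \<beta> A i\<bar> \<le> real r"
proof -
  have split: "{1..n} - {i} = ({1..r} - {i}) \<union> {r+1..n}" using i r by auto
  have cr: "card ({1..r} - {i}) \<le> r"
    by (rule order_trans[OF card_mono[of "{1..r}"]]) auto
  have "score n A \<beta> i = (\<Sum>k\<in>{1..n} - {i}. adj A i k - mu (\<beta> i + \<beta> k))"
    by (simp add: score_def deg_def sum_subtractf)
  also have "\<dots> = (\<Sum>k\<in>{1..r} - {i}. adj A i k - mu (\<beta> i + \<beta> k)) + (\<Sum>k\<in>{r+1..n}. adj A i k - mu (\<beta> i + \<beta> k))"
    unfolding split by (rule sum.union_disjoint) auto
  also have "(\<Sum>k\<in>{r+1..n}. adj A i k - mu (\<beta> i + \<beta> k)) = edge_noise n r \<beta> A i"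
    unfolding edge_noise_def using i by (intro sum.cong) (auto simp: adj_def)
  finally have "score n A \<beta> i - edge_noise n r \<beta> A i = (\<Sum>k\<in>{1..r} - {i}. adj A i k - mu (\<beta> i + \<beta> k))"
    by simp
  also have "\<bar>\<dots>\<bar> \<le> (\<Sum>k\<in>{1..r} - {i}. 1)"
  proof (intro order_trans[OF sum_abs] sum_mono)
    fix k show "\<bar>adj A i k - mu (\<beta> i + \<beta> k)\<bar> \<le> 1"
      using mu_bounds[of "\<beta> i + \<beta> k"] by (auto simp: adj_def)
  qed
  also have "\<dots> \<le> real r" using cr by simp
  finally show ?thesis .
qed

section \<open>Critical points, dual weights and score expansion under a curvature bound\<close>

locale curvature_bound =
  fixes n :: nat and \<beta> :: "nat \<Rightarrow> real" and b :: real
  assumes n4: "4 \<le> n" and b4: "4 \<le> b"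
    and dmu_ge: "\<And>j k. \<lbrakk>j \<in> {1..n}; k \<in> {1..n}; j \<noteq> k\<rbrakk> \<Longrightarrow> 1 / b \<le> dmu (\<beta> j + \<beta> k)"
begin

text \<open>\<open>p\<close> encodes the model: nodes with the same positive label share one
  displacement, and nodes labelled 0 stay at \<beta>. The likelihood is recentred at \<beta>, so
  that its linear term is the score there and every edge potential has slope 0 at the origin.
  \<open>t \<le> 1 / 4\<close> keeps each sum of two displacements within the range 1/2 of
  \<open>mu_diff_half\<close>.\<close>

lemma likelihood_critical_point:
  fixes p :: "nat \<Rightarrow> nat"
  assumes t: "0 < t" "t \<le> 1 / 4"
    and g: "\<And>j. j \<in> {1..n} \<Longrightarrow> \<bar>score n A \<beta> j\<bar> \<le> G"
    and large: "6 * b * G < (real n - 1) * t"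
  obtains x where "x 0 = 0" "\<And>m. \<bar>x m\<bar> \<le> t"
    "\<And>m. 1 \<le> m \<Longrightarrow> (\<Sum>j\<in>{j\<in>{1..n}. p j = m}. score n A (\<lambda>j. \<beta> j + x (p j)) j) = 0"
proof -
  define \<phi> where "\<phi> j k y = mu (\<beta> j + \<beta> k + y) - mu (\<beta> j + \<beta> k)" for j k y
  have b0: "0 < b" using b4 by simp
  have half: "\<exists>c. 1 / (2 * b) \<le> c \<and> \<phi> j k y = c * y"
    if "j \<in> {1..n}" "k \<in> {1..n}" "j \<noteq> k" "\<bar>y\<bar> \<le> 2 * t" for j k y
  proof -
    have "\<bar>y\<bar> \<le> 1 / 2" using that t by linarith
    from mu_diff_half[OF this, of "\<beta> j + \<beta> k"] obtain c
      where c: "dmu (\<beta> j + \<beta> k) / 2 \<le> c" "\<phi> j k y = c * y" unfolding \<phi>_def by blast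
    moreover have "1 / (2 * b) \<le> dmu (\<beta> j + \<beta> k) / 2" using dmu_ge[OF that(1-3)] by simp
    ultimately show ?thesis by (intro exI[of _ c]) auto
  qed
  obtain x where x: "x 0 = 0" "\<And>m. \<bar>x m\<bar> \<le> t"
    "\<And>m. 1 \<le> m \<Longrightarrow> (\<Sum>j\<in>{j\<in>{1..n}. p j = m}.
        score n A \<beta> j - (\<Sum>k\<in>{1..n} - {j}. \<phi> j k (x (p j) + x (p k)))) = 0"
  proof (rule box_critical_point[of n b t "score n A \<beta>" G
      "\<lambda>j k y. ln (1 + exp (\<beta> j + \<beta> k + y)) - mu (\<beta> j + \<beta> k) * y" \<phi> p])
    show "((\<lambda>y. ln (1 + exp (\<beta> j + \<beta> k + y)) - mu (\<beta> j + \<beta> k) * y) has_real_derivative \<phi> j k y) (at y)"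
      for j k y
      unfolding \<phi>_def
      by (auto intro!: derivative_eq_intros simp: mu_def)
    show "\<phi> j k = \<phi> k j" for j k by (simp add: \<phi>_def fun_eq_iff add.commute)
    show "y / (2 * b) \<le> \<phi> j k y"
      if "j \<in> {1..n}" "k \<in> {1..n}" "j \<noteq> k" "0 \<le> y" "y \<le> 2 * t" for j k y
    proof -
      have "\<bar>y\<bar> \<le> 2 * t" using that by simp
      then obtain c where c: "1 / (2 * b) \<le> c" "\<phi> j k y = c * y"
        using half \<open>j \<in> {1..n}\<close> \<open>k \<in> {1..n}\<close> \<open>j \<noteq> k\<close> by blast
      show ?thesis using mult_right_mono[OF c(1) that(4)] c(2) by simp
    qed
    show "\<phi> j k y \<le> y / (2 * b)"
      if "j \<in> {1..n}" "k \<in> {1..n}" "j \<noteq> k" "y \<le> 0" "- 2 * t \<le> y" for j k y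
    proof -
      have "\<bar>y\<bar> \<le> 2 * t" using that by simp
      then obtain c where c: "1 / (2 * b) \<le> c" "\<phi> j k y = c * y"
        using half \<open>j \<in> {1..n}\<close> \<open>k \<in> {1..n}\<close> \<open>j \<noteq> k\<close> by blast
      show ?thesis using mult_right_mono_neg[OF c(1) that(4)] c(2) by simp
    qed
  qed (use n4 b0 t g large in auto)
  show thesis
    by (rule that[of x]) (use x in \<open>simp_all add: score_shift[of n A \<beta> "\<lambda>j. x (p j)"] \<phi>_def\<close>)
qed

text \<open>The dual system is the critical point equation of a quadratic objective, so the box
  lemma both solves it and bounds the solution entrywise. The size b / n reflects a right-hand side
  of at most 1/4 against row sums of V of at least (n - 1) / b.\<close>

lemma dual_weights:
  assumes i: "i \<in> {1..n}"
  obtains w where "\<And>j. \<bar>w j\<bar> \<le> 5 * b / real n"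
    "\<And>j. j \<in> {1..n} \<Longrightarrow> (\<Sum>k\<in>{1..n} - {j}. dmu (\<beta> j + \<beta> k) * (w j + w k)) =
        (if j = i then 0 else dmu (\<beta> i + \<beta> j))"
proof -
  define t where "t = 5 * b / real n"
  have b0: "0 < b" using b4 by simp
  have t0: "0 < t" using n4 b0 by (simp add: t_def)
  have dmu_y: "1 / (2 * b) \<le> dmu (\<beta> j + \<beta> k)"
    if "j \<in> {1..n}" "k \<in> {1..n}" "j \<noteq> k" for j k
    using dmu_ge[OF that] b0 by (smt (verit) divide_left_mono mult_pos_pos)
  obtain w where w: "w 0 = 0" "\<And>m. \<bar>w m\<bar> \<le> t"
    "\<And>m. 1 \<le> m \<Longrightarrow> (\<Sum>j\<in>{j\<in>{1..n}. id j = m}.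
        (if j = i then 0 else dmu (\<beta> i + \<beta> j)) - (\<Sum>k\<in>{1..n} - {j}. dmu (\<beta> j + \<beta> k) * (w (id j) + w (id k)))) = 0"
  proof (rule box_critical_point[of n b t "\<lambda>j. if j = i then 0 else dmu (\<beta> i + \<beta> j)" "1/4"
      "\<lambda>j k y. dmu (\<beta> j + \<beta> k) * y\<^sup>2 / 2" "\<lambda>j k y. dmu (\<beta> j + \<beta> k) * y" id])
    show "((\<lambda>y. dmu (\<beta> j + \<beta> k) * y\<^sup>2 / 2) has_real_derivative dmu (\<beta> j + \<beta> k) * y) (at y)"
      for j k y
      by (auto intro!: derivative_eq_intros)
    show "y / (2 * b) \<le> dmu (\<beta> j + \<beta> k) * y"
      if "j \<in> {1..n}" "k \<in> {1..n}" "j \<noteq> k" "0 \<le> y" "y \<le> 2 * t" for j k y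
      using mult_right_mono[OF dmu_y[OF that(1-3)] that(4)] by simp
    show "dmu (\<beta> j + \<beta> k) * y \<le> y / (2 * b)"
      if "j \<in> {1..n}" "k \<in> {1..n}" "j \<noteq> k" "y \<le> 0" "- 2 * t \<le> y" for j k y
      using mult_right_mono_neg[OF dmu_y[OF that(1-3)] that(4)] by simp
    \<comment> \<open>The left side is 3b/2, the right side at least 15b/4 because n \<ge>
      4.\<close>
    show "6 * b * (1 / 4) < (real n - 1) * t"
      using n4 b0 by (simp add: t_def field_simps)
    show "\<bar>if j = i then 0 else dmu (\<beta> i + \<beta> j)\<bar> \<le> 1 / 4" for j
      using dmu_le_quarter[of "\<beta> i + \<beta> j"] dmu_pos[of "\<beta> i + \<beta> j"] by auto
  qed (use n4 b0 t0 in \<open>auto simp: add.commute\<close>)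
  show thesis
  proof (rule that[of w])
    show "\<bar>w j\<bar> \<le> 5 * b / real n" for j using w(2)[of j] by (simp add: t_def)
    fix j assume j: "j \<in> {1..n}"
    have single: "{j'\<in>{1..n}. id j' = j} = {j}" using j by auto
    show "(\<Sum>k\<in>{1..n} - {j}. dmu (\<beta> j + \<beta> k) * (w j + w k)) = (if j = i then 0 else dmu (\<beta> i + \<beta> j))"
      using w(3)[of j, unfolded single] j by simp
  qed
qed

text \<open>The nuisance sum \<open>\<Sum>k. \<mu>'(\<beta>\<^sub>i + \<beta>\<^sub>k) * d k\<close> is of the same order as the leading term if estimated
  coordinatewise. Testing the score equations against the dual weights \<open>w\<close> turns it into
  \<open>w\<close>-weighted noise, which is of lower order.\<close>

lemma score_expansion:
  assumes i: "i \<in> {1..r}" and r: "r \<le> n"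
    and w: "\<And>j. j \<in> {1..n} \<Longrightarrow> \<bar>w j\<bar> \<le> W"
    and weq: "\<And>j. j \<in> {1..n} \<Longrightarrow> (\<Sum>k\<in>{1..n} - {j}. dmu (\<beta> j + \<beta> k) * (w j + w k)) =
        (if j = i then 0 else dmu (\<beta> i + \<beta> j))"
    and g: "\<And>j. j \<in> {1..n} \<Longrightarrow> \<bar>score n A \<beta> j\<bar> \<le> G"
    and wg: "\<bar>\<Sum>j\<in>{1..n}. w j * score n A \<beta> j\<bar> \<le> B"
    and d: "\<And>j. j \<in> {1..n} \<Longrightarrow> \<bar>d j\<bar> \<le> t" and t: "t \<le> 1 / 4"
    and zero: "\<And>j. j \<in> {r+1..n} \<Longrightarrow> score n A (\<lambda>j. \<beta> j + d j) j = 0"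
  shows "\<bar>score n A (\<lambda>j. \<beta> j + d j) i - (\<Sum>k\<in>{r+1..n}. of_bool (A (i, k)) - mu (\<beta> i + \<beta> k))
           + (\<Sum>k\<in>{r+1..n}. dmu (\<beta> i + \<beta> k)) * d i\<bar>
     \<le> B + real n * (W * (real n * (2 * t)\<^sup>2)) + real r * (W * (G + real n * (2 * t)))
         + real n * (2 * t)\<^sup>2 + 2 * real r"
proof -
  define N where "N = {1..n}"
  define g where "g = score n A \<beta>"
  define s where "s = score n A (\<lambda>j. \<beta> j + d j)"
  define v where "v j k = dmu (\<beta> j + \<beta> k)" for j k
  define \<rho> where "\<rho> j = (\<Sum>k\<in>N - {j}. mu (\<beta> j + \<beta> k + (d j + d k)) - mu (\<beta> j + \<beta> k) - v j k * (d j + d k))" for j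
  define T where "T = (\<Sum>k\<in>N - {i}. v i k * d k)"
  have iN: "i \<in> N" using i r by (auto simp: N_def)
  have t0: "0 \<le> t" using d[of i] iN by (force simp: N_def)
  have W0: "0 \<le> W" using w[of i] iN by (force simp: N_def)
  have G0: "0 \<le> G" using assms(5)[of i] iN by (force simp: N_def)
  have cardN: "card (N - {j}) \<le> n" for j
    by (rule order_trans[OF card_mono[of N]]) (auto simp: N_def)
  have dd: "\<bar>d j + d k\<bar> \<le> 2 * t" if "j \<in> N" "k \<in> N" for j k
    using d[of j] d[of k] that by (fastforce simp: N_def)
  have \<rho>b: "\<bar>\<rho> j\<bar> \<le> real n * (2 * t)\<^sup>2" if "j \<in> N" for j
  proof -
    have "\<bar>\<rho> j\<bar> \<le> (\<Sum>k\<in>N - {j}. (2 * t)\<^sup>2)"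
      unfolding \<rho>_def
    proof (intro order_trans[OF sum_abs] sum_mono)
      fix k assume k: "k \<in> N - {j}"
      have a: "\<bar>d j + d k\<bar> \<le> 2 * t" using dd that k by auto
      have "\<bar>mu (\<beta> j + \<beta> k + (d j + d k)) - mu (\<beta> j + \<beta> k) - v j k * (d j + d k)\<bar> \<le> (d j + d k)\<^sup>2"
        unfolding v_def by (rule mu_taylor) (use a t in linarith)
      also have "\<dots> \<le> (2 * t)\<^sup>2" using power_mono[OF a, of 2] by simp
      finally show "\<bar>mu (\<beta> j + \<beta> k + (d j + d k)) - mu (\<beta> j + \<beta> k) - v j k * (d j + d k)\<bar> \<le> (2 * t)\<^sup>2" .
    qed
    also have "\<dots> = real (card (N - {j})) * (2 * t)\<^sup>2" by simp
    also have "\<dots> \<le> real n * (2 * t)\<^sup>2" using cardN by (intro mult_right_mono) auto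
    finally show ?thesis .
  qed
  have s_eq: "s j = g j - (\<Sum>k\<in>N - {j}. v j k * (d j + d k)) - \<rho> j" for j
    unfolding s_def g_def \<rho>_def score_shift N_def by (simp add: sum_subtractf)
  have sb: "\<bar>s j\<bar> \<le> G + real n * (2 * t)" if "j \<in> N" for j
  proof -
    have "\<bar>\<Sum>k\<in>N - {j}. mu (\<beta> j + \<beta> k + (d j + d k)) - mu (\<beta> j + \<beta> k)\<bar> \<le> (\<Sum>k\<in>N - {j}. 2 * t)"
      by (intro order_trans[OF sum_abs] sum_mono order_trans[OF mu_lipschitz] dd) (use that in auto)
    also have "\<dots> = real (card (N - {j})) * (2 * t)" by simp
    also have "\<dots> \<le> real n * (2 * t)" using cardN t0 by (intro mult_right_mono) auto
    finally show ?thesis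
      unfolding s_def score_shift N_def[symmetric] using assms(5)[of j] that by (auto simp: N_def)
  qed
  have vsym: "v j k = v k j" for j k by (simp add: v_def add.commute)
  \<comment> \<open>V is self-adjoint: the pairing of w with V d equals the pairing of d with V w,
    and the equation for w makes the latter the nuisance sum \<open>T\<close>.\<close>
  have "odsum n (\<lambda>j k. w j * (v j k * (d j + d k))) = odsum n (\<lambda>j k. (w j + w k) * (v j k * (d j + d k))) / 2"
    by (rule odsum_symmetric_weight) (simp add: vsym add.commute)
  also have "odsum n (\<lambda>j k. (w j + w k) * (v j k * (d j + d k))) = odsum n (\<lambda>j k. (d j + d k) * (v j k * (w j + w k)))"
    by (simp add: mult_ac)
  also have "\<dots> / 2 = odsum n (\<lambda>j k. d j * (v j k * (w j + w k)))"
    by (rule odsum_symmetric_weight[symmetric]) (simp add: vsym add.commute)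
  also have "\<dots> = (\<Sum>j\<in>N. d j * (if j = i then 0 else v i j))"
    unfolding sum_distrib_left[symmetric] N_def v_def by (intro sum.cong refl) (simp only: weq)
  also have "\<dots> = T"
    unfolding T_def using iN by (subst sum.remove[of N i]) (auto simp: N_def intro!: sum.cong)
  finally have oT: "odsum n (\<lambda>j k. w j * (v j k * (d j + d k))) = T" .
  have "(\<Sum>j\<in>N. w j * s j) = (\<Sum>j\<in>N. w j * g j) - odsum n (\<lambda>j k. w j * (v j k * (d j + d k))) - (\<Sum>j\<in>N. w j * \<rho> j)"
    unfolding s_eq N_def by (simp add: right_diff_distrib sum_subtractf sum_distrib_left)
  hence T_eq: "T = (\<Sum>j\<in>N. w j * g j) - (\<Sum>j\<in>N. w j * \<rho> j) - (\<Sum>j\<in>N. w j * s j)"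
    unfolding oT by simp
  \<comment> \<open>Scores vanish beyond \<open>r\<close>; the r remaining ones may be bounded
    crudely because they carry the small weights.\<close>
  have "(\<Sum>j\<in>N. w j * s j) = (\<Sum>j\<in>{1..r}. w j * s j)"
    using r zero by (intro sum.mono_neutral_right) (auto simp: N_def s_def)
  also have "\<bar>\<dots>\<bar> \<le> (\<Sum>j\<in>{1..r}. W * (G + real n * (2 * t)))"
    using r by (intro order_trans[OF sum_abs] sum_mono)
      (auto simp: abs_mult N_def intro!: mult_mono w W0 sb[unfolded N_def])
  finally have b1: "\<bar>\<Sum>j\<in>N. w j * s j\<bar> \<le> real r * (W * (G + real n * (2 * t)))" by simp
  have "\<bar>\<Sum>j\<in>N. w j * \<rho> j\<bar> \<le> (\<Sum>j\<in>N. W * (real n * (2 * t)\<^sup>2))"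
    unfolding abs_mult
    by (intro order_trans[OF sum_abs] sum_mono, unfold abs_mult, intro mult_mono w W0 \<rho>b)
       (auto simp: N_def)
  hence b2: "\<bar>\<Sum>j\<in>N. w j * \<rho> j\<bar> \<le> real n * (W * (real n * (2 * t)\<^sup>2))" by (simp add: N_def)
  have b3: "\<bar>\<Sum>j\<in>N. w j * g j\<bar> \<le> B" using wg by (simp add: N_def g_def)
  have split: "N - {i} = ({1..r} - {i}) \<union> {r+1..n}" using i r by (auto simp: N_def)
  have split_sum: "(\<Sum>k\<in>N - {i}. f k) = (\<Sum>k\<in>{1..r} - {i}. f k) + (\<Sum>k\<in>{r+1..n}. f k)" for f :: "nat \<Rightarrow> real"
    unfolding split by (rule sum.union_disjoint) auto
  have cr: "card ({1..r} - {i}) \<le> r"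
    by (rule order_trans[OF card_mono[of "{1..r}"]]) auto
  have b4: "\<bar>g i - (\<Sum>k\<in>{r+1..n}. of_bool (A (i, k)) - mu (\<beta> i + \<beta> k))\<bar> \<le> real r"
    using score_minus_edge_noise[OF i r, of A \<beta>] by (simp add: g_def edge_noise_def)
  \<comment> \<open>Together with \<open>b4\<close> this accounts for the term
    \<open>2 * real r\<close>: edges among the first r nodes are dropped once from the noise and
    once from the variance.\<close>
  have "\<bar>\<Sum>k\<in>{1..r} - {i}. v i k * d i\<bar> \<le> (\<Sum>k\<in>{1..r} - {i}. 1)"
  proof (intro order_trans[OF sum_abs] sum_mono)
    fix k
    have "\<bar>v i k * d i\<bar> \<le> 1 * 1" unfolding abs_mult v_def
      using dmu_pos[of "\<beta> i + \<beta> k"] dmu_le_quarter[of "\<beta> i + \<beta> k"] d[of i] iN t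
      by (intro mult_mono) (force simp: N_def)+
    thus "\<bar>v i k * d i\<bar> \<le> 1" by simp
  qed
  also have "\<dots> \<le> real r" using cr by simp
  finally have b5: "\<bar>\<Sum>k\<in>{1..r} - {i}. v i k * d i\<bar> \<le> real r" .
  have "(\<Sum>k\<in>N - {i}. v i k * (d i + d k)) = (\<Sum>k\<in>N - {i}. v i k * d i) + T"
    unfolding T_def by (simp add: distrib_left sum.distrib)
  also have "(\<Sum>k\<in>N - {i}. v i k * d i) = (\<Sum>k\<in>{1..r} - {i}. v i k * d i) + (\<Sum>k\<in>{r+1..n}. v i k) * d i"
    unfolding split_sum by (simp add: sum_distrib_right)
  finally have "s i - (\<Sum>k\<in>{r+1..n}. of_bool (A (i, k)) - mu (\<beta> i + \<beta> k)) + (\<Sum>k\<in>{r+1..n}. v i k) * d i =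
     (g i - (\<Sum>k\<in>{r+1..n}. of_bool (A (i, k)) - mu (\<beta> i + \<beta> k)))
     - (\<Sum>k\<in>{1..r} - {i}. v i k * d i) - T - \<rho> i"
    unfolding s_eq by simp
  thus ?thesis unfolding s_def[symmetric] v_def[symmetric]
    using b1 b2 b3 b4 b5 \<rho>b[OF iN] unfolding T_eq by linarith
qed

end

section \<open>Deterministic expansion of the likelihood ratio\<close>

definition edge_var :: "nat \<Rightarrow> nat \<Rightarrow> (nat \<Rightarrow> real) \<Rightarrow> nat \<Rightarrow> real" where
  "edge_var n r \<beta> i = (\<Sum>k\<in>{r+1..n}. dmu (\<beta> i + \<beta> k))"

definition edge_zscore :: "nat \<Rightarrow> nat \<Rightarrow> (nat \<Rightarrow> real) \<Rightarrow> (nat \<times> nat \<Rightarrow> bool) \<Rightarrow> nat \<Rightarrow> real" where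
  "edge_zscore n r \<beta> A i = edge_noise n r \<beta> A i / sqrt (edge_var n r \<beta> i)"

definition sum_sq :: "nat \<Rightarrow> (nat \<Rightarrow> real) \<Rightarrow> real" where
  "sum_sq r z = (\<Sum>i\<in>{1..r}. (z i)\<^sup>2)"

definition centred_sum_sq :: "nat \<Rightarrow> (nat \<Rightarrow> real) \<Rightarrow> real" where
  "centred_sum_sq r z = (\<Sum>i\<in>{1..r}. (z i - (\<Sum>j\<in>{1..r}. z j) / real r)\<^sup>2)"

lemma critical_point_maximizes:
  assumes "\<gamma> \<in> S" "\<And>\<gamma>'. \<gamma>' \<in> S \<Longrightarrow> (\<Sum>j\<in>{1..n}. (\<gamma>' j - \<gamma> j) * score n A \<gamma> j) = 0"
  shows "has_max (loglik n A) S" "Sup (loglik n A ` S) = loglik n A \<gamma>"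
proof -
  have le: "loglik n A \<gamma>' \<le> loglik n A \<gamma>" if "\<gamma>' \<in> S" for \<gamma>'
    using loglik_le_tangent[of n A \<gamma>' \<gamma>] assms(2)[OF that] by simp
  show "has_max (loglik n A) S" unfolding has_max_def using le assms(1) by blast
  show "Sup (loglik n A ` S) = loglik n A \<gamma>"
    by (rule cSup_eq_maximum) (use le assms(1) in auto)
qed

text \<open>Here \<open>y\<close> is the noise, \<open>s\<close> the score at the restricted
  estimate and \<open>d\<close> the displacement of the full one. Both \<open>s\<close> and
  \<open>v * d\<close> equal \<open>y\<close> up to \<open>E\<close>, so \<open>v * (d * s)\<close>
  is \<open>y\<^sup>2\<close> up to products that \<open>E \<le> Y\<close> absorbs. The constants 6
  and 8 are those of the homogeneous case.\<close>

lemma fixed_null_algebra: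
  fixes s d y v :: real
  assumes "\<bar>s - y\<bar> \<le> E" "\<bar>- y + v * d\<bar> \<le> E" "\<bar>y\<bar> \<le> Y" "E \<le> Y" "0 < v0" "v0 \<le> v"
  shows "\<bar>d * s - y\<^sup>2 / v\<bar> \<le> 6 * Y * E / v0" "\<bar>d * s\<bar> \<le> 8 * Y\<^sup>2 / v0"
proof -
  have v: "0 < v" using assms by simp
  define e f where "e = s - y" and "f = v * d - y"
  have e: "\<bar>e\<bar> \<le> E" and f: "\<bar>f\<bar> \<le> E" using assms(1,2) by (auto simp: e_def f_def)
  have E0: "0 \<le> E" and Y0: "0 \<le> Y" using assms(1,4) by auto
  have eq: "v * (d * s) = (y + f) * (y + e)" unfolding e_def f_def by simp
  have eq': "d * s = (y + f) * (y + e) / v" using eq v by (simp add: field_simps)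
  have "d * s - y\<^sup>2 / v = (y * e + f * y + f * e) / v"
    unfolding eq' by (simp add: power2_eq_square algebra_simps flip: diff_divide_distrib)
  also have "\<bar>\<dots>\<bar> = \<bar>y * e + f * y + f * e\<bar> / v" using v by simp
  also have "\<bar>y * e + f * y + f * e\<bar> \<le> \<bar>y\<bar> * \<bar>e\<bar> + \<bar>f\<bar> * \<bar>y\<bar> + \<bar>f\<bar> * \<bar>e\<bar>"
    unfolding abs_mult[symmetric] by linarith
  also have "\<dots> \<le> Y * E + E * Y + Y * E"
    using e f assms E0 Y0 by (intro add_mono mult_mono) auto
  also have "\<dots> \<le> 6 * Y * E" using E0 Y0 by simp
  finally have "\<bar>d * s - y\<^sup>2 / v\<bar> \<le> 6 * Y * E / v" using v by (simp add: divide_right_mono)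
  also have "\<dots> \<le> 6 * Y * E / v0" using assms E0 Y0 by (intro divide_left_mono) auto
  finally show "\<bar>d * s - y\<^sup>2 / v\<bar> \<le> 6 * Y * E / v0" .
  have "\<bar>d * s\<bar> = \<bar>y + f\<bar> * \<bar>y + e\<bar> / v" unfolding eq' using v by (simp add: abs_mult)
  also have "\<dots> \<le> (2 * Y) * (2 * Y) / v"
    using e f assms v by (intro divide_right_mono mult_mono) auto
  also have "\<dots> \<le> 8 * Y\<^sup>2 / v" using v by (intro divide_right_mono) (auto simp: power2_eq_square)
  also have "\<dots> \<le> 8 * Y\<^sup>2 / v0" using assms by (intro divide_left_mono) auto
  finally show "\<bar>d * s\<bar> \<le> 8 * Y\<^sup>2 / v0" .
qed

text \<open>The restricted scores of the block sum to 0, which determines the common displacement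
  \<open>c\<close>: \<open>v * c\<close> is the mean of the \<open>y i\<close> up to an error.
  Substituting it centres the scores, \<open>s i = (y i - ybar) + (e i - ebar)\<close>, and this is
  where one degree of freedom is lost.\<close>

lemma homog_null_algebra:
  fixes s d y :: "nat \<Rightarrow> real" and v c :: real
  assumes r: "1 \<le> r" and s: "\<And>i. i \<in> {1..r} \<Longrightarrow> \<bar>s i - y i + v * c\<bar> \<le> E"
    and d: "\<And>i. i \<in> {1..r} \<Longrightarrow> \<bar>- y i + v * d i\<bar> \<le> E"
    and y: "\<And>i. i \<in> {1..r} \<Longrightarrow> \<bar>y i\<bar> \<le> Y" and EY: "E \<le> Y" and v0: "0 < v0" "v0 \<le> v"
    and s0: "(\<Sum>i\<in>{1..r}. s i) = 0"
  shows "\<bar>(\<Sum>i\<in>{1..r}. (d i - c) * s i) - centred_sum_sq r (\<lambda>i. y i / sqrt v)\<bar> \<le> real r * (6 * Y * E / v0)"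
    and "\<bar>\<Sum>i\<in>{1..r}. (d i - c) * s i\<bar> \<le> real r * (8 * Y\<^sup>2 / v0)"
proof -
  have v: "0 < v" using v0 by simp
  define e f where "e i = s i - y i + v * c" and "f i = v * d i - y i" for i
  define ybar ebar where "ybar = (\<Sum>i\<in>{1..r}. y i) / r" and "ebar = (\<Sum>i\<in>{1..r}. e i) / r"
  have e: "\<bar>e i\<bar> \<le> E" and f: "\<bar>f i\<bar> \<le> E" if "i \<in> {1..r}" for i
    using s[OF that] d[OF that] by (auto simp: e_def f_def)
  have E0: "0 \<le> E" using s[of 1] r by force
  have Y0: "0 \<le> Y" using E0 EY by simp
  have avg: "\<bar>(\<Sum>i\<in>{1..r}. a i) / real r\<bar> \<le> K" if "\<And>i. i \<in> {1..r} \<Longrightarrow> \<bar>a i\<bar> \<le> K" for a :: "nat \<Rightarrow> real" and K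
  proof -
    have "\<bar>\<Sum>i\<in>{1..r}. a i\<bar> \<le> (\<Sum>i\<in>{1..r}. K)"
      by (intro order_trans[OF sum_abs] sum_mono that)
    thus ?thesis using r by (simp add: divide_simps mult.commute)
  qed
  have ybar: "\<bar>ybar\<bar> \<le> Y" unfolding ybar_def by (rule avg[OF y])
  have ebar: "\<bar>ebar\<bar> \<le> E" unfolding ebar_def by (rule avg[OF e])
  have "(\<Sum>i\<in>{1..r}. s i) = (\<Sum>i\<in>{1..r}. y i) + (\<Sum>i\<in>{1..r}. e i) - real r * (v * c)"
    by (simp add: e_def sum.distrib sum_subtractf)
  hence vc: "v * c = ybar + ebar" using s0 r by (simp add: ybar_def ebar_def field_simps)
  have s_eq: "s i = (y i - ybar) + (e i - ebar)" for i
    using vc by (simp add: e_def)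
  have cs: "v * centred_sum_sq r (\<lambda>i. y i / sqrt v) = (\<Sum>i\<in>{1..r}. (y i - ybar)\<^sup>2)"
    unfolding centred_sum_sq_def sum_distrib_left
  proof (intro sum.cong refl)
    fix i
    have "(\<Sum>j\<in>{1..r}. y j / sqrt v) / real r = ybar / sqrt v"
      by (simp add: ybar_def flip: sum_divide_distrib)
    thus "v * (y i / sqrt v - (\<Sum>j\<in>{1..r}. y j / sqrt v) / real r)\<^sup>2 = (y i - ybar)\<^sup>2"
      using v by (simp add: power_divide flip: diff_divide_distrib)
  qed
  have z: "(\<Sum>i\<in>{1..r}. y i - ybar) = 0" using r by (simp add: sum_subtractf ybar_def)
  have "(\<Sum>i\<in>{1..r}. (y i - ybar)\<^sup>2) = (\<Sum>i\<in>{1..r}. (y i - ybar) * y i) - ybar * (\<Sum>i\<in>{1..r}. y i - ybar)"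
    unfolding sum_distrib_left sum_subtractf[symmetric] by (intro sum.cong) (auto simp: power2_eq_square algebra_simps)
  hence sq: "(\<Sum>i\<in>{1..r}. (y i - ybar)\<^sup>2) = (\<Sum>i\<in>{1..r}. (y i - ybar) * y i)" using z by simp
  have "v * (\<Sum>i\<in>{1..r}. (d i - c) * s i) = (\<Sum>i\<in>{1..r}. (v * d i) * s i) - v * c * (\<Sum>i\<in>{1..r}. s i)"
    unfolding sum_distrib_left sum_subtractf[symmetric] by (intro sum.cong) (auto simp: algebra_simps)
  \<comment> \<open>\<open>c\<close> drops out of the pairing because the scores sum to 0; only the
    expansion of \<open>v * d i\<close> is left.\<close>
  hence ds: "v * (\<Sum>i\<in>{1..r}. (d i - c) * s i) = (\<Sum>i\<in>{1..r}. (y i + f i) * s i)"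
    using s0 by (simp add: f_def)
  have sb: "\<bar>s i\<bar> \<le> 4 * Y" if "i \<in> {1..r}" for i
    unfolding s_eq using e[OF that] y[OF that] ybar ebar EY by linarith
  have "v * (\<Sum>i\<in>{1..r}. (d i - c) * s i) - (\<Sum>i\<in>{1..r}. (y i - ybar)\<^sup>2) = (\<Sum>i\<in>{1..r}. (e i - ebar) * y i + f i * s i)"
    unfolding ds sq sum_subtractf[symmetric]
  proof (intro sum.cong refl)
    fix i show "(y i + f i) * s i - (y i - ybar) * y i = (e i - ebar) * y i + f i * s i"
      unfolding s_eq[of i] by (simp add: algebra_simps)
  qed
  also have "\<bar>\<dots>\<bar> \<le> (\<Sum>i\<in>{1..r}. 6 * Y * E)"
  proof (intro order_trans[OF sum_abs] sum_mono)
    fix i assume i: "i \<in> {1..r}"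
    have "\<bar>(e i - ebar) * y i + f i * s i\<bar> \<le> \<bar>e i - ebar\<bar> * \<bar>y i\<bar> + \<bar>f i\<bar> * \<bar>s i\<bar>"
      unfolding abs_mult[symmetric] by (rule abs_triangle_ineq)
    also have "\<dots> \<le> (2 * E) * Y + E * (4 * Y)"
      using e[OF i] f[OF i] y[OF i] sb[OF i] ebar E0 by (intro add_mono mult_mono) auto
    finally show "\<bar>(e i - ebar) * y i + f i * s i\<bar> \<le> 6 * Y * E" by (simp add: mult.commute)
  qed
  finally have "\<bar>v * ((\<Sum>i\<in>{1..r}. (d i - c) * s i) - centred_sum_sq r (\<lambda>i. y i / sqrt v))\<bar> \<le> real r * (6 * Y * E)"
    unfolding right_diff_distrib cs by simp
  hence "\<bar>(\<Sum>i\<in>{1..r}. (d i - c) * s i) - centred_sum_sq r (\<lambda>i. y i / sqrt v)\<bar> \<le> real r * (6 * Y * E) / v"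
    using v by (simp add: abs_mult pos_le_divide_eq mult.commute)
  also have "\<dots> \<le> real r * (6 * Y * E) / v0" using v0 E0 Y0 by (intro divide_left_mono) auto
  finally show "\<bar>(\<Sum>i\<in>{1..r}. (d i - c) * s i) - centred_sum_sq r (\<lambda>i. y i / sqrt v)\<bar> \<le> real r * (6 * Y * E / v0)"
    by simp
  have "\<bar>v * (\<Sum>i\<in>{1..r}. (d i - c) * s i)\<bar> \<le> (\<Sum>i\<in>{1..r}. 8 * Y\<^sup>2)"
    unfolding ds
  proof (intro order_trans[OF sum_abs] sum_mono)
    fix i assume i: "i \<in> {1..r}"
    have "\<bar>(y i + f i) * s i\<bar> \<le> (2 * Y) * (4 * Y)"
      unfolding abs_mult using f[OF i] y[OF i] sb[OF i] EY Y0 by (intro mult_mono) auto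
    thus "\<bar>(y i + f i) * s i\<bar> \<le> 8 * Y\<^sup>2" by (simp add: power2_eq_square)
  qed
  hence "\<bar>\<Sum>i\<in>{1..r}. (d i - c) * s i\<bar> \<le> real r * (8 * Y\<^sup>2) / v"
    using v by (simp add: abs_mult pos_le_divide_eq mult.commute)
  also have "\<dots> \<le> real r * (8 * Y\<^sup>2) / v0" using v0 by (intro divide_left_mono) auto
  finally show "\<bar>\<Sum>i\<in>{1..r}. (d i - c) * s i\<bar> \<le> real r * (8 * Y\<^sup>2 / v0)" by simp
qed

text \<open>A deterministic setting for a single graph; the randomness is confined to
  \<open>score_le\<close> and \<open>w_score\<close>. \<open>E \<le> G + real r\<close> says that
  the expansion error does not exceed the bound on the noise, as both algebra lemmas
  require.\<close>

locale regular_sample = curvature_bound +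
  fixes A :: "nat \<times> nat \<Rightarrow> bool" and r :: nat and G t W B E v0 :: real and w :: "nat \<Rightarrow> nat \<Rightarrow> real"
  assumes r: "1 \<le> r" "r \<le> n" and t: "0 < t" "t \<le> 1 / 4"
    and score_le: "\<And>j. j \<in> {1..n} \<Longrightarrow> \<bar>score n A \<beta> j\<bar> \<le> G"
    and radius: "6 * b * G < (real n - 1) * t"
    and w_le: "\<And>i j. i \<in> {1..r} \<Longrightarrow> j \<in> {1..n} \<Longrightarrow> \<bar>w i j\<bar> \<le> W"
    and w_eq: "\<And>i j. i \<in> {1..r} \<Longrightarrow> j \<in> {1..n} \<Longrightarrow>
        (\<Sum>k\<in>{1..n} - {j}. dmu (\<beta> j + \<beta> k) * (w i j + w i k)) = (if j = i then 0 else dmu (\<beta> i + \<beta> j))"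
    and w_score: "\<And>i. i \<in> {1..r} \<Longrightarrow> \<bar>\<Sum>j\<in>{1..n}. w i j * score n A \<beta> j\<bar> \<le> B"
    and E: "B + real n * (W * (real n * (2 * t)\<^sup>2)) + real r * (W * (G + real n * (2 * t)))
         + real n * (2 * t)\<^sup>2 + 2 * real r \<le> E" "E \<le> G + real r"
    and var_ge: "0 < v0" "\<And>i. i \<in> {1..r} \<Longrightarrow> v0 \<le> edge_var n r \<beta> i"
begin

abbreviation "y \<equiv> edge_noise n r \<beta> A"
abbreviation "v \<equiv> edge_var n r \<beta>"

lemma expansion:
  assumes "i \<in> {1..r}" "\<And>j. \<bar>d j\<bar> \<le> t" "\<And>j. j \<in> {r+1..n} \<Longrightarrow> score n A (\<lambda>j. \<beta> j + d j) j = 0"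
  shows "\<bar>score n A (\<lambda>j. \<beta> j + d j) i - y i + v i * d i\<bar> \<le> E"
proof (rule order_trans[OF _ E(1)])
  show "\<bar>score n A (\<lambda>j. \<beta> j + d j) i - y i + v i * d i\<bar> \<le>
      B + real n * (W * (real n * (2 * t)\<^sup>2)) + real r * (W * (G + real n * (2 * t)))
         + real n * (2 * t)\<^sup>2 + 2 * real r"
    unfolding edge_noise_def edge_var_def
    by (rule score_expansion[where w = "w i"])
       (use assms r t score_le w_le w_eq w_score in auto)
qed

lemma noise_le: "i \<in> {1..r} \<Longrightarrow> \<bar>y i\<bar> \<le> G + real r"
  using score_minus_edge_noise[of i r n A \<beta>] score_le[of i] r by fastforce

lemma full_mle:
  obtains d where "\<And>j. \<bar>d j\<bar> \<le> t" "\<And>j. j \<in> {1..n} \<Longrightarrow> score n A (\<lambda>j. \<beta> j + d j) j = 0"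
proof -
  obtain x where x: "x 0 = 0" "\<And>m. \<bar>x m\<bar> \<le> t"
    "\<And>m. 1 \<le> m \<Longrightarrow> (\<Sum>j\<in>{j\<in>{1..n}. id j = m}. score n A (\<lambda>j. \<beta> j + x (id j)) j) = 0"
    using likelihood_critical_point[OF t score_le radius, of id] by blast
  show thesis
  proof (rule that[of x])
    fix j assume j: "j \<in> {1..n}"
    have single: "{j'\<in>{1..n}. id j' = j} = {j}" using j by auto
    show "score n A (\<lambda>j. \<beta> j + x j) j = 0" using x(3)[of j, unfolded single] j by simp
  qed (rule x(2))
qed

text \<open>The gap lemma is applied from the restricted estimate to the full one, whose difference
  is at most 2t. Its relative error 8t times the size 8 (G + r)^2 / v0 per node gives the constant
  64. Orthogonality of the score to all increments within \<open>S\<close> is first-order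
  optimality, which suffices by concavity.\<close>

lemma lrt_approx:
  assumes d: "\<And>j. \<bar>d j\<bar> \<le> t" "\<And>j. j \<in> {1..n} \<Longrightarrow> score n A (\<lambda>j. \<beta> j + d j) j = 0"
    and c: "\<And>j. \<bar>c j\<bar> \<le> t" "\<And>j. j \<in> {r+1..n} \<Longrightarrow> score n A (\<lambda>j. \<beta> j + c j) j = 0"
    and S: "(\<lambda>j. \<beta> j + c j) \<in> S"
      "\<And>\<gamma>'. \<gamma>' \<in> S \<Longrightarrow> (\<Sum>j\<in>{1..n}. (\<gamma>' j - (\<beta> j + c j)) * score n A (\<lambda>j. \<beta> j + c j) j) = 0"
    and approx: "\<bar>(\<Sum>i\<in>{1..r}. (d i - c i) * score n A (\<lambda>j. \<beta> j + c j) i) - F\<bar> \<le> real r * (6 * (G + r) * E / v0)"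
    and size: "\<bar>\<Sum>i\<in>{1..r}. (d i - c i) * score n A (\<lambda>j. \<beta> j + c j) i\<bar> \<le> real r * (8 * (G + r)\<^sup>2 / v0)"
  shows "has_max (loglik n A) UNIV \<and> has_max (loglik n A) S \<and>
     \<bar>LRT n A S - F\<bar> \<le> real r * (6 * (G + r) * E + 64 * t * (G + r)\<^sup>2) / v0"
proof -
  define h where "h j = d j - c j" for j
  let ?s = "score n A (\<lambda>j. \<beta> j + c j)"
  have dh: "(\<lambda>j. (\<beta> j + c j) + h j) = (\<lambda>j. \<beta> j + d j)" by (simp add: h_def)
  have "\<bar>h j\<bar> \<le> 2 * t" for j unfolding h_def using c(1)[of j] d(1)[of j] by linarith
  note gap = loglik_gap[where n = n and h = h and A = A and \<gamma> = "\<lambda>j. \<beta> j + c j" and e = "2 * t",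
      unfolded dh, OF _ this]
  have M: "has_max (loglik n A) UNIV" "Sup (loglik n A ` UNIV) = loglik n A (\<lambda>j. \<beta> j + d j)"
    using critical_point_maximizes[of "\<lambda>j. \<beta> j + d j" UNIV n A] d(2) by auto
  have MS: "has_max (loglik n A) S" "Sup (loglik n A ` S) = loglik n A (\<lambda>j. \<beta> j + c j)"
    by (rule critical_point_maximizes[OF S], assumption)+
  have L: "LRT n A S = 2 * (loglik n A (\<lambda>j. \<beta> j + d j) - loglik n A (\<lambda>j. \<beta> j + c j))"
    unfolding LRT_def M MS ..
  have hs: "(\<Sum>j\<in>{1..n}. h j * ?s j) = (\<Sum>j\<in>{1..r}. (d j - c j) * ?s j)"
    unfolding h_def using c(2) r by (intro sum.mono_neutral_right) auto
  have "\<bar>LRT n A S - (\<Sum>j\<in>{1..r}. (d j - c j) * ?s j)\<bar> \<le> 4 * (2 * t) * (\<Sum>j\<in>{1..r}. (d j - c j) * ?s j)"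
    unfolding L hs[symmetric] by (rule gap) (use d(2) t in \<open>auto simp: sum.neutral\<close>)
  also have "\<dots> \<le> 4 * (2 * t) * (real r * (8 * (G + r)\<^sup>2 / v0))"
    using size t by (intro mult_left_mono) auto
  also have "\<dots> = real r * (64 * t * (G + r)\<^sup>2) / v0" by simp
  finally have "\<bar>LRT n A S - F\<bar> \<le> real r * (64 * t * (G + r)\<^sup>2) / v0 + real r * (6 * (G + r) * E / v0)"
    using approx by linarith
  also have "\<dots> = real r * (6 * (G + r) * E + 64 * t * (G + r)\<^sup>2) / v0"
    by (simp add: add_divide_distrib distrib_left)
  finally show ?thesis using M MS by simp
qed

lemma fixed_null_approx:
  assumes null: "\<And>i. i \<in> {1..r} \<Longrightarrow> \<beta> i = \<beta>0 i"
  shows "has_max (loglik n A) UNIV \<and> has_max (loglik n A) (fixed_null_set r \<beta>0) \<and>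
     \<bar>LRT n A (fixed_null_set r \<beta>0) - sum_sq r (edge_zscore n r \<beta> A)\<bar>
       \<le> real r * (6 * (G + r) * E + 64 * t * (G + r)\<^sup>2) / v0"
proof -
  obtain d where d: "\<And>j. \<bar>d j\<bar> \<le> t" "\<And>j. j \<in> {1..n} \<Longrightarrow> score n A (\<lambda>j. \<beta> j + d j) j = 0"
    using full_mle by blast
  \<comment> \<open>Label 0 belongs to the pinned coordinate, so the first r nodes keep their null
    values.\<close>
  define p where "p j = (if j \<le> r then 0 else j)" for j
  obtain x where x: "x 0 = 0" "\<And>m. \<bar>x m\<bar> \<le> t"
    "\<And>m. 1 \<le> m \<Longrightarrow> (\<Sum>j\<in>{j\<in>{1..n}. p j = m}. score n A (\<lambda>j. \<beta> j + x (p j)) j) = 0"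
    using likelihood_critical_point[OF t score_le radius, of p] by blast
  define c where "c j = x (p j)" for j
  have c: "\<bar>c j\<bar> \<le> t" for j unfolding c_def by (rule x(2))
  have cr: "c j = 0" if "j \<le> r" for j using that by (simp add: c_def p_def x(1))
  have s0: "score n A (\<lambda>j. \<beta> j + c j) j = 0" if j: "j \<in> {r+1..n}" for j
  proof -
    have single: "{j'\<in>{1..n}. p j' = j} = {j}" using j by (auto simp: p_def)
    show ?thesis using x(3)[of j, unfolded single] j by (simp add: c_def)
  qed
  let ?s = "score n A (\<lambda>j. \<beta> j + c j)"
  \<comment> \<open>At the restricted estimate the displacement \<open>c i\<close> is 0; at the full
    one the score is 0. The same expansion thus yields both hypotheses of the algebra.\<close>
  have s: "\<bar>?s i - y i\<bar> \<le> E" if "i \<in> {1..r}" for i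
    using expansion[where d = c, OF that c s0] cr[of i] that by simp
  have dE: "\<bar>- y i + v i * d i\<bar> \<le> E" if "i \<in> {1..r}" for i
    using expansion[where d = d, OF that d(1)] d(2)[of i] d(2) that r by simp
  note alg = fixed_null_algebra[OF s dE noise_le E(2) var_ge(1) var_ge(2)]
  have sq: "sum_sq r (edge_zscore n r \<beta> A) = (\<Sum>i\<in>{1..r}. (y i)\<^sup>2 / v i)"
    unfolding sum_sq_def edge_zscore_def power_divide
  proof (intro sum.cong refl)
    fix i assume "i \<in> {1..r}"
    hence "0 < v i" using var_ge(1) var_ge(2)[of i] by linarith
    thus "(y i)\<^sup>2 / (sqrt (v i))\<^sup>2 = (y i)\<^sup>2 / v i" by simp
  qed
  show ?thesis
  proof (rule lrt_approx[OF d c s0])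
    show "(\<lambda>j. \<beta> j + c j) \<in> fixed_null_set r \<beta>0"
      unfolding fixed_null_set_def using null cr by auto
    fix \<gamma>' assume "\<gamma>' \<in> fixed_null_set r \<beta>0"
    thus "(\<Sum>j\<in>{1..n}. (\<gamma>' j - (\<beta> j + c j)) * ?s j) = 0"
    proof (intro sum.neutral ballI)
      fix j assume g: "\<gamma>' \<in> fixed_null_set r \<beta>0" and j: "j \<in> {1..n}"
      show "(\<gamma>' j - (\<beta> j + c j)) * ?s j = 0"
      proof (cases "j \<le> r")
        case True
        hence "\<gamma>' j = \<beta> j" "c j = 0" using g j null[of j] cr[of j] unfolding fixed_null_set_def by auto
        thus ?thesis by simp
      next
        case False
        hence "?s j = 0" using j by (intro s0) auto
        thus ?thesis by simp
      qed
    qed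
  next
    have "(\<Sum>i\<in>{1..r}. (d i - c i) * ?s i) - sum_sq r (edge_zscore n r \<beta> A) =
        (\<Sum>i\<in>{1..r}. d i * ?s i - (y i)\<^sup>2 / v i)"
      unfolding sq sum_subtractf[symmetric] using cr by (intro sum.cong) auto
    also have "\<bar>\<dots>\<bar> \<le> (\<Sum>i\<in>{1..r}. 6 * (G + r) * E / v0)"
      by (intro order_trans[OF sum_abs] sum_mono alg(1))
    finally show "\<bar>(\<Sum>i\<in>{1..r}. (d i - c i) * ?s i) - sum_sq r (edge_zscore n r \<beta> A)\<bar> \<le> real r * (6 * (G + r) * E / v0)"
      by simp
    have "(\<Sum>i\<in>{1..r}. (d i - c i) * ?s i) = (\<Sum>i\<in>{1..r}. d i * ?s i)"
      using cr by (intro sum.cong) auto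
    also have "\<bar>\<dots>\<bar> \<le> (\<Sum>i\<in>{1..r}. 8 * (G + r)\<^sup>2 / v0)"
      by (intro order_trans[OF sum_abs] sum_mono alg(2))
    finally show "\<bar>\<Sum>i\<in>{1..r}. (d i - c i) * ?s i\<bar> \<le> real r * (8 * (G + r)\<^sup>2 / v0)" by simp
  qed
qed

lemma homog_null_approx:
  assumes null: "\<And>i. i \<in> {1..r} \<Longrightarrow> \<beta> i = \<beta> 1"
  shows "has_max (loglik n A) UNIV \<and> has_max (loglik n A) (homog_null_set r) \<and>
     \<bar>LRT n A (homog_null_set r) - centred_sum_sq r (edge_zscore n r \<beta> A)\<bar>
       \<le> real r * (6 * (G + r) * E + 64 * t * (G + r)\<^sup>2) / v0"
proof -
  obtain d where d: "\<And>j. \<bar>d j\<bar> \<le> t" "\<And>j. j \<in> {1..n} \<Longrightarrow> score n A (\<lambda>j. \<beta> j + d j) j = 0"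
    using full_mle by blast
  \<comment> \<open>One shared coordinate for the block. No node beyond \<open>r\<close> receives
    label 1, since r \<ge> 1.\<close>
  define p where "p j = (if j \<le> r then 1 else j)" for j
  obtain x where x: "x 0 = 0" "\<And>m. \<bar>x m\<bar> \<le> t"
    "\<And>m. 1 \<le> m \<Longrightarrow> (\<Sum>j\<in>{j\<in>{1..n}. p j = m}. score n A (\<lambda>j. \<beta> j + x (p j)) j) = 0"
    using likelihood_critical_point[OF t score_le radius, of p] by blast
  define c where "c j = x (p j)" for j
  have c: "\<bar>c j\<bar> \<le> t" for j unfolding c_def by (rule x(2))
  have cr: "c j = c 1" if "j \<le> r" for j using that r by (simp add: c_def p_def)
  let ?s = "score n A (\<lambda>j. \<beta> j + c j)"
  have s0: "?s j = 0" if j: "j \<in> {r+1..n}" for j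
  proof -
    have single: "{j'\<in>{1..n}. p j' = j} = {j}" using j r by (auto simp: p_def split: if_splits)
    show ?thesis using x(3)[of j, unfolded single] j by (simp add: c_def)
  qed
  have sum0: "(\<Sum>i\<in>{1..r}. ?s i) = 0"
  proof -
    have block: "{j'\<in>{1..n}. p j' = 1} = {1..r}" using r by (auto simp: p_def split: if_splits)
    show ?thesis using x(3)[of 1, unfolded block] by (simp add: c_def)
  qed
  \<comment> \<open>Equal parameters give equal variances because \<open>edge_var\<close> sums over
    the neighbours beyond \<open>r\<close>, which are common to the whole block.\<close>
  have v1: "v i = v 1" if "i \<in> {1..r}" for i
    unfolding edge_var_def using null[OF that] by simp
  have s: "\<bar>?s i - y i + v 1 * c 1\<bar> \<le> E" if "i \<in> {1..r}" for i
  proof -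
    have "c i = c 1" using that by (intro cr) simp
    thus ?thesis using expansion[where d = c, OF that c s0] unfolding v1[OF that] by simp
  qed
  have dE: "\<bar>- y i + v 1 * d i\<bar> \<le> E" if "i \<in> {1..r}" for i
    using expansion[where d = d, OF that d(1)] d(2)[of i] d(2) that r v1[OF that] by simp
  have v01: "v0 \<le> v 1" using var_ge(2)[of 1] r by simp
  note alg = homog_null_algebra[OF r(1) s dE noise_le E(2) var_ge(1) v01 sum0]
  have cs: "centred_sum_sq r (edge_zscore n r \<beta> A) = centred_sum_sq r (\<lambda>i. y i / sqrt (v 1))"
  proof -
    have "edge_zscore n r \<beta> A i = y i / sqrt (v 1)" if "i \<in> {1..r}" for i
      using v1[OF that] by (simp add: edge_zscore_def)
    thus ?thesis unfolding centred_sum_sq_def by simp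
  qed
  have dc: "(\<Sum>i\<in>{1..r}. (d i - c i) * ?s i) = (\<Sum>i\<in>{1..r}. (d i - c 1) * ?s i)"
  proof (intro sum.cong refl)
    fix i assume "i \<in> {1..r}"
    hence "c i = c 1" by (intro cr) simp
    thus "(d i - c i) * ?s i = (d i - c 1) * ?s i" by (simp only:)
  qed
  show ?thesis
  proof (rule lrt_approx[OF d c s0])
    show "(\<lambda>j. \<beta> j + c j) \<in> homog_null_set r"
      unfolding homog_null_set_def
    proof (intro CollectI ballI)
      fix i assume i: "i \<in> {1..r}"
      have "c i = c 1" using i by (intro cr) simp
      thus "\<beta> i + c i = \<beta> 1 + c 1" by (simp only: null[OF i])
    qed
    fix \<gamma>' assume \<gamma>': "\<gamma>' \<in> homog_null_set r"
    have "(\<Sum>j\<in>{1..n}. (\<gamma>' j - (\<beta> j + c j)) * ?s j) = (\<Sum>j\<in>{1..r}. (\<gamma>' j - (\<beta> j + c j)) * ?s j)"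
      using r s0 by (intro sum.mono_neutral_right) auto
    also have "\<dots> = (\<Sum>j\<in>{1..r}. (\<gamma>' 1 - (\<beta> 1 + c 1)) * ?s j)"
    proof (intro sum.cong refl)
      fix j assume j: "j \<in> {1..r}"
      have "\<gamma>' j = \<gamma>' 1" using \<gamma>' j unfolding homog_null_set_def by blast
      moreover have "\<beta> j = \<beta> 1" by (rule null[OF j])
      moreover have "c j = c 1" using j by (intro cr) simp
      ultimately show "(\<gamma>' j - (\<beta> j + c j)) * ?s j = (\<gamma>' 1 - (\<beta> 1 + c 1)) * ?s j" by presburger
    qed
    also have "\<dots> = 0" using sum0 by (simp flip: sum_distrib_left)
    finally show "(\<Sum>j\<in>{1..n}. (\<gamma>' j - (\<beta> j + c j)) * ?s j) = 0" .
  next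
    show "\<bar>(\<Sum>i\<in>{1..r}. (d i - c i) * ?s i) - centred_sum_sq r (edge_zscore n r \<beta> A)\<bar>
        \<le> real r * (6 * (G + r) * E / v0)"
      unfolding dc cs by (rule alg(1))
    show "\<bar>\<Sum>i\<in>{1..r}. (d i - c i) * ?s i\<bar> \<le> real r * (8 * (G + r)\<^sup>2 / v0)"
      unfolding dc by (rule alg(2))
  qed
qed

end

section \<open>Chi-square laws of normal vectors\<close>

lemma chi_sq_density_nonneg: "0 \<le> chi_sq_density k x"
proof (cases "k = 0")
  case False
  hence "0 < Gamma (real k / 2)" by (intro Gamma_real_pos) auto
  thus ?thesis by (simp add: chi_sq_density_def)
qed (auto simp: chi_sq_density_def)

lemma chi_sq_density_measurable [measurable]: "chi_sq_density k \<in> borel_measurable borel"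
  unfolding chi_sq_density_def[abs_def] by measurable

lemma sets_chi_sq [simp, measurable_cong]: "sets (chi_sq k) = sets borel"
  by (simp add: chi_sq_def)

text \<open>The substitution rule for compact intervals is applied on [0, m] and its image [0, m^2];
  monotone convergence along both exhaustions gives the half-line.\<close>

lemma nn_integral_nonneg_half_substitution_square:
  fixes f :: "real \<Rightarrow> real"
  assumes [measurable]: "f \<in> borel_measurable borel" and f: "\<And>x. 0 \<le> f x"
  shows "(\<integral>\<^sup>+x. f x * indicator {0..} x \<partial>lborel) = (\<integral>\<^sup>+x. f (x\<^sup>2) * (2 * x) * indicator {0..} x \<partial>lborel)"
proof -
  have lim: "(\<integral>\<^sup>+x. ennreal (h x * indicator {0..} x) \<partial>lborel) =
      (SUP m. \<integral>\<^sup>+x. ennreal (h x * indicator (S m) x) \<partial>lborel)"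
    if [measurable]: "h \<in> borel_measurable borel" and S: "\<And>m. S m \<in> sets borel" "incseq S" "(\<Union>m. S m) = {0..}"
    for h :: "real \<Rightarrow> real" and S :: "nat \<Rightarrow> real set"
  proof -
    have [measurable]: "S m \<in> sets borel" for m by (rule S)
    have e: "ennreal (h x * indicator X x) = ennreal (h x) * indicator X x" for x X
      by (auto simp: indicator_def)
    have "(SUP m. emeasure (density lborel (\<lambda>x. ennreal (h x))) (S m)) =
        emeasure (density lborel (\<lambda>x. ennreal (h x))) (\<Union>m. S m)"
      using S by (intro SUP_emeasure_incseq) auto
    thus ?thesis unfolding e S(3) by (simp add: emeasure_density)
  qed
  have "(\<integral>\<^sup>+x. f x * indicator {0..} x \<partial>lborel) = (SUP m. \<integral>\<^sup>+x. f x * indicator {0..(real m)\<^sup>2} x \<partial>lborel)"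
  proof (rule lim)
    have "\<exists>m. x \<le> (real m)\<^sup>2" for x :: real
    proof
      have "x \<le> real (nat \<lceil>\<bar>x\<bar>\<rceil> + 1)" by linarith
      also have "\<dots> \<le> (real (nat \<lceil>\<bar>x\<bar>\<rceil> + 1))\<^sup>2" by (rule self_le_power) auto
      finally show "x \<le> (real (nat \<lceil>\<bar>x\<bar>\<rceil> + 1))\<^sup>2" .
    qed
    thus "(\<Union>m. {0..(real m)\<^sup>2}) = {0..}" by auto
    show "incseq (\<lambda>m. {0..(real m)\<^sup>2})"
      by (auto simp: incseq_def intro: order_trans power_mono)
  qed auto
  also have "\<dots> = (SUP m. \<integral>\<^sup>+x. f (x\<^sup>2) * (2 * x) * indicator {0..real m} x \<partial>lborel)"
  proof (intro SUP_cong refl)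
    fix m :: nat
    have "(\<integral>\<^sup>+x. f x * indicator {0\<^sup>2..(real m)\<^sup>2} x \<partial>lborel) = (\<integral>\<^sup>+x. f (x\<^sup>2) * (2 * x) * indicator {0..real m} x \<partial>lborel)"
      by (rule nn_integral_substitution)
         (auto intro!: derivative_eq_intros continuous_intros simp: set_borel_measurable_def)
    thus "(\<integral>\<^sup>+x. f x * indicator {0..(real m)\<^sup>2} x \<partial>lborel) = (\<integral>\<^sup>+x. f (x\<^sup>2) * (2 * x) * indicator {0..real m} x \<partial>lborel)"
      by simp
  qed
  also have "\<dots> = (\<integral>\<^sup>+x. f (x\<^sup>2) * (2 * x) * indicator {0..} x \<partial>lborel)"
  proof (rule lim[symmetric])
    have "\<exists>m. x \<le> real m" for x :: real by (rule real_arch_simple)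
    thus "(\<Union>m. {0..real m}) = {0..}" by auto
    show "incseq (\<lambda>m. {0..real m})" by (auto simp: incseq_def)
  qed auto
  finally show ?thesis .
qed

text \<open>Substituting the square on the half-line gives twice the normal integral over
  nonnegative arguments. By symmetry of the density, one of the two copies is reflected to the
  negative axis.\<close>

lemma distr_std_normal_square: "distr std_normal_distribution borel (\<lambda>x. x\<^sup>2) = chi_sq 1"
proof (rule measure_eqI)
  fix A assume "A \<in> sets (distr std_normal_distribution borel (\<lambda>x. x\<^sup>2))"
  hence [measurable]: "A \<in> sets borel" by simp
  define f where "f x = chi_sq_density 1 x * indicator A x" for x
  have [measurable]: "f \<in> borel_measurable borel" unfolding f_def by measurable
  define I where "I = (\<integral>\<^sup>+x. ennreal (std_normal_density x * indicator A (x\<^sup>2) * indicator {0..} x) \<partial>lborel)"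
  have "emeasure (chi_sq 1) A = (\<integral>\<^sup>+x. f x \<partial>lborel)"
    unfolding chi_sq_def by (subst emeasure_density)
      (auto intro!: nn_integral_cong simp: f_def indicator_def)
  also have "\<dots> = (\<integral>\<^sup>+x. f x * indicator {0..} x \<partial>lborel)"
    by (intro nn_integral_cong) (auto simp: f_def indicator_def chi_sq_density_def)
  also have "\<dots> = (\<integral>\<^sup>+x. f (x\<^sup>2) * (2 * x) * indicator {0..} x \<partial>lborel)"
    by (rule nn_integral_nonneg_half_substitution_square) (auto simp: f_def chi_sq_density_nonneg)
  \<comment> \<open>The origin has to be excluded: \<open>chi_sq_density\<close> is 0 there by
    definition, the normal density is not.\<close>
  also have "\<dots> = (\<integral>\<^sup>+x. 2 * ennreal (std_normal_density x * indicator A (x\<^sup>2) * indicator {0..} x) \<partial>lborel)"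
  proof (intro nn_integral_cong_AE AE_I[of _ _ "{0}"] subsetI)
    fix x assume x: "x \<in> {x \<in> space lborel. ennreal (f (x\<^sup>2) * (2 * x) * indicator {0..} x) \<noteq>
        2 * ennreal (std_normal_density x * indicator A (x\<^sup>2) * indicator {0..} x)}"
    show "x \<in> {0}"
    proof (rule ccontr)
      assume x0: "x \<notin> {0}"
      have "f (x\<^sup>2) * (2 * x) * indicator {0..} x = 2 * (std_normal_density x * indicator A (x\<^sup>2) * indicator {0..} x)"
      proof (cases "x > 0")
        case True
        have "(x\<^sup>2) powr (- (1 / 2)) = 1 / x" using True
          by (simp add: powr_minus powr_half_sqrt divide_simps)
        hence "chi_sq_density 1 (x\<^sup>2) * (2 * x) = 2 * std_normal_density x"
          using True Gamma_one_half_real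
          by (simp add: chi_sq_density_def std_normal_density_def powr_half_sqrt real_sqrt_mult)
        thus ?thesis by (simp add: f_def indicator_def)
      qed (use x0 in \<open>auto simp: indicator_def\<close>)
      hence "ennreal (f (x\<^sup>2) * (2 * x) * indicator {0..} x) =
          2 * ennreal (std_normal_density x * indicator A (x\<^sup>2) * indicator {0..} x)"
        by (simp only: ennreal_mult' ennreal_numeral zero_le_numeral)
      thus False using x by blast
    qed
  qed auto
  also have "\<dots> = I + I" unfolding I_def by (simp add: nn_integral_add mult_2)
  also have "I + I = I + (\<integral>\<^sup>+x. ennreal (std_normal_density x * indicator A (x\<^sup>2) * indicator {..0} x) \<partial>lborel)"
    unfolding I_def
    by (subst (2) nn_integral_real_affine[of _ "-1" 0])
       (auto simp: indicator_def normal_density_def intro!: nn_integral_cong arg_cong2[of _ _ _ _ "(+)"])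
  also have "\<dots> = (\<integral>\<^sup>+x. ennreal (std_normal_density x * indicator A (x\<^sup>2) * indicator {0..} x) +
      ennreal (std_normal_density x * indicator A (x\<^sup>2) * indicator {..0} x) \<partial>lborel)"
    unfolding I_def by (subst nn_integral_add) auto
  also have "\<dots> = (\<integral>\<^sup>+x. ennreal (std_normal_density x) * indicator A (x\<^sup>2) \<partial>lborel)"
    by (intro nn_integral_cong_AE AE_I[of _ _ "{0}"]) (auto simp: indicator_def)
  also have "\<dots> = (\<integral>\<^sup>+x. indicator A (x\<^sup>2) \<partial>std_normal_distribution)"
    by (subst nn_integral_density) auto
  also have "\<dots> = emeasure (distr std_normal_distribution borel (\<lambda>x. x\<^sup>2)) A"
  proof -
    have "emeasure (distr std_normal_distribution borel (\<lambda>x. x\<^sup>2)) A =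
        (\<integral>\<^sup>+x. indicator A x \<partial>distr std_normal_distribution borel (\<lambda>x. x\<^sup>2))" by simp
    also have "\<dots> = (\<integral>\<^sup>+x. indicator A (x\<^sup>2) \<partial>std_normal_distribution)"
      by (subst nn_integral_distr) auto
    finally show ?thesis ..
  qed
  finally show "emeasure (distr std_normal_distribution borel (\<lambda>x. x\<^sup>2)) A = emeasure (chi_sq 1) A" ..
qed simp

lemma prob_space_std_normal: "prob_space std_normal_distribution"
  by (rule prob_space_normal_density) simp

text \<open>The substitution y = x u produces the Beta integral, and its expression through Gamma
  functions recovers the normalisation. For x \<le> 0 the two factors are never both
  positive.\<close>

lemma chi_sq_density_convolution:
  assumes "1 \<le> k" "1 \<le> l"
  shows "(\<integral>\<^sup>+y. ennreal (chi_sq_density k (x - y)) * ennreal (chi_sq_density l y) \<partial>lborel) =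
      ennreal (chi_sq_density (k + l) x)"
proof (cases "x > 0")
  case False
  have "(\<integral>\<^sup>+y. ennreal (chi_sq_density k (x - y)) * ennreal (chi_sq_density l y) \<partial>lborel) = (\<integral>\<^sup>+(y::real). 0 \<partial>lborel)"
    using False by (intro nn_integral_cong) (auto simp: chi_sq_density_def)
  thus ?thesis using False by (simp add: chi_sq_density_def)
next
  case True
  define a b where "a = real k / 2" and "b = real l / 2"
  have ab: "a > 0" "b > 0" using assms by (auto simp: a_def b_def)
  define C where "C = exp (- x / 2) / (2 powr a * Gamma a * (2 powr b * Gamma b)) * x powr (a + b - 2)"
  have C0: "0 \<le> C" using ab by (simp add: C_def Gamma_real_pos less_imp_le)
  have pt: "chi_sq_density k (x - x * u) * chi_sq_density l (x * u) =
      C * (u powr (b - 1) * (1 - u) powr (a - 1) * indicator {0..1} u)" for u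
  proof (cases "0 < u \<and> u < 1")
    case True
    have xu: "0 < x - x * u" "0 < x * u" using True \<open>x > 0\<close> by (auto simp: algebra_simps)
    have "(x - x * u) powr (a - 1) = x powr (a - 1) * (1 - u) powr (a - 1)"
      using True \<open>x > 0\<close> by (subst powr_mult[symmetric]) (auto simp: algebra_simps)
    moreover have "(x * u) powr (b - 1) = x powr (b - 1) * u powr (b - 1)"
      using True \<open>x > 0\<close> by (simp add: powr_mult)
    moreover have "x powr (a - 1) * x powr (b - 1) = x powr (a + b - 2)"
      by (simp flip: powr_add)
    moreover have "exp (- (x - x * u) / 2) * exp (- (x * u) / 2) = exp (- x / 2)"
      by (simp add: field_simps flip: exp_add)
    moreover have "chi_sq_density k (x - x * u) * chi_sq_density l (x * u) =
      ((x - x * u) powr (a - 1) * (x * u) powr (b - 1)) * (exp (- (x - x * u) / 2) * exp (- (x * u) / 2))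
        / (2 powr a * Gamma a * (2 powr b * Gamma b))"
      using xu unfolding chi_sq_density_def a_def b_def by simp
    ultimately show ?thesis using True by (simp add: C_def mult_ac)
  next
    case False
    hence "x * u \<le> 0 \<or> x - x * u \<le> 0" using \<open>x > 0\<close>
      by (auto simp: mult_le_0_iff not_less)
    hence "chi_sq_density k (x - x * u) * chi_sq_density l (x * u) = 0" by (auto simp: chi_sq_density_def)
    moreover have "u powr (b - 1) * (1 - u) powr (a - 1) * indicator {0..1} u = 0"
      using False by (cases "u = 0 \<or> u = 1") (auto simp: indicator_def)
    ultimately show ?thesis by (simp only: mult_zero_right)
  qed
  have "(\<integral>\<^sup>+y. ennreal (chi_sq_density k (x - y)) * ennreal (chi_sq_density l y) \<partial>lborel) =
     ennreal \<bar>x\<bar> * (\<integral>\<^sup>+u. ennreal (chi_sq_density k (x - (0 + x * u))) * ennreal (chi_sq_density l (0 + x * u)) \<partial>lborel)"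
    using True by (intro nn_integral_real_affine) auto
  also have "(\<lambda>u. ennreal (chi_sq_density k (x - (0 + x * u))) * ennreal (chi_sq_density l (0 + x * u))) =
     (\<lambda>u. ennreal C * (ennreal (u powr (b - 1) * (1 - u) powr (a - 1)) * indicator {0..1} u))"
  proof
    fix u
    have "ennreal (chi_sq_density k (x - (0 + x * u))) * ennreal (chi_sq_density l (0 + x * u)) =
       ennreal (C * (u powr (b - 1) * (1 - u) powr (a - 1) * indicator {0..1} u))"
      using pt[of u] by (simp add: chi_sq_density_nonneg flip: ennreal_mult)
    also have "\<dots> = ennreal C * (ennreal (u powr (b - 1) * (1 - u) powr (a - 1)) * indicator {0..1} u)"
      using C0 by (auto simp: ennreal_mult' indicator_def)
    finally show "ennreal (chi_sq_density k (x - (0 + x * u))) * ennreal (chi_sq_density l (0 + x * u)) =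
       ennreal C * (ennreal (u powr (b - 1) * (1 - u) powr (a - 1)) * indicator {0..1} u)" .
  qed
  also have "(\<integral>\<^sup>+u. ennreal C * (ennreal (u powr (b - 1) * (1 - u) powr (a - 1)) * indicator {0..1} u) \<partial>lborel) =
     ennreal C * ennreal (Beta b a)"
    using has_integral_Beta_real[OF ab(2,1)]
    by (subst nn_integral_cmult) (auto simp: nn_integral_has_integral_lebesgue')
  also have "ennreal \<bar>x\<bar> * (ennreal C * ennreal (Beta b a)) = ennreal (x * C * Beta b a)"
    using True C0 by (simp add: ennreal_mult' mult.assoc)
  also have "x * C * Beta b a = chi_sq_density (k + l) x"
  proof -
    have "Gamma a \<noteq> 0" "Gamma b \<noteq> 0" using Gamma_real_pos[OF ab(1)] Gamma_real_pos[OF ab(2)] by (metis less_irrefl)+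
    moreover have "x * x powr (a + b - 2) = x powr (a + b - 1)"
      using True by (simp add: powr_mult_base)
    moreover have "real (k + l) / 2 = a + b" by (simp add: a_def b_def add_divide_distrib)
    moreover have "chi_sq_density (k + l) x =
        x powr (a + b - 1) * exp (- x / 2) / (2 powr (a + b) * Gamma (a + b))"
      using True unfolding chi_sq_density_def \<open>real (k + l) / 2 = a + b\<close> by simp
    ultimately show ?thesis
      unfolding C_def Beta_def by (simp add: powr_add add.commute field_simps)
  qed
  finally show ?thesis .
qed

text \<open>Total mass 1 is inherited rather than computed from the Gamma integral: from the squared
  normal for k = 1, then through convolution.\<close>

lemma prob_space_chi_sq:
  assumes "1 \<le> k" shows "prob_space (chi_sq k)"
  using assms
proof (induction k rule: dec_induct)
  case base
  interpret prob_space std_normal_distribution by (rule prob_space_std_normal)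
  show ?case unfolding distr_std_normal_square[symmetric] by (rule prob_space_distr) simp
next
  case (step k)
  have one: "prob_space (chi_sq 1)"
  proof -
    interpret prob_space std_normal_distribution by (rule prob_space_std_normal)
    show ?thesis unfolding distr_std_normal_square[symmetric] by (rule prob_space_distr) simp
  qed
  have "prob_space (density lborel (\<lambda>x. \<integral>\<^sup>+y. ennreal (chi_sq_density k (x - y)) * ennreal (chi_sq_density 1 y) \<partial>lborel))"
    using step.IH one unfolding chi_sq_def
    by (intro prob_space_convolution_density) (auto simp: chi_sq_density_nonneg)
  moreover have "(\<lambda>x. \<integral>\<^sup>+y. ennreal (chi_sq_density k (x - y)) * ennreal (chi_sq_density 1 y) \<partial>lborel) =
     (\<lambda>x. ennreal (chi_sq_density (Suc k) x))"
    using chi_sq_density_convolution[of k 1] step.hyps by (intro ext) simp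
  ultimately show ?case by (simp add: chi_sq_def)
qed

lemma chi_sq_convolution:
  assumes "1 \<le> k" "1 \<le> l" shows "chi_sq k \<star> chi_sq l = chi_sq (k + l)"
proof -
  interpret k: prob_space "chi_sq k" by (rule prob_space_chi_sq[OF assms(1)])
  interpret l: prob_space "chi_sq l" by (rule prob_space_chi_sq[OF assms(2)])
  have "chi_sq k \<star> chi_sq l = density lborel (\<lambda>x. \<integral>\<^sup>+y. ennreal (chi_sq_density k (x - y)) * ennreal (chi_sq_density l y) \<partial>lborel)"
    unfolding chi_sq_def
    by (rule convolution_density)
       (use k.finite_measure_axioms l.finite_measure_axioms in \<open>auto simp: chi_sq_def\<close>)
  also have "\<dots> = chi_sq (k + l)"
    unfolding chi_sq_def chi_sq_density_convolution[OF assms] ..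
  finally show ?thesis .
qed

text \<open>As \<open>Gamma 0 = 0\<close>, division by zero makes \<open>chi_sq 0\<close> the zero measure rather than the point mass at 0.\<close>

definition chi_sq0 :: "nat \<Rightarrow> real measure" where
  "chi_sq0 k = (if k = 0 then return borel 0 else chi_sq k)"

lemma sets_chi_sq0 [simp, measurable_cong]: "sets (chi_sq0 k) = sets borel"
  by (simp add: chi_sq0_def)

text \<open>The common induction step for plain and centred sums of squares; the point mass at k = 0
  lets these inductions start with an empty sum and with a single variable, respectively.\<close>

lemma nn_integral_chi_sq0_Suc:
  assumes [measurable]: "h \<in> borel_measurable borel"
  shows "(\<integral>\<^sup>+x. h x \<partial>chi_sq0 (Suc k)) = (\<integral>\<^sup>+q. \<integral>\<^sup>+v. h (q + v\<^sup>2) \<partial>std_normal_distribution \<partial>chi_sq0 k)"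
proof -
  have inner: "(\<integral>\<^sup>+v. h (q + v\<^sup>2) \<partial>std_normal_distribution) = (\<integral>\<^sup>+p. h (q + p) \<partial>chi_sq 1)" for q
    unfolding distr_std_normal_square[symmetric] by (subst nn_integral_distr) auto
  show ?thesis
  proof (cases "k = 0")
    case True
    have "(\<integral>\<^sup>+q. (\<integral>\<^sup>+p. h (q + p) \<partial>chi_sq 1) \<partial>return borel 0) = (\<integral>\<^sup>+p. h (0 + p) \<partial>chi_sq 1)"
    proof (rule nn_integral_return)
      interpret sigma_finite_measure "chi_sq 1"
        using prob_space_chi_sq[of 1] by (simp add: prob_space_imp_sigma_finite)
      show "(\<lambda>q. \<integral>\<^sup>+p. h (q + p) \<partial>chi_sq 1) \<in> borel_measurable borel" by measurable
    qed simp
    thus ?thesis unfolding inner using True by (simp add: chi_sq0_def)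
  next
    case False
    have "(\<integral>\<^sup>+x. h x \<partial>(chi_sq k \<star> chi_sq 1)) = (\<integral>\<^sup>+q. \<integral>\<^sup>+p. h (q + p) \<partial>chi_sq 1 \<partial>chi_sq k)"
      using prob_space_chi_sq[of k] prob_space_chi_sq[of 1] False
      by (intro nn_integral_convolution) (auto simp: prob_space_def)
    thus ?thesis unfolding inner using False chi_sq_convolution[of k 1] by (simp add: chi_sq0_def)
  qed
qed

text \<open>Rotation invariance of the planar Gaussian by two one-dimensional affine substitutions:
  u = a s + b y in place of \<open>s\<close>, then y = b u + a v. Their Jacobians 1/a and a cancel,
  and a^2 + b^2 = 1 preserves the exponent.\<close>

lemma std_normal_rotation:
  fixes f :: "real \<Rightarrow> real \<Rightarrow> ennreal"
  assumes [measurable]: "case_prod f \<in> borel_measurable (borel \<Otimes>\<^sub>M borel)" and ab: "a\<^sup>2 + b\<^sup>2 = 1" "a > 0"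
  shows "(\<integral>\<^sup>+s. \<integral>\<^sup>+y. f (a * s + b * y) (a * y - b * s) \<partial>std_normal_distribution \<partial>std_normal_distribution) =
    (\<integral>\<^sup>+u. \<integral>\<^sup>+v. f u v \<partial>std_normal_distribution \<partial>std_normal_distribution)"
proof -
  define \<phi> where "\<phi> s y = ennreal (exp (- (s\<^sup>2 + y\<^sup>2) / 2) / (2 * pi))" for s y
  have [measurable]: "case_prod \<phi> \<in> borel_measurable (borel \<Otimes>\<^sub>M borel)" unfolding \<phi>_def by measurable
  have dens: "ennreal (std_normal_density s) * ennreal (std_normal_density y) = \<phi> s y" for s y
    unfolding \<phi>_def std_normal_density_def
    by (simp add: mult_exp_exp add_divide_distrib flip: ennreal_mult)
  have two: "(\<integral>\<^sup>+s. \<integral>\<^sup>+y. k s y \<partial>std_normal_distribution \<partial>std_normal_distribution) =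
     (\<integral>\<^sup>+s. \<integral>\<^sup>+y. \<phi> s y * k s y \<partial>lborel \<partial>lborel)"
    if [measurable]: "case_prod k \<in> borel_measurable (borel \<Otimes>\<^sub>M borel)" for k :: "real \<Rightarrow> real \<Rightarrow> ennreal"
  proof -
    have "(\<integral>\<^sup>+s. \<integral>\<^sup>+y. k s y \<partial>std_normal_distribution \<partial>std_normal_distribution) =
      (\<integral>\<^sup>+s. ennreal (std_normal_density s) * (\<integral>\<^sup>+y. ennreal (std_normal_density y) * k s y \<partial>lborel) \<partial>lborel)"
      by (subst nn_integral_density)
         (auto simp: nn_integral_density intro!: nn_integral_cong)
    also have "\<dots> = (\<integral>\<^sup>+s. \<integral>\<^sup>+y. ennreal (std_normal_density s) * (ennreal (std_normal_density y) * k s y) \<partial>lborel \<partial>lborel)"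
      by (intro nn_integral_cong nn_integral_cmult[symmetric]) simp
    finally show ?thesis by (simp only: mult.assoc[symmetric] dens)
  qed
  have a0: "a \<noteq> 0" using ab by simp
  have "(\<integral>\<^sup>+s. \<integral>\<^sup>+y. f (a * s + b * y) (a * y - b * s) \<partial>std_normal_distribution \<partial>std_normal_distribution) =
     (\<integral>\<^sup>+s. \<integral>\<^sup>+y. \<phi> s y * f (a * s + b * y) (a * y - b * s) \<partial>lborel \<partial>lborel)"
    by (rule two) simp
  also have "\<dots> = (\<integral>\<^sup>+y. \<integral>\<^sup>+s. \<phi> s y * f (a * s + b * y) (a * y - b * s) \<partial>lborel \<partial>lborel)"
    by (rule lborel_pair.Fubini') simp
  also have "\<dots> = (\<integral>\<^sup>+y. \<integral>\<^sup>+u. ennreal (1 / a) * (\<phi> ((u - b * y) / a) y * f u ((y - b * u) / a)) \<partial>lborel \<partial>lborel)"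
  proof (rule nn_integral_cong)
    fix y :: real
    have "(\<integral>\<^sup>+s. \<phi> s y * f (a * s + b * y) (a * y - b * s) \<partial>lborel) =
       ennreal \<bar>1 / a\<bar> * (\<integral>\<^sup>+u. \<phi> (- b * y / a + 1 / a * u) y * f (a * (- b * y / a + 1 / a * u) + b * y)
          (a * y - b * (- b * y / a + 1 / a * u)) \<partial>lborel)"
      using a0 by (intro nn_integral_real_affine) auto
    also have "\<dots> = (\<integral>\<^sup>+u. ennreal \<bar>1 / a\<bar> * (\<phi> (- b * y / a + 1 / a * u) y * f (a * (- b * y / a + 1 / a * u) + b * y)
          (a * y - b * (- b * y / a + 1 / a * u))) \<partial>lborel)"
      by (rule nn_integral_cmult[symmetric]) simp
    also have "\<dots> = (\<integral>\<^sup>+u. ennreal (1 / a) * (\<phi> ((u - b * y) / a) y * f u ((y - b * u) / a)) \<partial>lborel)"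
    proof (intro nn_integral_cong)
      fix u
      have 1: "- b * y / a + 1 / a * u = (u - b * y) / a" using a0 by (simp add: field_simps)
      have 2: "a * ((u - b * y) / a) + b * y = u" using a0 by simp
      have "a * y - b * ((u - b * y) / a) = (a\<^sup>2 * y + b\<^sup>2 * y - b * u) / a"
        using a0 by (simp add: field_simps power2_eq_square)
      also have "a\<^sup>2 * y + b\<^sup>2 * y = y" using ab(1) by (simp flip: distrib_right)
      finally have 3: "a * y - b * ((u - b * y) / a) = (y - b * u) / a" .
      show "ennreal \<bar>1 / a\<bar> * (\<phi> (- b * y / a + 1 / a * u) y * f (a * (- b * y / a + 1 / a * u) + b * y)
          (a * y - b * (- b * y / a + 1 / a * u))) = ennreal (1 / a) * (\<phi> ((u - b * y) / a) y * f u ((y - b * u) / a))"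
        unfolding 1 2 3 using ab(2) by simp
    qed
    finally show "(\<integral>\<^sup>+s. \<phi> s y * f (a * s + b * y) (a * y - b * s) \<partial>lborel) =
      (\<integral>\<^sup>+u. ennreal (1 / a) * (\<phi> ((u - b * y) / a) y * f u ((y - b * u) / a)) \<partial>lborel)" .
  qed
  also have "\<dots> = (\<integral>\<^sup>+u. \<integral>\<^sup>+y. ennreal (1 / a) * (\<phi> ((u - b * y) / a) y * f u ((y - b * u) / a)) \<partial>lborel \<partial>lborel)"
    by (rule lborel_pair.Fubini') simp
  also have "\<dots> = (\<integral>\<^sup>+u. \<integral>\<^sup>+v. \<phi> u v * f u v \<partial>lborel \<partial>lborel)"
  proof (rule nn_integral_cong)
    fix u :: real
    have "(\<integral>\<^sup>+y. ennreal (1 / a) * (\<phi> ((u - b * y) / a) y * f u ((y - b * u) / a)) \<partial>lborel) =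
       ennreal \<bar>a\<bar> * (\<integral>\<^sup>+v. ennreal (1 / a) * (\<phi> ((u - b * (b * u + a * v)) / a) (b * u + a * v) * f u ((b * u + a * v - b * u) / a)) \<partial>lborel)"
      using a0 by (intro nn_integral_real_affine) auto
    also have "\<dots> = (\<integral>\<^sup>+v. ennreal \<bar>a\<bar> * (ennreal (1 / a) * (\<phi> ((u - b * (b * u + a * v)) / a) (b * u + a * v) * f u ((b * u + a * v - b * u) / a))) \<partial>lborel)"
      by (rule nn_integral_cmult[symmetric]) simp
    also have "\<dots> = (\<integral>\<^sup>+v. \<phi> u v * f u v \<partial>lborel)"
    proof (intro nn_integral_cong)
      fix v
      have "u - b * (b * u + a * v) = (a\<^sup>2 + b\<^sup>2) * u - b\<^sup>2 * u - a * b * v"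
        unfolding ab(1) by (simp add: algebra_simps power2_eq_square)
      hence 1: "(u - b * (b * u + a * v)) / a = a * u - b * v"
        using a0 by (simp add: field_simps power2_eq_square)
      have "(a * u - b * v)\<^sup>2 + (b * u + a * v)\<^sup>2 = (a\<^sup>2 + b\<^sup>2) * (u\<^sup>2 + v\<^sup>2)"
        by (simp add: power2_eq_square algebra_simps)
      hence 2: "\<phi> (a * u - b * v) (b * u + a * v) = \<phi> u v" unfolding \<phi>_def ab(1) by simp
      have 3: "(b * u + a * v - b * u) / a = v" using a0 by simp
      have 4: "ennreal \<bar>a\<bar> * ennreal (1 / a) = 1" using ab(2) by (simp flip: ennreal_mult)
      show "ennreal \<bar>a\<bar> * (ennreal (1 / a) * (\<phi> ((u - b * (b * u + a * v)) / a) (b * u + a * v) * f u ((b * u + a * v - b * u) / a)))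
         = \<phi> u v * f u v"
        unfolding 1 2 3 mult.assoc[symmetric] 4 by simp
    qed
    finally show "(\<integral>\<^sup>+y. ennreal (1 / a) * (\<phi> ((u - b * y) / a) y * f u ((y - b * u) / a)) \<partial>lborel) =
      (\<integral>\<^sup>+v. \<phi> u v * f u v \<partial>lborel)" .
  qed
  also have "\<dots> = (\<integral>\<^sup>+u. \<integral>\<^sup>+v. f u v \<partial>std_normal_distribution \<partial>std_normal_distribution)"
    by (rule two[symmetric]) simp
  finally show ?thesis .
qed

section \<open>Plain and centred sums of squares of independent normals\<close>

lemma sum_sq_Suc: "sum_sq (Suc k) (z(Suc k := y)) = sum_sq k z + y\<^sup>2"
  unfolding sum_sq_def by (simp add: sum.atLeast1_atMost_eq)

lemma centred_sum_sq_alt: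
  assumes "1 \<le> k"
  shows "centred_sum_sq k z = (\<Sum>i\<in>{1..k}. (z i)\<^sup>2) - (\<Sum>i\<in>{1..k}. z i)\<^sup>2 / real k"
proof -
  define m where "m = (\<Sum>i\<in>{1..k}. z i) / real k"
  have T: "(\<Sum>i\<in>{1..k}. z i) = real k * m" using assms by (simp add: m_def)
  have "centred_sum_sq k z = (\<Sum>i\<in>{1..k}. (z i)\<^sup>2 - 2 * m * z i + m\<^sup>2)"
    unfolding centred_sum_sq_def m_def[symmetric]
    by (intro sum.cong) (auto simp: power2_eq_square algebra_simps)
  also have "\<dots> = (\<Sum>i\<in>{1..k}. (z i)\<^sup>2) - 2 * m * (\<Sum>i\<in>{1..k}. z i) + real k * m\<^sup>2"
    by (simp add: sum.distrib sum_subtractf sum_distrib_left)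
  also have "\<dots> = (\<Sum>i\<in>{1..k}. (z i)\<^sup>2) - (\<Sum>i\<in>{1..k}. z i)\<^sup>2 / real k"
    unfolding T using assms by (simp add: power2_eq_square)
  finally show ?thesis .
qed

text \<open>One step of the Helmert transform. The coefficients of the new contrast form the second
  row of the rotation that sends (\<open>S\<close>, \<open>y\<close>) to the new normalised sum and
  this contrast.\<close>

lemma centred_sum_sq_Suc:
  fixes z :: "nat \<Rightarrow> real"
  assumes k: "1 \<le> k"
  defines "S \<equiv> (\<Sum>i\<in>{1..k}. z i) / sqrt k"
  shows "centred_sum_sq (Suc k) (z(Suc k := y)) =
    centred_sum_sq k z + (sqrt (k / Suc k) * y - sqrt (1 / Suc k) * S)\<^sup>2"
proof -
  define q where "q = sqrt (real k)"
  have q: "q > 0" "q\<^sup>2 = real k" using k by (auto simp: q_def)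
  have T: "(\<Sum>i\<in>{1..k}. z i) = q * S" using q by (simp add: S_def q_def)
  have "(sqrt (k / Suc k) * y - sqrt (1 / Suc k) * S)\<^sup>2 = ((q * y - S) / sqrt (Suc k))\<^sup>2"
    by (simp add: q_def real_sqrt_divide diff_divide_distrib)
  also have "\<dots> = (q * y - S)\<^sup>2 / (q\<^sup>2 + 1)" using q by (simp add: power_divide)
  finally have 1: "(sqrt (k / Suc k) * y - sqrt (1 / Suc k) * S)\<^sup>2 = (q * y - S)\<^sup>2 / (q\<^sup>2 + 1)" .
  have 2: "(\<Sum>i\<in>{1..Suc k}. (z(Suc k := y)) i) = (\<Sum>i\<in>{1..k}. z i) + y"
    and 3: "(\<Sum>i\<in>{1..Suc k}. ((z(Suc k := y)) i)\<^sup>2) = (\<Sum>i\<in>{1..k}. (z i)\<^sup>2) + y\<^sup>2"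
    by (simp_all add: sum.atLeast1_atMost_eq)
  have 4: "real (Suc k) = q\<^sup>2 + 1" using q by simp
  have "q\<^sup>2 + 1 > 0" using q by (simp add: add_pos_pos)
  hence "y\<^sup>2 - (q * S + y)\<^sup>2 / (q\<^sup>2 + 1) = - (q * S)\<^sup>2 / q\<^sup>2 + (q * y - S)\<^sup>2 / (q\<^sup>2 + 1)"
    using q(1) by (simp add: divide_simps) (simp add: power2_eq_square algebra_simps)
  moreover have "centred_sum_sq (Suc k) (z(Suc k := y)) =
      (\<Sum>i\<in>{1..k}. (z i)\<^sup>2) + y\<^sup>2 - (q * S + y)\<^sup>2 / (q\<^sup>2 + 1)"
    using centred_sum_sq_alt[of "Suc k" "z(Suc k := y)"] unfolding 2 3 4 T by simp
  moreover have "centred_sum_sq k z = (\<Sum>i\<in>{1..k}. (z i)\<^sup>2) - (q * S)\<^sup>2 / q\<^sup>2"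
    by (simp only: centred_sum_sq_alt[OF k] T q(2))
  ultimately show ?thesis unfolding 1 by simp
qed

abbreviation normal_vector :: "nat \<Rightarrow> (nat \<Rightarrow> real) measure" where
  "normal_vector k \<equiv> PiM {1..k} (\<lambda>_. std_normal_distribution)"

lemma sum_sq_measurable [measurable]: "sum_sq k \<in> borel_measurable (PiM {1..k} (\<lambda>_. borel))"
  unfolding sum_sq_def[abs_def] by measurable

lemma centred_sum_sq_measurable [measurable]:
  "centred_sum_sq k \<in> borel_measurable (PiM {1..k} (\<lambda>_. borel))"
  unfolding centred_sum_sq_def[abs_def] by measurable

interpretation std_normal: prob_space std_normal_distribution
  by (rule prob_space_std_normal)

interpretation normal_product: product_sigma_finite "\<lambda>_::nat. std_normal_distribution"
  by standard

lemma sets_normal_vector [measurable_cong]: "sets (normal_vector k) = sets (PiM {1..k} (\<lambda>_. borel))"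
  by (rule sets_PiM_cong) auto

lemma nn_integral_normal_vector_Suc:
  assumes "f \<in> borel_measurable (PiM {1..Suc k} (\<lambda>_. borel))"
  shows "(\<integral>\<^sup>+z. f z \<partial>normal_vector (Suc k)) =
    (\<integral>\<^sup>+z. \<integral>\<^sup>+y. f (z(Suc k := y)) \<partial>std_normal_distribution \<partial>normal_vector k)"
proof -
  have ins: "{1..Suc k} = insert (Suc k) {1..k}" by auto
  have "f \<in> borel_measurable (normal_vector (Suc k))"
    using assms by (simp only: measurable_cong_sets[OF sets_normal_vector refl])
  thus ?thesis unfolding ins
    by (intro normal_product.product_nn_integral_insert) auto
qed

lemma nn_integral_sum_sq:
  assumes [measurable]: "h \<in> borel_measurable borel"
  shows "(\<integral>\<^sup>+z. h (sum_sq k z) \<partial>normal_vector k) = (\<integral>\<^sup>+x. h x \<partial>chi_sq0 k)"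
  using assms
proof (induction k arbitrary: h)
  case 0
  thus ?case by (simp add: chi_sq0_def sum_sq_def nn_integral_return PiM_empty)
next
  case (Suc k)
  note [measurable] = Suc.prems
  have "(\<integral>\<^sup>+z. h (sum_sq (Suc k) z) \<partial>normal_vector (Suc k)) =
      (\<integral>\<^sup>+z. \<integral>\<^sup>+y. h (sum_sq k z + y\<^sup>2) \<partial>std_normal_distribution \<partial>normal_vector k)"
    unfolding sum_sq_Suc[symmetric] by (rule nn_integral_normal_vector_Suc) measurable
  also have "\<dots> = (\<integral>\<^sup>+q. \<integral>\<^sup>+y. h (q + y\<^sup>2) \<partial>std_normal_distribution \<partial>chi_sq0 k)"
    by (rule Suc.IH) measurable
  also have "\<dots> = (\<integral>\<^sup>+x. h x \<partial>chi_sq0 (Suc k))"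
    by (rule nn_integral_chi_sq0_Suc[symmetric]) simp
  finally show ?case .
qed

text \<open>Adding one more normal variable rotates (normalised sum, new variable) into (new normalised
  sum, new contrast), so the centred sum of squares gains the square of an independent normal.\<close>

lemma nn_integral_centred_sum_sq:
  assumes "1 \<le> k" "case_prod f \<in> borel_measurable (borel \<Otimes>\<^sub>M borel)"
  shows "(\<integral>\<^sup>+z. f (centred_sum_sq k z) ((\<Sum>i\<in>{1..k}. z i) / sqrt k) \<partial>normal_vector k) =
    (\<integral>\<^sup>+q. \<integral>\<^sup>+s. f q s \<partial>std_normal_distribution \<partial>chi_sq0 (k - 1))"
  using assms
proof (induction k arbitrary: f rule: dec_induct)
  case base
  note [measurable] = base
  have "(\<integral>\<^sup>+z. f (centred_sum_sq 1 z) ((\<Sum>i\<in>{1..1}. z i) / sqrt 1) \<partial>normal_vector 1) =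
      (\<integral>\<^sup>+z. f 0 (z 1) \<partial>PiM {1::nat} (\<lambda>_. std_normal_distribution))"
    by (simp add: centred_sum_sq_def del: One_nat_def)
  also have "\<dots> = (\<integral>\<^sup>+s. f 0 s \<partial>std_normal_distribution)"
    by (rule normal_product.product_nn_integral_singleton) measurable
  also have "\<dots> = (\<integral>\<^sup>+q. \<integral>\<^sup>+s. f q s \<partial>std_normal_distribution \<partial>return borel 0)"
    by (rule nn_integral_return[symmetric]) measurable
  finally show ?case by (simp add: chi_sq0_def)
next
  case (step k)
  note [measurable] = step.prems
  define a b where "a = sqrt (k / Suc k)" and "b = sqrt (1 / Suc k)"
  have ab: "a\<^sup>2 + b\<^sup>2 = 1" "a > 0" using step.hyps by (simp_all add: a_def b_def field_simps)
  have S: "(\<Sum>i\<in>{1..Suc k}. (z(Suc k := y)) i) / sqrt (Suc k) = a * ((\<Sum>i\<in>{1..k}. z i) / sqrt k) + b * y"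
    for z :: "nat \<Rightarrow> real" and y
  proof -
    have "(\<Sum>i\<in>{1..Suc k}. (z(Suc k := y)) i) = (\<Sum>i\<in>{1..k}. z i) + y"
      by (simp add: sum.atLeast1_atMost_eq)
    thus ?thesis using step.hyps by (simp add: a_def b_def real_sqrt_divide add_divide_distrib)
  qed
  have "(\<integral>\<^sup>+z. f (centred_sum_sq (Suc k) z) ((\<Sum>i\<in>{1..Suc k}. z i) / sqrt (Suc k)) \<partial>normal_vector (Suc k)) =
     (\<integral>\<^sup>+z. \<integral>\<^sup>+y. f (centred_sum_sq (Suc k) (z(Suc k := y))) ((\<Sum>i\<in>{1..Suc k}. (z(Suc k := y)) i) / sqrt (Suc k))
        \<partial>std_normal_distribution \<partial>normal_vector k)"
    by (rule nn_integral_normal_vector_Suc) measurable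
  \<comment> \<open>The induction hypothesis is used for the function that integrates out the new
    variable; hence it must cover joint functions of the centred sum of squares and the normalised
    sum.\<close>
  also have "\<dots> = (\<integral>\<^sup>+z. (\<lambda>q s. \<integral>\<^sup>+y. f (q + (a * y - b * s)\<^sup>2) (a * s + b * y) \<partial>std_normal_distribution)
       (centred_sum_sq k z) ((\<Sum>i\<in>{1..k}. z i) / sqrt k) \<partial>normal_vector k)"
    unfolding S using step.hyps by (simp only: centred_sum_sq_Suc a_def b_def)
  also have "\<dots> = (\<integral>\<^sup>+q. \<integral>\<^sup>+s. \<integral>\<^sup>+y. f (q + (a * y - b * s)\<^sup>2) (a * s + b * y)
       \<partial>std_normal_distribution \<partial>std_normal_distribution \<partial>chi_sq0 (k - 1))"
    by (rule step.IH) measurable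
  also have "\<dots> = (\<integral>\<^sup>+q. \<integral>\<^sup>+u. \<integral>\<^sup>+v. f (q + v\<^sup>2) u
       \<partial>std_normal_distribution \<partial>std_normal_distribution \<partial>chi_sq0 (k - 1))"
    by (rule nn_integral_cong, rule std_normal_rotation[OF _ ab, of "\<lambda>u v. f (_ + v\<^sup>2) u"]) measurable
  also have "\<dots> = (\<integral>\<^sup>+q. \<integral>\<^sup>+v. \<integral>\<^sup>+u. f (q + v\<^sup>2) u
       \<partial>std_normal_distribution \<partial>std_normal_distribution \<partial>chi_sq0 (k - 1))"
  proof -
    interpret pair_sigma_finite std_normal_distribution std_normal_distribution ..
    show ?thesis by (rule nn_integral_cong, rule Fubini') measurable
  qed
  also have "\<dots> = (\<integral>\<^sup>+q. \<integral>\<^sup>+u. f q u \<partial>std_normal_distribution \<partial>chi_sq0 (Suc (k - 1)))"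
    by (rule nn_integral_chi_sq0_Suc[symmetric]) measurable
  also have "Suc (k - 1) = Suc k - 1" using step.hyps by simp
  finally show ?case .
qed

lemma distr_sum_sq:
  assumes "1 \<le> k" shows "distr (normal_vector k) borel (sum_sq k) = chi_sq k"
proof (rule measure_eqI)
  fix A assume "A \<in> sets (distr (normal_vector k) borel (sum_sq k))"
  hence [measurable]: "A \<in> sets borel" by simp
  have "emeasure (distr (normal_vector k) borel (sum_sq k)) A =
      (\<integral>\<^sup>+x. indicator A x \<partial>distr (normal_vector k) borel (sum_sq k))" by simp
  also have "\<dots> = (\<integral>\<^sup>+z. indicator A (sum_sq k z) \<partial>normal_vector k)"
    by (rule nn_integral_distr) measurable
  also have "\<dots> = (\<integral>\<^sup>+x. indicator A x \<partial>chi_sq0 k)" by (rule nn_integral_sum_sq) simp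
  also have "\<dots> = emeasure (chi_sq k) A" using assms by (simp add: chi_sq0_def)
  finally show "emeasure (distr (normal_vector k) borel (sum_sq k)) A = emeasure (chi_sq k) A" .
qed simp

lemma distr_centred_sum_sq:
  assumes "2 \<le> k" shows "distr (normal_vector k) borel (centred_sum_sq k) = chi_sq (k - 1)"
proof (rule measure_eqI)
  fix A assume "A \<in> sets (distr (normal_vector k) borel (centred_sum_sq k))"
  hence [measurable]: "A \<in> sets borel" by simp
  have "emeasure (distr (normal_vector k) borel (centred_sum_sq k)) A =
      (\<integral>\<^sup>+x. indicator A x \<partial>distr (normal_vector k) borel (centred_sum_sq k))" by simp
  also have "\<dots> = (\<integral>\<^sup>+z. indicator A (centred_sum_sq k z) \<partial>normal_vector k)"
    by (rule nn_integral_distr) measurable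
  also have "\<dots> = (\<integral>\<^sup>+q. \<integral>\<^sup>+s. indicator A q \<partial>std_normal_distribution \<partial>chi_sq0 (k - 1))"
    using assms by (intro nn_integral_centred_sum_sq[of k "\<lambda>q s. indicator A q"]) auto
  also have "\<dots> = emeasure (chi_sq (k - 1)) A"
    using assms std_normal.emeasure_space_1 by (simp add: chi_sq0_def)
  finally show "emeasure (distr (normal_vector k) borel (centred_sum_sq k)) A = emeasure (chi_sq (k - 1)) A" .
qed simp

section \<open>Continuous mapping and perturbation of weak limits\<close>

lemma PiM_distr_components:
  fixes M M' :: "'i \<Rightarrow> 'a measure" and f :: "'i \<Rightarrow> 'a \<Rightarrow> 'a"
  assumes fin: "finite I" and M: "\<And>i. prob_space (M i)"
    and f: "\<And>i. f i \<in> measurable (M i) (M' i)"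
  shows "distr (PiM I M) (PiM I M') (\<lambda>x. \<lambda>i\<in>I. f i (x i)) = PiM I (\<lambda>i. distr (M i) (M' i) (f i))"
proof -
  interpret M: prob_space "M i" for i by (rule M)
  have pd: "prob_space (distr (M i) (M' i) (f i))" for i by (rule M.prob_space_distr[OF f])
  interpret D: product_sigma_finite "\<lambda>i. distr (M i) (M' i) (f i)"
    unfolding product_sigma_finite_def using pd by (simp add: prob_space_imp_sigma_finite)
  interpret MM: product_sigma_finite M by unfold_locales
  have sets: "sets (PiM I (\<lambda>i. distr (M i) (M' i) (f i))) = sets (PiM I M')" by (rule sets_PiM_cong) auto
  have meas: "(\<lambda>x. \<lambda>i\<in>I. f i (x i)) \<in> measurable (PiM I M) (PiM I M')"
    by (intro measurable_restrict measurable_PiM_component_rev f)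
  show ?thesis
  proof (rule D.PiM_eqI[OF fin])
    show "sets (distr (PiM I M) (PiM I M') (\<lambda>x. \<lambda>i\<in>I. f i (x i))) = sets (PiM I (\<lambda>i. distr (M i) (M' i) (f i)))"
      using sets by simp
    fix A assume "\<And>i. i \<in> I \<Longrightarrow> A i \<in> sets (distr (M i) (M' i) (f i))"
    hence A: "\<And>i. i \<in> I \<Longrightarrow> A i \<in> sets (M' i)" by simp
    have "emeasure (distr (PiM I M) (PiM I M') (\<lambda>x. \<lambda>i\<in>I. f i (x i))) (PiE I A) =
        emeasure (PiM I M) ((\<lambda>x. \<lambda>i\<in>I. f i (x i)) -` PiE I A \<inter> space (PiM I M))"
      using A fin by (intro emeasure_distr[OF meas]) (auto intro: sets_PiM_I_finite)
    also have "(\<lambda>x. \<lambda>i\<in>I. f i (x i)) -` PiE I A \<inter> space (PiM I M) = PiE I (\<lambda>i. f i -` A i \<inter> space (M i))"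
      by (auto simp: space_PiM PiE_iff)
    also have "emeasure (PiM I M) \<dots> = (\<Prod>i\<in>I. emeasure (M i) (f i -` A i \<inter> space (M i)))"
      using fin A by (intro MM.emeasure_PiM) (auto intro: measurable_sets[OF f])
    also have "\<dots> = (\<Prod>i\<in>I. emeasure (distr (M i) (M' i) (f i)) (A i))"
      using A by (intro prod.cong refl) (simp add: emeasure_distr[OF f])
    finally show "emeasure (distr (PiM I M) (PiM I M') (\<lambda>x. \<lambda>i\<in>I. f i (x i))) (PiE I A) =
        (\<Prod>i\<in>I. emeasure (distr (M i) (M' i) (f i)) (A i))" .
  qed
qed

text \<open>Weak convergence of the independent coordinates is realised as pointwise convergence on a product
  of Skorohod spaces, which gives the continuous mapping theorem for functions of several coordinates.\<close>

lemma char_PiM_continuous_mapping: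
  fixes \<mu> :: "nat \<Rightarrow> nat \<Rightarrow> real measure" and F :: "(nat \<Rightarrow> real) \<Rightarrow> real"
  assumes fin: "finite I" and \<mu>: "\<And>i n. i \<in> I \<Longrightarrow> real_distribution (\<mu> i n)" and M: "real_distribution M"
    and conv: "\<And>i. i \<in> I \<Longrightarrow> weak_conv_m (\<mu> i) M"
    and F: "F \<in> borel_measurable (PiM I (\<lambda>_. borel))"
    and F_cont: "\<And>z z'. (\<And>i. i \<in> I \<Longrightarrow> (\<lambda>n. z n i) \<longlonglongrightarrow> z' i) \<Longrightarrow> (\<lambda>n. F (z n)) \<longlonglongrightarrow> F z'"
  shows "(\<lambda>n. char (distr (PiM I (\<lambda>i. \<mu> i n)) borel F) t) \<longlonglongrightarrow> char (distr (PiM I (\<lambda>_. M)) borel F) t"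
proof -
  \<comment> \<open>Extending the family by the constant \<open>M\<close> outside \<open>I\<close>
    makes Skorohod's theorem applicable at every index, so that all spaces can be chosen
    together.\<close>
  define \<nu> where "\<nu> i n = (if i \<in> I then \<mu> i n else M)" for i n
  have \<nu>: "real_distribution (\<nu> i n)" for i n using \<mu> M by (simp add: \<nu>_def)
  have conv': "weak_conv_m (\<nu> i) M" for i
    using conv[of i] by (cases "i \<in> I") (auto simp: \<nu>_def[abs_def] weak_conv_m_def weak_conv_def)
  have "\<exists>\<Omega> Y Y'. prob_space (\<Omega> :: real measure) \<and> (\<forall>n. Y n \<in> measurable \<Omega> borel) \<and>
      (\<forall>n. distr \<Omega> borel (Y n) = \<nu> i n) \<and> Y' \<in> measurable \<Omega> lborel \<and> distr \<Omega> borel Y' = M \<and>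
      (\<forall>x\<in>space \<Omega>. (\<lambda>n. Y n x) \<longlonglongrightarrow> Y' x)" for i
    using Skorohod[OF \<nu> M conv', of i] by blast
  then obtain \<Omega> Y Y' where \<Omega>: "\<And>i. prob_space (\<Omega> i :: real measure)"
    and Y: "\<And>i n. Y i n \<in> measurable (\<Omega> i) borel" "\<And>i n. distr (\<Omega> i) borel (Y i n) = \<nu> i n"
    and Y': "\<And>i. Y' i \<in> measurable (\<Omega> i) lborel" "\<And>i. distr (\<Omega> i) borel (Y' i) = M"
    and lim: "\<And>i x. x \<in> space (\<Omega> i) \<Longrightarrow> (\<lambda>n. Y i n x) \<longlonglongrightarrow> Y' i x"
    by metis
  have Y'b: "Y' i \<in> measurable (\<Omega> i) borel" for i using Y'(1)[of i] by simp
  have law: "PiM I (\<lambda>i. \<mu> i n) = distr (PiM I \<Omega>) (PiM I (\<lambda>_. borel)) (\<lambda>x. \<lambda>i\<in>I. Y i n (x i))" for n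
  proof -
    have "PiM I (\<lambda>i. \<mu> i n) = PiM I (\<lambda>i. \<nu> i n)" by (rule PiM_cong) (auto simp: \<nu>_def)
    also have "\<dots> = distr (PiM I \<Omega>) (PiM I (\<lambda>_. borel)) (\<lambda>x. \<lambda>i\<in>I. Y i n (x i))"
      using PiM_distr_components[OF fin \<Omega>, where f = "\<lambda>i. Y i n" and M' = "\<lambda>_. borel"] Y by simp
    finally show ?thesis .
  qed
  have law': "PiM I (\<lambda>_. M) = distr (PiM I \<Omega>) (PiM I (\<lambda>_. borel)) (\<lambda>x. \<lambda>i\<in>I. Y' i (x i))"
    using PiM_distr_components[OF fin \<Omega>, where f = Y' and M' = "\<lambda>_. borel"] Y'b Y'(2) by simp
  interpret P: prob_space "PiM I \<Omega>" by (rule prob_space_PiM) (rule \<Omega>)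
  note F[measurable]
  have mY [measurable]: "(\<lambda>x. \<lambda>i\<in>I. Y i n (x i)) \<in> measurable (PiM I \<Omega>) (PiM I (\<lambda>_. borel))" for n
    by (intro measurable_restrict measurable_PiM_component_rev Y(1))
  have mY' [measurable]: "(\<lambda>x. \<lambda>i\<in>I. Y' i (x i)) \<in> measurable (PiM I \<Omega>) (PiM I (\<lambda>_. borel))"
    by (intro measurable_restrict measurable_PiM_component_rev Y'b)
  have ch: "char (distr (distr (PiM I \<Omega>) (PiM I (\<lambda>_. borel)) g) borel F) t = (CLINT x|PiM I \<Omega>. iexp (t * F (g x)))"
    if [measurable]: "g \<in> measurable (PiM I \<Omega>) (PiM I (\<lambda>_. borel))" for g
    unfolding char_def by (simp add: integral_distr)
  show ?thesis
    unfolding law law' ch[OF mY] ch[OF mY']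
  proof (rule integral_dominated_convergence[where w = "\<lambda>_. 1"])
    show "AE x in PiM I \<Omega>. (\<lambda>n. iexp (t * F (\<lambda>i\<in>I. Y i n (x i)))) \<longlonglongrightarrow> iexp (t * F (\<lambda>i\<in>I. Y' i (x i)))"
    proof (rule AE_I2)
      fix x assume x: "x \<in> space (PiM I \<Omega>)"
      have "(\<lambda>n. F (\<lambda>i\<in>I. Y i n (x i))) \<longlonglongrightarrow> F (\<lambda>i\<in>I. Y' i (x i))"
        by (rule F_cont) (use x lim in \<open>auto simp: space_PiM\<close>)
      thus "(\<lambda>n. iexp (t * F (\<lambda>i\<in>I. Y i n (x i)))) \<longlonglongrightarrow> iexp (t * F (\<lambda>i\<in>I. Y' i (x i)))"
        by (intro tendsto_intros)
    qed
  qed (auto simp del: of_real_mult)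
qed

text \<open>The two complex exponentials differ by at most |t| e on \<open>S\<close> and by at most
  2 elsewhere.\<close>

lemma char_diff_le:
  fixes p :: "'a pmf" and X Y :: "'a \<Rightarrow> real"
  assumes "\<And>\<omega>. \<omega> \<in> S \<Longrightarrow> \<bar>X \<omega> - Y \<omega>\<bar> \<le> e" "0 \<le> e"
  shows "cmod (char (distr (measure_pmf p) borel X) t - char (distr (measure_pmf p) borel Y) t)
     \<le> \<bar>t\<bar> * e + 2 * (1 - measure_pmf.prob p S)"
proof -
  have int: "integrable (measure_pmf p) (\<lambda>\<omega>. iexp (t * Z \<omega>))" for Z
    by (intro measure_pmf.integrable_const_bound[of _ 1]) (auto simp del: of_real_mult)
  have pt: "cmod (iexp (t * X \<omega>) - iexp (t * Y \<omega>)) \<le> \<bar>t\<bar> * e + 2 * indicator (- S) \<omega>" for \<omega>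
  proof (cases "\<omega> \<in> S")
    case True
    have "iexp (t * X \<omega>) - iexp (t * Y \<omega>) = iexp (t * Y \<omega>) * (iexp (t * X \<omega> - t * Y \<omega>) - 1)"
      by (simp add: right_diff_distrib flip: exp_add)
    hence "cmod (iexp (t * X \<omega>) - iexp (t * Y \<omega>)) = cmod (iexp (t * X \<omega> - t * Y \<omega>) - 1)"
      by (simp only: norm_mult norm_exp_i_times mult_1_left)
    also have "\<dots> \<le> \<bar>t * X \<omega> - t * Y \<omega>\<bar>"
      using iexp_approx1[of "t * X \<omega> - t * Y \<omega>" 0] by simp
    also have "\<dots> = \<bar>t\<bar> * \<bar>X \<omega> - Y \<omega>\<bar>" by (simp add: abs_mult flip: right_diff_distrib)
    also have "\<dots> \<le> \<bar>t\<bar> * e" using assms(1)[OF True] by (intro mult_left_mono) auto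
    finally show ?thesis using True by simp
  next
    case False
    have "cmod (iexp (t * X \<omega>) - iexp (t * Y \<omega>)) \<le> cmod (iexp (t * X \<omega>)) + cmod (iexp (t * Y \<omega>))"
      by (rule norm_triangle_ineq4)
    also have "\<dots> = 2" by (simp only: norm_exp_i_times)
    also have "\<dots> \<le> \<bar>t\<bar> * e + 2" using assms(2) by simp
    finally show ?thesis using False by simp
  qed
  have "char (distr (measure_pmf p) borel X) t - char (distr (measure_pmf p) borel Y) t =
      (CLINT \<omega>|measure_pmf p. iexp (t * X \<omega>) - iexp (t * Y \<omega>))"
    unfolding char_def by (simp add: integral_distr Bochner_Integration.integral_diff[OF int int] del: of_real_mult)
  also have "cmod \<dots> \<le> (LINT \<omega>|measure_pmf p. cmod (iexp (t * X \<omega>) - iexp (t * Y \<omega>)))"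
    by (rule integral_norm_bound)
  also have "\<dots> \<le> (LINT \<omega>|measure_pmf p. \<bar>t\<bar> * e + 2 * indicator (- S) \<omega>)"
    using int by (intro integral_mono pt) (auto intro!: Bochner_Integration.integrable_add integrable_mult_right
        simp: measure_pmf.integrable_const integrable_indicator_iff less_top[symmetric])
  also have "\<dots> = \<bar>t\<bar> * e + 2 * measure_pmf.prob p (- S)"
    by (subst Bochner_Integration.integral_add) (auto simp: less_top[symmetric])
  also have "measure_pmf.prob p (- S) = 1 - measure_pmf.prob p S"
    using measure_pmf.prob_compl[of S p] by (simp add: Compl_eq_Diff_UNIV)
  finally show ?thesis .
qed

text \<open>Slutsky's argument through characteristic functions. Closeness is asked on
  \<open>S n\<close> only, so \<open>Y\<close> may take arbitrary values where the estimates fail to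
  exist.\<close>

lemma weak_conv_close:
  fixes p :: "nat \<Rightarrow> 'a pmf" and X Y :: "nat \<Rightarrow> 'a \<Rightarrow> real"
  assumes M: "real_distribution M"
    and X: "\<And>t. (\<lambda>n. char (distr (measure_pmf (p n)) borel (X n)) t) \<longlonglongrightarrow> char M t"
    and close: "\<forall>\<^sub>F n in sequentially. \<forall>\<omega>\<in>S n. \<bar>Y n \<omega> - X n \<omega>\<bar> \<le> e n"
    and e: "e \<longlonglongrightarrow> 0" and S: "(\<lambda>n. measure_pmf.prob (p n) (S n)) \<longlonglongrightarrow> 1"
  shows "weak_conv_m (\<lambda>n. distr (measure_pmf (p n)) borel (Y n)) M"
proof (rule levy_continuity[OF _ M])
  show "real_distribution (distr (measure_pmf (p n)) borel (Y n))" for n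
    by (rule prob_space.real_distribution_distr[OF measure_pmf.prob_space_axioms]) simp
  fix t
  let ?d = "\<lambda>n. char (distr (measure_pmf (p n)) borel (Y n)) t - char (distr (measure_pmf (p n)) borel (X n)) t"
  have "(\<lambda>n. \<bar>t\<bar> * \<bar>e n\<bar> + 2 * (1 - measure_pmf.prob (p n) (S n))) \<longlonglongrightarrow> \<bar>t\<bar> * \<bar>0\<bar> + 2 * (1 - 1)"
    by (intro tendsto_intros e S)
  moreover have "\<forall>\<^sub>F n in sequentially. cmod (?d n) \<le> \<bar>t\<bar> * \<bar>e n\<bar> + 2 * (1 - measure_pmf.prob (p n) (S n))"
    using close
  proof eventually_elim
    case (elim n)
    show ?case by (rule char_diff_le) (use elim in \<open>auto intro: order_trans[OF _ abs_ge_self]\<close>)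
  qed
  ultimately have "?d \<longlonglongrightarrow> 0" by (intro Lim_null_comparison[of ?d]) auto
  from tendsto_add[OF this X[of t]]
  show "(\<lambda>n. char (distr (measure_pmf (p n)) borel (Y n)) t) \<longlonglongrightarrow> char M t" by simp
qed

section \<open>Concentration and asymptotic normality of the degrees\<close>

definition edge_dev :: "(nat \<Rightarrow> real) \<Rightarrow> nat \<times> nat \<Rightarrow> (nat \<times> nat \<Rightarrow> bool) \<Rightarrow> real" where
  "edge_dev \<beta> e A = of_bool (A e) - mu (\<beta> (fst e) + \<beta> (snd e))"

lemma abs_edge_dev_le: "\<bar>edge_dev \<beta> e A\<bar> \<le> 1"
  using mu_bounds[of "\<beta> (fst e) + \<beta> (snd e)"] by (auto simp: edge_dev_def)

lemma expectation_edge: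
  fixes f :: "bool \<Rightarrow> real" and \<beta> :: "nat \<Rightarrow> real"
  assumes "e \<in> pairs n"
  defines "p \<equiv> mu (\<beta> (fst e) + \<beta> (snd e))"
  shows "measure_pmf.expectation (beta_graph n \<beta>) (\<lambda>A. f (A e)) = p * f True + (1 - p) * f False"
proof -
  have "map_pmf (\<lambda>A. A e) (beta_graph n \<beta>) = bernoulli_pmf p"
    unfolding beta_graph_def using assms by (subst Pi_pmf_component) (auto simp: case_prod_beta)
  moreover have "measure_pmf.expectation (beta_graph n \<beta>) (\<lambda>A. f (A e)) =
      measure_pmf.expectation (map_pmf (\<lambda>A. A e) (beta_graph n \<beta>)) f"
    by simp
  ultimately show ?thesis using mu_bounds unfolding p_def by simp
qed

lemma expectation_edge_dev:
  assumes "e \<in> pairs n"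
  shows "measure_pmf.expectation (beta_graph n \<beta>) (edge_dev \<beta> e) = 0"
    and "measure_pmf.expectation (beta_graph n \<beta>) (\<lambda>A. (edge_dev \<beta> e A)\<^sup>2) = dmu (\<beta> (fst e) + \<beta> (snd e))"
  using expectation_edge[OF assms, of \<beta> "\<lambda>x. of_bool x - mu (\<beta> (fst e) + \<beta> (snd e))"]
    expectation_edge[OF assms, of \<beta> "\<lambda>x. (of_bool x - mu (\<beta> (fst e) + \<beta> (snd e)))\<^sup>2"]
  by (simp_all add: edge_dev_def[abs_def] dmu_eq_mu power2_eq_square algebra_simps)

lemma indep_edges:
  "prob_space.indep_vars (measure_pmf (beta_graph n \<beta>)) (\<lambda>_. count_space UNIV) (\<lambda>e A. A e) (pairs n)"
  unfolding beta_graph_def by (rule indep_vars_Pi_pmf) simp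

lemma indep_edge_devs:
  "prob_space.indep_vars (measure_pmf (beta_graph n \<beta>)) (\<lambda>_. borel) (\<lambda>e A. c e * edge_dev \<beta> e A) (pairs n)"
  unfolding edge_dev_def
  by (rule prob_space.indep_vars_compose2[OF measure_pmf.prob_space_axioms indep_edges,
      where Y = "\<lambda>e x. c e * (of_bool x - mu (\<beta> (fst e) + \<beta> (snd e)))"]) simp

lemma hoeffding_edges:
  assumes V: "(\<Sum>e\<in>pairs n. (c e)\<^sup>2) \<le> V" and e: "0 < \<epsilon>"
  shows "measure_pmf.prob (beta_graph n \<beta>) {A. \<bar>\<Sum>e\<in>pairs n. c e * edge_dev \<beta> e A\<bar> \<ge> \<epsilon>}
     \<le> 2 * exp (- 2 * \<epsilon>\<^sup>2 / V)"
\<comment> \<open>Hoeffding's inequality is applied with a positive sum of squared widths. If all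
  weights vanish, the weighted sum is 0 and cannot reach \<epsilon>.\<close>
proof (cases "(\<Sum>e\<in>pairs n. (c e)\<^sup>2) = 0")
  case True
  hence "\<forall>e\<in>pairs n. c e = 0" by (subst (asm) sum_nonneg_eq_0_iff) auto
  hence "(\<Sum>e\<in>pairs n. c e * edge_dev \<beta> e A) = 0" for A by simp
  thus ?thesis using e by simp
next
  case False
  hence pos: "(\<Sum>e\<in>pairs n. (c e)\<^sup>2) > 0" by (simp add: sum_nonneg order_less_le)
  define p where "p e = mu (\<beta> (fst e) + \<beta> (snd e))" for e
  \<comment> \<open>The values of the summand for an absent and a present edge, ordered according to
    the sign of \<open>c e\<close>; they are |c e| apart.\<close>
  define lo hi where "lo e = min (- c e * p e) (c e * (1 - p e))"
    and "hi e = max (- c e * p e) (c e * (1 - p e))" for e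
  have width: "(hi e - lo e)\<^sup>2 = (c e)\<^sup>2" for e
  proof -
    have "c e * (1 - p e) = - c e * p e + c e" by (simp add: algebra_simps)
    thus ?thesis unfolding hi_def lo_def by (cases "c e \<ge> 0") auto
  qed
  have mean: "measure_pmf.expectation (beta_graph n \<beta>) (\<lambda>A. c e * edge_dev \<beta> e A) = 0" if "e \<in> pairs n" for e
    using expectation_edge_dev(1)[OF that] by simp
  interpret H: Hoeffding_ineq "measure_pmf (beta_graph n \<beta>)" "pairs n" "\<lambda>e A. c e * edge_dev \<beta> e A" lo hi
    "\<Sum>e\<in>pairs n. measure_pmf.expectation (beta_graph n \<beta>) (\<lambda>A. c e * edge_dev \<beta> e A)"
  proof (unfold_locales)
    show "prob_space.indep_vars (measure_pmf (beta_graph n \<beta>)) (\<lambda>_. borel) (\<lambda>e A. c e * edge_dev \<beta> e A) (pairs n)"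
      by (rule indep_edge_devs)
    show "AE A in measure_pmf (beta_graph n \<beta>). c e * edge_dev \<beta> e A \<in> {lo e..hi e}" for e
      by (rule AE_I2) (auto simp: lo_def hi_def p_def edge_dev_def)
  qed auto
  have "measure_pmf.prob (beta_graph n \<beta>) {A. \<bar>\<Sum>e\<in>pairs n. c e * edge_dev \<beta> e A\<bar> \<ge> \<epsilon>} \<le>
     2 * exp (- 2 * \<epsilon>\<^sup>2 / (\<Sum>e\<in>pairs n. (c e)\<^sup>2))"
  proof -
    have "(\<Sum>e\<in>pairs n. measure_pmf.expectation (beta_graph n \<beta>) (\<lambda>A. c e * edge_dev \<beta> e A)) = 0"
      by (intro sum.neutral ballI mean)
    thus ?thesis using H.Hoeffding_ineq_abs_ge[of \<epsilon>] e pos unfolding width by simp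
  qed
  also have "\<dots> \<le> 2 * exp (- 2 * \<epsilon>\<^sup>2 / V)"
  proof -
    have "2 * \<epsilon>\<^sup>2 / V \<le> 2 * \<epsilon>\<^sup>2 / (\<Sum>e\<in>pairs n. (c e)\<^sup>2)"
      using V pos by (intro divide_left_mono) auto
    thus ?thesis by simp
  qed
  finally show ?thesis .
qed

text \<open>Scores of different nodes share edges and are dependent. Regrouping by edges, each of
  which enters through both endpoints, gives an independent sum to which Hoeffding's inequality
  applies.\<close>

lemma sum_mult_score_edges:
  "(\<Sum>j\<in>{1..n}. x j * score n A \<beta> j) = (\<Sum>e\<in>pairs n. (x (fst e) + x (snd e)) * edge_dev \<beta> e A)"
proof -
  have "(\<Sum>j\<in>{1..n}. x j * score n A \<beta> j) = odsum n (\<lambda>j k. x j * (adj A j k - mu (\<beta> j + \<beta> k)))"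
    unfolding score_def deg_def sum_subtractf[symmetric] sum_distrib_left ..
  also have "\<dots> = (\<Sum>e\<in>pairs n. (x (fst e) + x (snd e)) * edge_dev \<beta> e A)"
    unfolding odsum_pairs
    by (intro sum.cong refl) (auto simp: pairs_def adj_def edge_dev_def add.commute distrib_right)
  finally show ?thesis .
qed

lemma prob_score_ge:
  assumes j: "j \<in> {1..n}" and n: "2 \<le> n"
  shows "measure_pmf.prob (beta_graph n \<beta>) {A. \<bar>score n A \<beta> j\<bar> \<ge> sqrt (real n * ln n)} \<le> 2 / (real n)\<^sup>2"
proof -
  define x where "x k = (if k = j then 1 else 0 :: real)" for k
  have sc: "score n A \<beta> j = (\<Sum>e\<in>pairs n. (x (fst e) + x (snd e)) * edge_dev \<beta> e A)" for A
    unfolding sum_mult_score_edges[symmetric] using j by (simp add: x_def if_distrib[of "\<lambda>u. u * _"] cong: if_cong)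
  \<comment> \<open>The endpoints of an edge differ, so at most one of them is \<open>j\<close> and
    each weight is 0 or 1, equal to its square.\<close>
  have "(\<Sum>e\<in>pairs n. (x (fst e) + x (snd e))\<^sup>2) = (\<Sum>(a, b)\<in>pairs n. x a + x b)"
    by (intro sum.cong refl) (auto simp: x_def pairs_def)
  also have "\<dots> = odsum n (\<lambda>a b. x a)" unfolding odsum_pairs ..
  also have "\<dots> = (\<Sum>a\<in>{1..n}. x a * real (card ({1..n} - {a})))" by (simp add: mult.commute)
  also have "\<dots> \<le> (\<Sum>a\<in>{1..n}. x a * real n)"
  proof (intro sum_mono mult_left_mono)
    fix a show "real (card ({1..n} - {a})) \<le> real n"
      using card_mono[of "{1..n}" "{1..n} - {a}"] by auto
  qed (auto simp: x_def)
  also have "\<dots> = real n" using j by (simp add: x_def if_distrib[of "\<lambda>u. u * _"] cong: if_cong)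
  finally have V: "(\<Sum>e\<in>pairs n. (x (fst e) + x (snd e))\<^sup>2) \<le> real n" .
  have ln: "0 < ln (real n)" using n by simp
  have "measure_pmf.prob (beta_graph n \<beta>) {A. \<bar>score n A \<beta> j\<bar> \<ge> sqrt (real n * ln n)}
     \<le> 2 * exp (- 2 * (sqrt (real n * ln n))\<^sup>2 / real n)"
    unfolding sc using n ln by (intro hoeffding_edges V) auto
  \<comment> \<open>The level sqrt (n ln n) is chosen to make the exponent -2 ln n, so that the
    bound 2 / n^2 survives a union over n nodes.\<close>
  also have "- 2 * (sqrt (real n * ln n))\<^sup>2 / real n = - (2 * ln n)" using n ln by simp
  also have "2 * exp (- (2 * ln n)) = 2 / (real n)\<^sup>2"
    using n by (simp add: exp_minus exp_double divide_inverse)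
  finally show ?thesis .
qed

text \<open>The gain from the dual weights: at most n^2 edges with weights at most 10b / n have a
  sum of squares of at most 100 b^2, free of \<open>n\<close>. The weighted noise is therefore O(b
  ln n), whereas a single score is only bounded by sqrt (n ln n).\<close>

lemma prob_weighted_score_ge:
  assumes w: "\<And>j. \<bar>w j\<bar> \<le> 5 * b / real n" and n: "3 \<le> n" and b: "0 < b" and ln1: "1 \<le> ln (real n)"
  shows "measure_pmf.prob (beta_graph n \<beta>) {A. \<bar>\<Sum>j\<in>{1..n}. w j * score n A \<beta> j\<bar> \<ge> 10 * b * ln n} \<le> 2 / (real n)\<^sup>2"
proof -
  have "(\<Sum>e\<in>pairs n. (w (fst e) + w (snd e))\<^sup>2) \<le> (\<Sum>e\<in>pairs n. (10 * b / real n)\<^sup>2)"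
  proof (intro sum_mono)
    fix e :: "nat \<times> nat"
    have "\<bar>w (fst e) + w (snd e)\<bar> \<le> 10 * b / real n" using w[of "fst e"] w[of "snd e"] by linarith
    from power_mono[OF this, of 2] show "(w (fst e) + w (snd e))\<^sup>2 \<le> (10 * b / real n)\<^sup>2" by simp
  qed
  also have "\<dots> = real (card (pairs n)) * (10 * b / real n)\<^sup>2" by simp
  also have "\<dots> \<le> real (n * n) * (10 * b / real n)\<^sup>2"
  proof (intro mult_right_mono of_nat_mono)
    have "card (pairs n) \<le> card ({1..n} \<times> {1..n})" by (intro card_mono) (auto simp: pairs_def)
    thus "card (pairs n) \<le> n * n" by (simp add: card_cartesian_product)
  qed auto
  also have "\<dots> = 100 * b\<^sup>2" using n by (simp add: power2_eq_square field_simps)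
  finally have V: "(\<Sum>e\<in>pairs n. (w (fst e) + w (snd e))\<^sup>2) \<le> 100 * b\<^sup>2" .
  have "measure_pmf.prob (beta_graph n \<beta>) {A. \<bar>\<Sum>j\<in>{1..n}. w j * score n A \<beta> j\<bar> \<ge> 10 * b * ln n}
     \<le> 2 * exp (- 2 * (10 * b * ln n)\<^sup>2 / (100 * b\<^sup>2))"
    unfolding sum_mult_score_edges using b ln1 by (intro hoeffding_edges V) auto
  also have "- 2 * (10 * b * ln n)\<^sup>2 / (100 * b\<^sup>2) = - (2 * (ln n)\<^sup>2)" using b by (simp add: power_mult_distrib)
  also have "2 * exp (- (2 * (ln n)\<^sup>2)) \<le> 2 * exp (- (2 * ln n))"
    using ln1 by (simp add: power2_eq_square)
  also have "2 * exp (- (2 * ln n)) = 2 / (real n)\<^sup>2"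
    using n by (simp add: exp_minus exp_double divide_inverse)
  finally show ?thesis .
qed

definition good_graphs :: "nat \<Rightarrow> nat \<Rightarrow> (nat \<Rightarrow> real) \<Rightarrow> real \<Rightarrow> (nat \<Rightarrow> nat \<Rightarrow> real) \<Rightarrow> (nat \<times> nat \<Rightarrow> bool) set" where
  "good_graphs n r \<beta> b w =
    {A. (\<forall>j\<in>{1..n}. \<bar>score n A \<beta> j\<bar> \<le> sqrt (real n * ln n)) \<and>
        (\<forall>i\<in>{1..r}. \<bar>\<Sum>j\<in>{1..n}. w i j * score n A \<beta> j\<bar> \<le> 10 * b * ln n)}"

lemma prob_good_graphs:
  assumes w: "\<And>i j. i \<in> {1..r} \<Longrightarrow> \<bar>w i j\<bar> \<le> 5 * b / real n"
    and n: "3 \<le> n" "r \<le> n" and b: "0 < b" and ln1: "1 \<le> ln (real n)"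
  shows "1 - 4 / real n \<le> measure_pmf.prob (beta_graph n \<beta>) (good_graphs n r \<beta> b w)"
proof -
  let ?P = "measure_pmf.prob (beta_graph n \<beta>)"
  define X where "X j = {A. \<bar>score n A \<beta> j\<bar> \<ge> sqrt (real n * ln n)}" for j
  define Y where "Y i = {A. \<bar>\<Sum>j\<in>{1..n}. w i j * score n A \<beta> j\<bar> \<ge> 10 * b * ln n}" for i
  have "1 - ?P (good_graphs n r \<beta> b w) = ?P (- good_graphs n r \<beta> b w)"
    using measure_pmf.prob_compl[of "good_graphs n r \<beta> b w" "beta_graph n \<beta>"] by (simp add: Compl_eq_Diff_UNIV)
  also have "\<dots> \<le> ?P ((\<Union>j\<in>{1..n}. X j) \<union> (\<Union>i\<in>{1..r}. Y i))"
    by (intro measure_pmf.finite_measure_mono) (auto simp: good_graphs_def X_def Y_def not_le intro: less_imp_le)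
  also have "\<dots> \<le> ?P (\<Union>j\<in>{1..n}. X j) + ?P (\<Union>i\<in>{1..r}. Y i)"
    by (intro measure_Un_le) auto
  also have "\<dots> \<le> (\<Sum>j\<in>{1..n}. ?P (X j)) + (\<Sum>i\<in>{1..r}. ?P (Y i))"
    by (intro add_mono measure_UNION_le) auto
  also have "\<dots> \<le> (\<Sum>j\<in>{1..n}. 2 / (real n)\<^sup>2) + (\<Sum>i\<in>{1..r}. 2 / (real n)\<^sup>2)"
    unfolding X_def Y_def using n b ln1 w
    by (intro add_mono sum_mono prob_score_ge prob_weighted_score_ge) auto
  also have "\<dots> = (real n + real r) * (2 / (real n)\<^sup>2)" by (simp add: distrib_right add_divide_distrib)
  also have "\<dots> \<le> (real n + real n) * (2 / (real n)\<^sup>2)"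
    using n by (intro mult_right_mono) auto
  also have "\<dots> = 4 / real n" using n by (simp add: power2_eq_square field_simps)
  finally show ?thesis by simp
qed

section \<open>Characteristic functions and independence of the z-scores\<close>

lemma exp_minus_le_quadratic: "0 \<le> x \<Longrightarrow> exp (- x) \<le> 1 - x + x\<^sup>2 / (2::real)"
proof -
  assume x: "0 \<le> x"
  let ?f = "\<lambda>x::real. 1 - x + x\<^sup>2 / 2 - exp (- x)"
  have "?f 0 \<le> ?f x"
  proof (rule DERIV_nonneg_imp_nondecreasing[OF x])
    fix y :: real
    have "(?f has_real_derivative - 1 + y + exp (- y)) (at y)"
      by (auto intro!: derivative_eq_intros)
    moreover have "0 \<le> - 1 + y + exp (- y)" using exp_ge_add_one_self[of "- y"] by simp
    ultimately show "\<exists>z. (?f has_real_derivative z) (at y) \<and> 0 \<le> z" by blast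
  qed
  thus ?thesis by simp
qed

text \<open>A quantitative comparison, because the edges form a triangular array with parameters
  changing with \<open>n\<close>. The Gaussian characteristic function is split into one factor per
  edge according to its share \<open>u k\<close> of the variance. Factors are compared singly:
  \<open>\<bar>X k A\<bar> \<le> 1 / \<sigma>\<close> bounds the third-order term by the variance,
  and the shares add up to \<open>\<sigma>\<^sup>2\<close>.\<close>

lemma char_edge_zscore:
  fixes \<beta> :: "nat \<Rightarrow> real"
  assumes i: "i \<in> {1..r}" and v: "0 < edge_var n r \<beta> i"
  defines "\<sigma> \<equiv> sqrt (edge_var n r \<beta> i)"
  shows "cmod (char (distr (measure_pmf (beta_graph n \<beta>)) borel (\<lambda>A. edge_zscore n r \<beta> A i)) t - exp (- t\<^sup>2 / 2))
     \<le> \<bar>t\<bar> ^ 3 / \<sigma> + t ^ 4 / \<sigma>\<^sup>2"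
proof -
  let ?M = "measure_pmf (beta_graph n \<beta>)"
  have \<sigma>: "0 < \<sigma>" "\<sigma>\<^sup>2 = edge_var n r \<beta> i" using v by (auto simp: \<sigma>_def)
  define K where "K = Pair i ` {r+1..n}"
  define u where "u k = dmu (\<beta> (fst k) + \<beta> (snd k))" for k
  have u: "0 < u k" "u k \<le> 1 / 4" for k using dmu_pos dmu_le_quarter by (auto simp: u_def)
  have sumu: "(\<Sum>k\<in>K. u k) = \<sigma>\<^sup>2" unfolding \<sigma>(2) edge_var_def K_def u_def by (subst sum.reindex) (auto intro: inj_onI)
  define X where "X k A = 1 / \<sigma> * edge_dev \<beta> k A" for k A
  have pr: "k \<in> pairs n" if "k \<in> K" for k using that i by (auto simp: K_def pairs_def)
  have indepX: "prob_space.indep_vars ?M (\<lambda>_. borel) X K"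
    unfolding X_def[abs_def]
    by (rule prob_space.indep_vars_subset[OF measure_pmf.prob_space_axioms indep_edge_devs]) (use pr in auto)
  have z: "edge_zscore n r \<beta> A i = (\<Sum>k\<in>K. X k A)" for A
    unfolding edge_zscore_def edge_noise_def X_def K_def edge_dev_def \<sigma>_def[symmetric]
    by (subst sum.reindex) (auto intro: inj_onI simp: sum_divide_distrib)
  have prod: "char (distr ?M borel (\<lambda>A. edge_zscore n r \<beta> A i)) t = (\<Prod>k\<in>K. char (distr ?M borel (X k)) t)"
    unfolding z by (rule prob_space.char_distr_sum[OF measure_pmf.prob_space_axioms indepX])
  define x where "x k = t\<^sup>2 * u k / (2 * \<sigma>\<^sup>2)" for k
  have x0: "0 \<le> x k" for k using u(1)[of k] by (simp add: x_def)
  have "(\<Sum>k\<in>K. x k) = t\<^sup>2 / 2"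
    unfolding x_def sum_divide_distrib[symmetric] sum_distrib_left[symmetric] sumu using \<sigma>(1) by simp
  hence expprod: "complex_of_real (exp (- t\<^sup>2 / 2)) = (\<Prod>k\<in>K. complex_of_real (exp (- x k)))"
    unfolding of_real_prod[symmetric] by (subst exp_sum[symmetric]) (simp_all add: K_def sum_negf)
  have bound: "cmod (char (distr ?M borel (X k)) t - complex_of_real (exp (- x k)))
      \<le> \<bar>t\<bar> ^ 3 * u k / \<sigma> ^ 3 + t ^ 4 * u k / \<sigma> ^ 4" if k: "k \<in> K" for k
  proof -
    have Xb: "\<bar>X k A\<bar> \<le> 1 / \<sigma>" for A
      using abs_edge_dev_le[of \<beta> k A] \<sigma> by (simp add: X_def abs_mult divide_right_mono)
    have int: "integrable ?M f" if "\<And>A. \<bar>f A\<bar> \<le> c" for f :: "_ \<Rightarrow> real" and c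
      using that by (intro measure_pmf.integrable_const_bound[of _ c]) auto
    have X2b: "(X k A)\<^sup>2 \<le> (1 / \<sigma>)\<^sup>2" for A using power_mono[OF Xb[of A], of 2] by simp
    have intX: "integrable ?M (X k)" by (rule int[OF Xb])
    have intX2: "integrable ?M (\<lambda>A. (X k A)\<^sup>2)" by (rule int[of _ "(1 / \<sigma>)\<^sup>2"]) (use X2b in simp)
    have m1: "measure_pmf.expectation (beta_graph n \<beta>) (X k) = 0"
      unfolding X_def using expectation_edge_dev(1)[OF pr[OF k]] by simp
    have m2: "measure_pmf.expectation (beta_graph n \<beta>) (\<lambda>A. (X k A)\<^sup>2) = u k / \<sigma>\<^sup>2"
      unfolding X_def power_mult_distrib using expectation_edge_dev(2)[OF pr[OF k], of \<beta>]
      by (simp add: u_def power_divide)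
    have "cmod (char (distr ?M borel (X k)) t - (1 - t\<^sup>2 * (u k / \<sigma>\<^sup>2) / 2)) \<le>
        (t\<^sup>2 / 6) * measure_pmf.expectation (beta_graph n \<beta>) (\<lambda>A. min (6 * (X k A)\<^sup>2) (\<bar>t\<bar> * \<bar>X k A\<bar> ^ 3))"
      by (rule prob_space.char_approx3'[OF measure_pmf.prob_space_axioms _ intX intX2 m1 _ refl]) (use m1 m2 in auto)
    also have "\<dots> \<le> (t\<^sup>2 / 6) * measure_pmf.expectation (beta_graph n \<beta>) (\<lambda>A. \<bar>t\<bar> / \<sigma> * (X k A)\<^sup>2)"
    proof (intro mult_left_mono integral_mono)
      show "min (6 * (X k A)\<^sup>2) (\<bar>t\<bar> * \<bar>X k A\<bar> ^ 3) \<le> \<bar>t\<bar> / \<sigma> * (X k A)\<^sup>2" for A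
      proof -
        have "\<bar>t\<bar> * \<bar>X k A\<bar> ^ 3 = \<bar>t\<bar> * \<bar>X k A\<bar> * (X k A)\<^sup>2" by (simp add: power3_eq_cube power2_eq_square)
        also have "\<dots> \<le> \<bar>t\<bar> * (1 / \<sigma>) * (X k A)\<^sup>2"
          by (intro mult_right_mono mult_left_mono Xb) auto
        finally show ?thesis by simp
      qed
      show "integrable ?M (\<lambda>A. \<bar>t\<bar> / \<sigma> * (X k A)\<^sup>2)" using intX2 by simp
      show "integrable ?M (\<lambda>A. min (6 * (X k A)\<^sup>2) (\<bar>t\<bar> * \<bar>X k A\<bar> ^ 3))"
      proof (rule int[of _ "6 * (1 / \<sigma>)\<^sup>2"])
        fix A
        have "0 \<le> min (6 * (X k A)\<^sup>2) (\<bar>t\<bar> * \<bar>X k A\<bar> ^ 3)" by simp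
        moreover have "min (6 * (X k A)\<^sup>2) (\<bar>t\<bar> * \<bar>X k A\<bar> ^ 3) \<le> 6 * (1 / \<sigma>)\<^sup>2"
          by (rule order_trans[OF min.cobounded1]) (use X2b in simp)
        ultimately show "\<bar>min (6 * (X k A)\<^sup>2) (\<bar>t\<bar> * \<bar>X k A\<bar> ^ 3)\<bar> \<le> 6 * (1 / \<sigma>)\<^sup>2" by simp
      qed
    qed simp
    also have "measure_pmf.expectation (beta_graph n \<beta>) (\<lambda>A. \<bar>t\<bar> / \<sigma> * (X k A)\<^sup>2) = \<bar>t\<bar> / \<sigma> * (u k / \<sigma>\<^sup>2)" using m2 by simp
    also have "(t\<^sup>2 / 6) * (\<bar>t\<bar> / \<sigma> * (u k / \<sigma>\<^sup>2)) = (\<bar>t\<bar> ^ 3 * u k / \<sigma> ^ 3) / 6"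
    proof -
      have "\<bar>t\<bar> ^ 3 = t\<^sup>2 * \<bar>t\<bar>" by (simp add: power3_eq_cube power2_eq_square)
      thus ?thesis by (simp add: power3_eq_cube power2_eq_square)
    qed
    also have "\<dots> \<le> \<bar>t\<bar> ^ 3 * u k / \<sigma> ^ 3"
    proof -
      have "y / 6 \<le> y" if "0 \<le> y" for y :: real using that by simp
      moreover have "0 \<le> \<bar>t\<bar> ^ 3 * u k / \<sigma> ^ 3" using u(1)[of k] \<sigma>(1) by simp
      ultimately show ?thesis by blast
    qed
    also have "1 - t\<^sup>2 * (u k / \<sigma>\<^sup>2) / 2 = 1 - x k" by (simp add: x_def)
    finally have 1: "cmod (char (distr ?M borel (X k)) t - complex_of_real (1 - x k)) \<le> \<bar>t\<bar> ^ 3 * u k / \<sigma> ^ 3"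
      by simp
    have "\<bar>exp (- x k) - (1 - x k)\<bar> \<le> (x k)\<^sup>2 / 2"
      using exp_minus_le_quadratic[OF x0[of k]] exp_ge_add_one_self[of "- x k"] by simp
    also have "\<dots> = t ^ 4 * (u k)\<^sup>2 / (8 * \<sigma> ^ 4)"
      by (simp add: x_def power2_eq_square power4_eq_xxxx mult_ac)
    also have "\<dots> \<le> t ^ 4 * u k / \<sigma> ^ 4"
    proof -
      have "(u k)\<^sup>2 \<le> u k * 1" unfolding power2_eq_square using u[of k] by (intro mult_left_mono) auto
      hence "t ^ 4 * (u k)\<^sup>2 / (8 * \<sigma> ^ 4) \<le> t ^ 4 * u k / (8 * \<sigma> ^ 4)"
        using \<sigma> by (intro divide_right_mono mult_left_mono) auto
      also have "\<dots> \<le> t ^ 4 * u k / \<sigma> ^ 4" using \<sigma> u(1)[of k] by (intro divide_left_mono) auto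
      finally show ?thesis .
    qed
    finally have "cmod (complex_of_real (1 - x k) - complex_of_real (exp (- x k))) \<le> t ^ 4 * u k / \<sigma> ^ 4"
      unfolding of_real_diff[symmetric] norm_of_real by (simp add: abs_minus_commute)
    with 1 show ?thesis
      using norm_triangle_ineq[of "char (distr ?M borel (X k)) t - complex_of_real (1 - x k)"
          "complex_of_real (1 - x k) - complex_of_real (exp (- x k))"] by simp
  qed
  have "cmod (char (distr ?M borel (\<lambda>A. edge_zscore n r \<beta> A i)) t - exp (- t\<^sup>2 / 2)) \<le>
     (\<Sum>k\<in>K. cmod (char (distr ?M borel (X k)) t - complex_of_real (exp (- x k))))"
    unfolding prod expprod
  proof (rule norm_prod_diff)
    show "cmod (char (distr ?M borel (X k)) t) \<le> 1" for k
    proof -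
      interpret real_distribution "distr ?M borel (X k)" by (rule prob_space.real_distribution_distr[OF measure_pmf.prob_space_axioms]) simp
      show ?thesis by (rule cmod_char_le_1)
    qed
    show "cmod (complex_of_real (exp (- x k))) \<le> 1" for k using x0[of k] by simp
  qed
  also have "\<dots> \<le> (\<Sum>k\<in>K. \<bar>t\<bar> ^ 3 * u k / \<sigma> ^ 3 + t ^ 4 * u k / \<sigma> ^ 4)" by (intro sum_mono bound)
  also have "\<dots> = \<bar>t\<bar> ^ 3 * (\<Sum>k\<in>K. u k) / \<sigma> ^ 3 + t ^ 4 * (\<Sum>k\<in>K. u k) / \<sigma> ^ 4"
    by (simp add: sum.distrib sum_distrib_left sum_divide_distrib)
  also have "\<dots> = \<bar>t\<bar> ^ 3 / \<sigma> + t ^ 4 / \<sigma>\<^sup>2"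
    unfolding sumu using \<sigma>(1) by (simp add: power2_eq_square power3_eq_cube power4_eq_xxxx)
  finally show ?thesis .
qed

lemma weak_conv_edge_zscore:
  assumes i: "i \<in> {1..r}" and v: "filterlim (\<lambda>n. edge_var n r (\<beta> n) i) at_top sequentially"
  shows "weak_conv_m (\<lambda>n. distr (measure_pmf (beta_graph n (\<beta> n))) borel (\<lambda>A. edge_zscore n r (\<beta> n) A i))
     std_normal_distribution"
proof (rule levy_continuity[OF _ real_dist_normal_dist])
  show "real_distribution (distr (measure_pmf (beta_graph n (\<beta> n))) borel (\<lambda>A. edge_zscore n r (\<beta> n) A i))" for n
    by (rule prob_space.real_distribution_distr[OF measure_pmf.prob_space_axioms]) simp
  fix t
  define \<sigma> where "\<sigma> n = sqrt (edge_var n r (\<beta> n) i)" for n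
  have s: "filterlim \<sigma> at_top sequentially"
    unfolding \<sigma>_def[abs_def] by (rule filterlim_compose[OF sqrt_at_top v])
  have s2: "filterlim (\<lambda>n. (\<sigma> n)\<^sup>2) at_top sequentially"
    by (rule filterlim_pow_at_top[OF _ s]) simp
  have "(\<lambda>n. \<bar>t\<bar> ^ 3 / \<sigma> n + t ^ 4 / (\<sigma> n)\<^sup>2) \<longlonglongrightarrow> 0 + 0"
    by (rule tendsto_add[OF tendsto_divide_0[OF tendsto_const filterlim_at_top_imp_at_infinity[OF s]]
          tendsto_divide_0[OF tendsto_const filterlim_at_top_imp_at_infinity[OF s2]]])
  moreover have "\<forall>\<^sub>F n in sequentially. 0 < edge_var n r (\<beta> n) i"
    by (rule filterlim_at_top_dense[THEN iffD1, OF v, THEN spec])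
  hence "\<forall>\<^sub>F n in sequentially. cmod (char (distr (measure_pmf (beta_graph n (\<beta> n))) borel
      (\<lambda>A. edge_zscore n r (\<beta> n) A i)) t - exp (- t\<^sup>2 / 2)) \<le> \<bar>t\<bar> ^ 3 / \<sigma> n + t ^ 4 / (\<sigma> n)\<^sup>2"
    unfolding \<sigma>_def by eventually_elim (rule char_edge_zscore[OF i])
  ultimately have "(\<lambda>n. char (distr (measure_pmf (beta_graph n (\<beta> n))) borel
      (\<lambda>A. edge_zscore n r (\<beta> n) A i)) t - exp (- t\<^sup>2 / 2)) \<longlonglongrightarrow> 0"
    unfolding add_0 by (rule Lim_null_comparison[rotated])
  thus "(\<lambda>n. char (distr (measure_pmf (beta_graph n (\<beta> n))) borel (\<lambda>A. edge_zscore n r (\<beta> n) A i)) t)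
      \<longlonglongrightarrow> char std_normal_distribution t"
    unfolding char_std_normal_distribution by (rule LIM_zero_cancel)
qed

text \<open>Each z-score is a function of the graph restricted to its own edge set
  \<open>K i\<close>, and these sets are disjoint.\<close>

lemma indep_edge_zscores:
  "prob_space.indep_vars (measure_pmf (beta_graph n \<beta>)) (\<lambda>_. borel) (\<lambda>i A. edge_zscore n r \<beta> A i) {1..r}"
proof -
  let ?M = "measure_pmf (beta_graph n \<beta>)"
  define K where "K i = Pair i ` {r+1..n}" for i :: nat
  have "prob_space.indep_vars ?M (\<lambda>i. PiM (K i) (\<lambda>_. count_space UNIV)) (\<lambda>i A. restrict (\<lambda>e. A e) (K i)) {1..r}"
    by (rule prob_space.indep_vars_restrict[OF measure_pmf.prob_space_axioms indep_edges])
       (auto simp: K_def pairs_def disjoint_family_on_def)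
  hence "prob_space.indep_vars ?M (\<lambda>_. borel) (\<lambda>i A. edge_zscore n r \<beta> (restrict (\<lambda>e. A e) (K i)) i) {1..r}"
  proof (rule prob_space.indep_vars_compose2[OF measure_pmf.prob_space_axioms])
    fix i
    have "(\<lambda>f. of_bool (f (i, k)) :: real) \<in> borel_measurable (PiM (K i) (\<lambda>_. count_space UNIV))"
      if "k \<in> {r+1..n}" for k
      by (rule measurable_PiM_component_rev[where f = "of_bool"]) (use that in \<open>auto simp: K_def\<close>)
    thus "(\<lambda>A. edge_zscore n r \<beta> A i) \<in> borel_measurable (PiM (K i) (\<lambda>_. count_space UNIV))"
      unfolding edge_zscore_def edge_noise_def
      by (intro borel_measurable_divide borel_measurable_sum borel_measurable_diff) auto
  qed
  moreover have "edge_zscore n r \<beta> (restrict (\<lambda>e. A e) (K i)) i = edge_zscore n r \<beta> A i" for A i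
    unfolding edge_zscore_def edge_noise_def by (intro arg_cong2[of _ _ _ _ "(/)"] sum.cong) (auto simp: K_def)
  ultimately show ?thesis by simp
qed

lemma char_function_of_zscores:
  assumes r: "1 \<le> r"
    and v: "\<And>i. i \<in> {1..r} \<Longrightarrow> filterlim (\<lambda>n. edge_var n r (\<beta> n) i) at_top sequentially"
    and F: "F \<in> borel_measurable (PiM {1..r} (\<lambda>_. borel))"
    and F_cont: "\<And>z z'. (\<And>i. i \<in> {1..r} \<Longrightarrow> (\<lambda>n. z n i) \<longlonglongrightarrow> z' i) \<Longrightarrow> (\<lambda>n. F (z n)) \<longlonglongrightarrow> F z'"
  shows "(\<lambda>n. char (distr (measure_pmf (beta_graph n (\<beta> n))) borel (\<lambda>A. F (edge_zscore n r (\<beta> n) A))) t)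
     \<longlonglongrightarrow> char (distr (normal_vector r) borel F) t"
proof -
  let ?M = "\<lambda>n. measure_pmf (beta_graph n (\<beta> n))"
  let ?\<mu> = "\<lambda>i n. distr (?M n) borel (\<lambda>A. edge_zscore n r (\<beta> n) A i)"
  \<comment> \<open>\<open>F_cont\<close> looks at coordinates in {1..r} only; for a constant
    sequence it says that \<open>F\<close> ignores all others.\<close>
  have restr: "F (restrict z {1..r}) = F z" for z
  proof -
    have "(\<lambda>n::nat. F (restrict z {1..r})) \<longlonglongrightarrow> F z" by (rule F_cont) simp
    thus ?thesis by (simp add: LIMSEQ_const_iff)
  qed
  have law: "distr (PiM {1..r} (\<lambda>i. ?\<mu> i n)) borel F = distr (?M n) borel (\<lambda>A. F (edge_zscore n r (\<beta> n) A))" for n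
  proof -
    have "PiM {1..r} (\<lambda>i. ?\<mu> i n) = distr (?M n) (PiM {1..r} (\<lambda>_. borel)) (\<lambda>A. \<lambda>i\<in>{1..r}. edge_zscore n r (\<beta> n) A i)"
      by (rule prob_space.indep_vars_iff_distr_eq_PiM'[OF measure_pmf.prob_space_axioms, THEN iffD1, OF _ _ indep_edge_zscores, symmetric]) (use r in auto)
    also have "distr \<dots> borel F = distr (?M n) borel (F \<circ> (\<lambda>A. \<lambda>i\<in>{1..r}. edge_zscore n r (\<beta> n) A i))"
      by (rule distr_distr[OF F]) (rule measurable_restrict, simp)
    also have "F \<circ> (\<lambda>A. \<lambda>i\<in>{1..r}. edge_zscore n r (\<beta> n) A i) = (\<lambda>A. F (edge_zscore n r (\<beta> n) A))"
      unfolding comp_def by (simp only: restr)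
    finally show ?thesis .
  qed
  have "(\<lambda>n. char (distr (PiM {1..r} (\<lambda>i. ?\<mu> i n)) borel F) t) \<longlonglongrightarrow> char (distr (normal_vector r) borel F) t"
    by (rule char_PiM_continuous_mapping[OF _ _ real_dist_normal_dist _ F F_cont])
       (auto intro!: weak_conv_edge_zscore v prob_space.real_distribution_distr[OF measure_pmf.prob_space_axioms])
  thus ?thesis unfolding law .
qed

section \<open>Rates and conclusion\<close>

text \<open>The maximum and the minimum run over reciprocals of \<open>dmu\<close>, so these facts
  are bounds on \<open>dmu\<close> read upside down; two nodes make the set nonempty.\<close>

lemma bn_cn_facts:
  assumes n: "2 \<le> n"
  shows "4 \<le> bn n \<beta>" "0 < cn n \<beta>" "cn n \<beta> \<le> bn n \<beta>"
    and "\<And>j k. \<lbrakk>j \<in> {1..n}; k \<in> {1..n}; j \<noteq> k\<rbrakk> \<Longrightarrow> 1 / bn n \<beta> \<le> dmu (\<beta> j + \<beta> k)"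
proof -
  define S where "S = {(1 + exp (\<beta> i + \<beta> j))\<^sup>2 / exp (\<beta> i + \<beta> j) | i j.
                  i \<in> {1..n} \<and> j \<in> {1..n} \<and> i \<noteq> j}"
  have "S \<subseteq> (\<lambda>(i, j). (1 + exp (\<beta> i + \<beta> j))\<^sup>2 / exp (\<beta> i + \<beta> j)) ` ({1..n} \<times> {1..n})"
    by (auto simp: S_def)
  hence fin: "finite S" by (rule finite_subset) simp
  have el: "1 / dmu (\<beta> j + \<beta> k) \<in> S" if "j \<in> {1..n}" "k \<in> {1..n}" "j \<noteq> k" for j k
    unfolding S_def using that by (auto simp: dmu_def)
  have ge4: "4 \<le> x" if x: "x \<in> S" for x
  proof -
    obtain i j where "x = 1 / dmu (\<beta> i + \<beta> j)" using x by (auto simp: S_def dmu_def)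
    thus ?thesis using dmu_pos[of "\<beta> i + \<beta> j"] dmu_le_quarter[of "\<beta> i + \<beta> j"]
      by (simp add: pos_le_divide_eq)
  qed
  have ne: "S \<noteq> {}" using el[of 1 2] n by auto
  have b: "bn n \<beta> = Max S" and c: "cn n \<beta> = Min S" by (simp_all add: bn_def cn_def S_def)
  show b4: "4 \<le> bn n \<beta>" unfolding b by (rule ge4[OF Max_in[OF fin ne]])
  have "4 \<le> cn n \<beta>" unfolding c by (rule ge4[OF Min_in[OF fin ne]])
  thus "0 < cn n \<beta>" by simp
  show "cn n \<beta> \<le> bn n \<beta>" unfolding b c using Min_le[OF fin Max_in[OF fin ne]] .
  fix j k assume jk: "j \<in> {1..n}" "k \<in> {1..n}" "j \<noteq> k"
  have "1 / dmu (\<beta> j + \<beta> k) \<le> bn n \<beta>" unfolding b by (rule Max_ge[OF fin el[OF jk]])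
  thus "1 / bn n \<beta> \<le> dmu (\<beta> j + \<beta> k)" using dmu_pos[of "\<beta> j + \<beta> k"] b4 by (simp add: field_simps)
qed

text \<open>Collects the constants of the expansion error on the scale b^3 ln n: 10 from the
  weighted noise, 8000 and 1600 from the Taylor remainders, and 205 + 2 for each of the first r
  nodes.\<close>

definition rate_const :: "nat \<Rightarrow> real" where
  "rate_const r = 9610 + 207 * real r"

text \<open>The weights depend on \<beta> only and are fixed before the graph is drawn, as
  Hoeffding's inequality requires.\<close>

definition dual_family :: "nat \<Rightarrow> nat \<Rightarrow> (nat \<Rightarrow> real) \<Rightarrow> real \<Rightarrow> (nat \<Rightarrow> nat \<Rightarrow> real) \<Rightarrow> bool" where
  "dual_family n r \<beta> b w \<longleftrightarrow> (\<forall>i\<in>{1..r}. (\<forall>j. \<bar>w i j\<bar> \<le> 5 * b / real n) \<and>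
     (\<forall>j\<in>{1..n}. (\<Sum>k\<in>{1..n} - {j}. dmu (\<beta> j + \<beta> k) * (w i j + w i k)) =
        (if j = i then 0 else dmu (\<beta> i + \<beta> j))))"

lemma (in curvature_bound) dual_family_exists:
  assumes "r \<le> n" shows "\<exists>w. dual_family n r \<beta> b w"
proof -
  have "\<forall>i\<in>{1..r}. \<exists>w. (\<forall>j. \<bar>w j\<bar> \<le> 5 * b / real n) \<and>
     (\<forall>j\<in>{1..n}. (\<Sum>k\<in>{1..n} - {j}. dmu (\<beta> j + \<beta> k) * (w j + w k)) = (if j = i then 0 else dmu (\<beta> i + \<beta> j)))"
  proof
    fix i assume "i \<in> {1..r}"
    hence "i \<in> {1..n}" using assms by auto
    from dual_weights[OF this] show "\<exists>w. (\<forall>j. \<bar>w j\<bar> \<le> 5 * b / real n) \<and>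
      (\<forall>j\<in>{1..n}. (\<Sum>k\<in>{1..n} - {j}. dmu (\<beta> j + \<beta> k) * (w j + w k)) = (if j = i then 0 else dmu (\<beta> i + \<beta> j)))"
      by metis
  qed
  from bchoice[OF this] show ?thesis unfolding dual_family_def by blast
qed

lemma (in curvature_bound) edge_var_ge:
  assumes "i \<in> {1..r}" "2 * r \<le> n"
  shows "real n / (2 * b) \<le> edge_var n r \<beta> i"
proof -
  have "(\<Sum>k\<in>{r+1..n}. 1 / b) \<le> edge_var n r \<beta> i"
    unfolding edge_var_def using assms by (intro sum_mono dmu_ge) auto
  moreover have "real n / (2 * b) \<le> (\<Sum>k\<in>{r+1..n}. 1 / b)"
  proof -
    have "real n \<le> 2 * (real n - real r)" using of_nat_mono[OF assms(2), where ?'a = real] by simp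
    thus ?thesis using b4 assms by (simp add: field_simps of_nat_diff)
  qed
  ultimately show ?thesis by linarith
qed

text \<open>Everything is measured against \<kappa>, which dominates each b^i l^j / s with i, j
  \<le> 4, where s = sqrt n and l = sqrt (ln n). The bound \<kappa> \<le> 1/80 gives t = 20 b l / s
  \<le> 1/4; the bound with \<open>rate_const r\<close> gives E \<le> s;
  \<open>2 * r \<le> n\<close> keeps at least n / 2 edges in each variance; and
  \<open>r\<^sup>2 \<le> n\<close> gives r \<le> G.\<close>

lemma (in curvature_bound) good_graph_regular:
  fixes r :: nat and \<kappa> G t E :: real
  defines "\<kappa> \<equiv> b ^ 4 * (ln (real n))\<^sup>2 / sqrt n"
  defines "G \<equiv> sqrt (real n * ln n)"
  defines "t \<equiv> 20 * b * G / n"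
  defines "E \<equiv> rate_const r * b ^ 3 * ln n"
  assumes r: "1 \<le> r" "2 * r \<le> n" "r\<^sup>2 \<le> n" and ln1: "1 \<le> ln (real n)"
    and small: "\<kappa> \<le> 1 / 80" "rate_const r * \<kappa> \<le> 1"
    and w: "dual_family n r \<beta> b w" and A: "A \<in> good_graphs n r \<beta> b w"
  shows "regular_sample n \<beta> b A r G t (5 * b / n) (10 * b * ln n) E (real n / (2 * b)) w"
    and "real r * (6 * (G + r) * E + 64 * t * (G + r)\<^sup>2) / (real n / (2 * b))
       \<le> real r * (24 * rate_const r + 10240) * \<kappa>"
proof -
  define s l where "s = sqrt (real n)" and "l = sqrt (ln (real n))"
  have s: "1 \<le> s" "s\<^sup>2 = real n" using n4 by (auto simp: s_def)
  have l: "1 \<le> l" "l\<^sup>2 = ln (real n)" using ln1 by (auto simp: l_def)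
  have b1: "1 \<le> b" "0 < b" using b4 by auto
  have G: "G = s * l" unfolding G_def s_def l_def by (rule real_sqrt_mult)
  have t: "t = 20 * b * l / s" unfolding t_def G s(2)[symmetric] using s(1) by (simp add: power2_eq_square)
  have \<kappa>: "\<kappa> = b ^ 4 * l ^ 4 / s" unfolding \<kappa>_def s_def[symmetric] l(2)[symmetric] by simp
  have K: "1 \<le> rate_const r" by (simp add: rate_const_def)
  have pw: "b ^ i \<le> b ^ j" if "i \<le> j" for i j using that b1 by (intro power_increasing) auto
  have pwl: "l ^ i \<le> l ^ j" if "i \<le> j" for i j using that l by (intro power_increasing) auto
  have mono: "b ^ i * l ^ j / s \<le> \<kappa>" if "i \<le> 4" "j \<le> 4" for i j
    unfolding \<kappa> using that b1 l s by (intro divide_right_mono mult_mono pw pwl) auto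
  have mono': "b ^ i * l ^ j \<le> b ^ 3 * l\<^sup>2" if "i \<le> 3" "j \<le> 2" for i j
    using that b1 l by (intro mult_mono pw pwl) auto
  have t0: "0 < t" unfolding t using b1 l s by simp
  have t14: "t \<le> 1 / 4" using mono[of 1 1] small(1) by (simp add: t)
  have Gs: "s \<le> G" unfolding G using s l by simp
  have rs: "real r \<le> s"
  proof -
    have "real (r\<^sup>2) \<le> real n" using r(3) by (rule of_nat_mono)
    thus ?thesis unfolding s_def by (intro real_le_rsqrt) simp
  qed
  have E: "E = rate_const r * (b ^ 3 * l\<^sup>2)" unfolding E_def l(2) by simp
  have EG: "E \<le> s"
  proof -
    have "rate_const r * (b ^ 3 * l ^ 2 / s) \<le> rate_const r * \<kappa>" using K by (intro mult_left_mono mono) auto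
    also have "\<dots> \<le> 1" by (rule small(2))
    finally show ?thesis using s unfolding E by (simp add: field_simps)
  qed
  show "regular_sample n \<beta> b A r G t (5 * b / n) (10 * b * ln n) E (real n / (2 * b)) w"
  proof
    show "1 \<le> r" "r \<le> n" "0 < t" "t \<le> 1 / 4" using r t0 t14 by auto
    show "\<bar>score n A \<beta> j\<bar> \<le> G" if "j \<in> {1..n}" for j
      using A that unfolding good_graphs_def G_def by blast
    show "6 * b * G < (real n - 1) * t"
    proof -
      have bG: "0 < b * G" using b1 Gs s by simp
      \<comment> \<open>The 20 in \<open>t\<close> leaves room: (n - 1) / n is at least 3/4, and 15
        exceeds the required 6.\<close>
      have "6 * b * G < 15 * (b * G)" using bG by (simp only: mult.assoc)
      also have "15 * (b * G) = (3 / 4) * (20 * (b * G))" by simp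
      also have "\<dots> \<le> ((real n - 1) / n) * (20 * (b * G))"
        using n4 bG by (intro mult_right_mono) (auto simp: field_simps)
      also have "\<dots> = (real n - 1) * t" unfolding t_def by simp
      finally show ?thesis .
    qed
    show "\<bar>w i j\<bar> \<le> 5 * b / n" if "i \<in> {1..r}" "j \<in> {1..n}" for i j
      using w that unfolding dual_family_def by blast
    show "(\<Sum>k\<in>{1..n} - {j}. dmu (\<beta> j + \<beta> k) * (w i j + w i k)) = (if j = i then 0 else dmu (\<beta> i + \<beta> j))"
      if "i \<in> {1..r}" "j \<in> {1..n}" for i j
      using w that unfolding dual_family_def by blast
    show "\<bar>\<Sum>j\<in>{1..n}. w i j * score n A \<beta> j\<bar> \<le> 10 * b * ln n" if "i \<in> {1..r}" for i
      using A that unfolding good_graphs_def by blast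
    show "0 < real n / (2 * b)" using b1 n4 by simp
    show "real n / (2 * b) \<le> edge_var n r \<beta> i" if "i \<in> {1..r}" for i
      using that r by (intro edge_var_ge)
    show "E \<le> G + real r" using EG Gs by linarith
    have 1: "real n * (2 * t)\<^sup>2 = 1600 * (b\<^sup>2 * l\<^sup>2)"
      unfolding t s(2)[symmetric] using s(1) by (simp add: power2_eq_square)
    have 2: "real n * (5 * b / n * (real n * (2 * t)\<^sup>2)) = 8000 * (b ^ 3 * l\<^sup>2)"
      unfolding 1 using n4 by (simp add: power2_eq_square power3_eq_cube)
    have 3: "real r * (5 * b / n * (G + real n * (2 * t))) \<le> real r * (205 * (b ^ 3 * l\<^sup>2))"
    proof (rule mult_left_mono)
      have "5 * b / n * (G + real n * (2 * t)) = (5 * (b * l) + 200 * (b\<^sup>2 * l)) / s"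
        unfolding G t s(2)[symmetric] using s(1) by (simp add: field_simps power2_eq_square)
      also have "\<dots> \<le> 5 * (b * l) + 200 * (b\<^sup>2 * l)"
      proof -
        have "0 \<le> 5 * (b * l) + 200 * (b\<^sup>2 * l)" using b1 l by simp
        from mult_left_mono[OF s(1) this] show ?thesis using s(1) by (simp add: pos_divide_le_eq)
      qed
      also have "\<dots> \<le> 205 * (b ^ 3 * l\<^sup>2)" using mono'[of 1 1] mono'[of 2 1] by simp
      finally show "5 * b / n * (G + real n * (2 * t)) \<le> 205 * (b ^ 3 * l\<^sup>2)" .
    qed simp
    have 4: "10 * b * ln n \<le> 10 * (b ^ 3 * l\<^sup>2)" using mono'[of 1 2] by (simp add: l(2))
    have 5: "1600 * (b\<^sup>2 * l\<^sup>2) \<le> 1600 * (b ^ 3 * l\<^sup>2)" using mono'[of 2 2] by simp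
    have 6: "2 * real r \<le> real r * (2 * (b ^ 3 * l\<^sup>2))"
      using mult_left_mono[of 2 "2 * (b ^ 3 * l\<^sup>2)" "real r"] mono'[of 0 0] by simp
    show "10 * b * ln n + real n * (5 * b / n * (real n * (2 * t)\<^sup>2)) + real r * (5 * b / n * (G + real n * (2 * t)))
         + real n * (2 * t)\<^sup>2 + 2 * real r \<le> E"
      unfolding 2 unfolding 1 E rate_const_def using 3 4 5 6 by (simp add: algebra_simps)
  qed
  have Gr: "G + real r \<le> 2 * G" using rs Gs by linarith
  have E0: "0 \<le> E" unfolding E using K b1 by simp
  have "6 * (G + r) * E + 64 * t * (G + r)\<^sup>2 \<le> 6 * (2 * G) * E + 64 * t * (2 * G)\<^sup>2"
    using Gr E0 t0 Gs s by (intro add_mono mult_right_mono mult_left_mono power_mono) auto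
  hence "real r * (6 * (G + r) * E + 64 * t * (G + r)\<^sup>2) / (real n / (2 * b)) \<le>
     real r * (6 * (2 * G) * E + 64 * t * (2 * G)\<^sup>2) / (real n / (2 * b))"
    using b1 by (intro divide_right_mono mult_left_mono) auto
  \<comment> \<open>24 is 6 times 2 times 2 and 10240 is 64 times 20 times 4 times 2, from G + r
    \<le> 2G, the 20 in \<open>t\<close> and the division by n / (2b).\<close>
  also have "\<dots> = real r * (24 * rate_const r * (b ^ 4 * l ^ 3 / s) + 10240 * (b\<^sup>2 * l ^ 3 / s))"
    unfolding E G t s(2)[symmetric] using s(1) b1
    by (simp add: field_simps power2_eq_square power3_eq_cube power4_eq_xxxx)
  also have "\<dots> \<le> real r * (24 * rate_const r * \<kappa> + 10240 * \<kappa>)"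
    using K by (intro mult_left_mono add_mono mono) auto
  also have "\<dots> = real r * (24 * rate_const r + 10240) * \<kappa>" by (simp add: algebra_simps)
  finally show "real r * (6 * (G + r) * E + 64 * t * (G + r)\<^sup>2) / (real n / (2 * b))
       \<le> real r * (24 * rate_const r + 10240) * \<kappa>" .
qed

text \<open>From c \<le> b follows b^2 \<le> b^3 / c, so b^4 is at most the square of the quantity
  in the rate assumption. Squaring the assumption therefore gives b^4 (ln n)^2 = o(n^(1/3)), and
  n^(1/3) \<le> sqrt n.\<close>

lemma rate_imp_negligible:
  assumes "(\<lambda>n. bn n (\<beta> n) ^ 3 / cn n (\<beta> n)) \<in> o(\<lambda>n. real n powr (1/6) / ln (real n))"
  shows "(\<lambda>n. bn n (\<beta> n) ^ 4 * (ln (real n))\<^sup>2 / sqrt n) \<longlonglongrightarrow> 0"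
proof -
  define b c where "b n = bn n (\<beta> n)" and "c n = cn n (\<beta> n)" for n
  have lim: "(\<lambda>n. (b n ^ 3 / c n) / (real n powr (1/6) / ln (real n))) \<longlonglongrightarrow> 0"
    using smalloD_tendsto[OF assms] unfolding b_def c_def .
  from tendsto_power[OF this, of 2]
  have "(\<lambda>n. ((b n ^ 3 / c n) / (real n powr (1/6) / ln (real n)))\<^sup>2) \<longlonglongrightarrow> 0" by simp
  moreover have "\<forall>\<^sub>F n in sequentially. norm (b n ^ 4 * (ln (real n))\<^sup>2 / sqrt n) \<le>
      ((b n ^ 3 / c n) / (real n powr (1/6) / ln (real n)))\<^sup>2"
    using eventually_ge_at_top[of 2]
  proof eventually_elim
    case (elim n)
    note f = bn_cn_facts[OF elim, where \<beta> = "\<beta> n", folded b_def c_def]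
    have n1: "1 \<le> real n" using elim by simp
    have "b n ^ 2 \<le> b n ^ 3 / c n"
      using f(1,2,3) by (simp add: field_simps power2_eq_square power3_eq_cube)
    hence "(b n ^ 2)\<^sup>2 \<le> (b n ^ 3 / c n)\<^sup>2" by (rule power_mono) simp
    hence bb: "b n ^ 4 \<le> (b n ^ 3 / c n)\<^sup>2" by simp
    have "(real n powr (1/6))\<^sup>2 = real n powr (1/3)" using n1 by (simp add: powr_power)
    also have "\<dots> \<le> real n powr (1/2)" using n1 by (intro powr_mono) auto
    also have "\<dots> = sqrt n" using n1 by (simp add: powr_half_sqrt)
    finally have nn: "(real n powr (1/6))\<^sup>2 \<le> sqrt n" .
    have "norm (b n ^ 4 * (ln (real n))\<^sup>2 / sqrt n) = b n ^ 4 * (ln (real n))\<^sup>2 / sqrt n"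
      using f(1) by simp
    also have "\<dots> \<le> (b n ^ 3 / c n)\<^sup>2 * (ln (real n))\<^sup>2 / (real n powr (1/6))\<^sup>2"
      using bb nn n1 f(1) by (intro frac_le mult_right_mono mult_nonneg_nonneg) auto
    also have "\<dots> = ((b n ^ 3 / c n) / (real n powr (1/6) / ln (real n)))\<^sup>2"
      by (simp add: power_divide power_mult_distrib)
    finally show ?case .
  qed
  ultimately show ?thesis unfolding b_def[symmetric] by (rule Lim_null_comparison[rotated])
qed

theorem theorem2:
  fixes \<beta> :: "nat \<Rightarrow> nat \<Rightarrow> real" and \<beta>0 :: "nat \<Rightarrow> nat \<Rightarrow> real" and r :: nat
  assumes r_pos: "r \<ge> 1"
    and rate: "(\<lambda>n. bn n (\<beta> n) ^ 3 / cn n (\<beta> n)) \<in> o(\<lambda>n. real n powr (1/6) / ln (real n))"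
  shows
    "((\<forall>n. \<forall>i\<in>{1..r}. i \<le> n \<longrightarrow> \<beta> n i = \<beta>0 n i) \<longrightarrow>
        weak_conv_m (\<lambda>n. LRT_law n (\<beta> n) (fixed_null_set r (\<beta>0 n))) (chi_sq r) \<and>
        (\<lambda>n. prob_mle_exist n (\<beta> n) (fixed_null_set r (\<beta>0 n))) \<longlonglongrightarrow> 1)
     \<and>
     ((r \<ge> 2 \<and> (\<forall>n. \<forall>i\<in>{1..r}. i \<le> n \<longrightarrow> \<beta> n i = \<beta> n 1)) \<longrightarrow>
        weak_conv_m (\<lambda>n. LRT_law n (\<beta> n) (homog_null_set r)) (chi_sq (r - 1)) \<and>
        (\<lambda>n. prob_mle_exist n (\<beta> n) (homog_null_set r)) \<longlonglongrightarrow> 1)"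
proof -
  define b where "b n = bn n (\<beta> n)" for n
  define \<kappa> where "\<kappa> n = b n ^ 4 * (ln (real n))\<^sup>2 / sqrt n" for n
  define C where "C = real r * (24 * rate_const r + 10240)"
  have \<kappa>: "\<kappa> \<longlonglongrightarrow> 0" unfolding \<kappa>_def b_def using rate_imp_negligible[OF rate] .
  have C\<kappa>: "(\<lambda>n. C * \<kappa> n) \<longlonglongrightarrow> 0" using tendsto_mult_right_zero[OF \<kappa>] by simp
  have curv: "curvature_bound n (\<beta> n) (b n)" if "4 \<le> n" for n
    using that bn_cn_facts[where n = n and \<beta> = "\<beta> n"] unfolding curvature_bound_def b_def by auto
  \<comment> \<open>The guard allows one choice of weights for the whole sequence, although
    \<open>dual_family_exists\<close> applies only once 4 \<le> n and r \<le> n.\<close>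
  have "\<exists>w. 4 \<le> n \<and> r \<le> n \<longrightarrow> dual_family n r (\<beta> n) (b n) w" for n
    using curvature_bound.dual_family_exists[OF curv, of n r] by blast
  then obtain w where w: "\<And>n. 4 \<le> n \<Longrightarrow> r \<le> n \<Longrightarrow> dual_family n r (\<beta> n) (b n) (w n)"
    by metis
  define S where "S n = good_graphs n r (\<beta> n) (b n) (w n)" for n
  have ev_ln: "\<forall>\<^sub>F n in sequentially. 1 \<le> ln (real n)"
    using filterlim_compose[OF ln_at_top filterlim_real_sequentially] unfolding filterlim_at_top by blast
  have ev_k: "\<forall>\<^sub>F n in sequentially. \<kappa> n < 1 / 80" "\<forall>\<^sub>F n in sequentially. \<kappa> n < 1 / rate_const r"
    by (rule order_tendstoD(2)[OF \<kappa>], simp add: rate_const_def add_pos_nonneg)+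
  have ev: "\<forall>\<^sub>F n in sequentially. 4 \<le> n \<and> 2 * r \<le> n \<and> r\<^sup>2 \<le> n \<and> 1 \<le> ln (real n) \<and>
      \<kappa> n \<le> 1 / 80 \<and> rate_const r * \<kappa> n \<le> 1"
    using eventually_ge_at_top[of 4] eventually_ge_at_top[of "2 * r"] eventually_ge_at_top[of "r\<^sup>2"] ev_ln ev_k
  proof eventually_elim
    case (elim n)
    have "0 < rate_const r" by (simp add: rate_const_def add_pos_nonneg)
    hence "rate_const r * \<kappa> n \<le> 1" using elim(6) by (simp add: field_simps)
    thus ?case using elim by simp
  qed
  have regular: "\<forall>\<^sub>F n in sequentially. \<forall>A\<in>S n. \<exists>G t W B E v0.
      regular_sample n (\<beta> n) (b n) A r G t W B E v0 (w n) \<and>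
      real r * (6 * (G + r) * E + 64 * t * (G + r)\<^sup>2) / v0 \<le> C * \<kappa> n"
    using ev
  proof eventually_elim
    case (elim n)
    interpret curvature_bound n "\<beta> n" "b n" using elim by (intro curv) simp
    show ?case
    proof
      fix A assume "A \<in> S n"
      hence A: "A \<in> good_graphs n r (\<beta> n) (b n) (w n)" by (simp add: S_def)
      have dual: "dual_family n r (\<beta> n) (b n) (w n)" using elim by (intro w) auto
      have c: "2 * r \<le> n" "r\<^sup>2 \<le> n" "1 \<le> ln (real n)" "b n ^ 4 * (ln (real n))\<^sup>2 / sqrt n \<le> 1 / 80"
        "rate_const r * (b n ^ 4 * (ln (real n))\<^sup>2 / sqrt n) \<le> 1"
        using elim unfolding \<kappa>_def by auto
      note good = good_graph_regular[OF r_pos c dual A]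
      show "\<exists>G t W B E v0. regular_sample n (\<beta> n) (b n) A r G t W B E v0 (w n) \<and>
          real r * (6 * (G + r) * E + 64 * t * (G + r)\<^sup>2) / v0 \<le> C * \<kappa> n"
        unfolding C_def \<kappa>_def by (intro exI conjI, rule good(1), rule good(2))
    qed
  qed
  have PS: "(\<lambda>n. measure_pmf.prob (beta_graph n (\<beta> n)) (S n)) \<longlonglongrightarrow> 1"
  proof (rule tendsto_sandwich[OF _ _ _ tendsto_const])
    show "(\<lambda>n. 1 - 4 / real n) \<longlonglongrightarrow> 1"
      using tendsto_diff[OF tendsto_const lim_const_over_n[of 4], of 1] by simp
    show "\<forall>\<^sub>F n in sequentially. 1 - 4 / real n \<le> measure_pmf.prob (beta_graph n (\<beta> n)) (S n)"
      using ev
    proof eventually_elim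
      case (elim n)
      have "4 \<le> b n" unfolding b_def using elim by (intro bn_cn_facts) auto
      moreover have "dual_family n r (\<beta> n) (b n) (w n)" using elim by (intro w) auto
      ultimately show ?case unfolding S_def using elim
        by (intro prob_good_graphs) (auto simp: dual_family_def)
    qed
  qed simp
  have var: "filterlim (\<lambda>n. edge_var n r (\<beta> n) i) at_top sequentially" if i: "i \<in> {1..r}" for i
  proof (rule filterlim_at_top_mono)
    show "filterlim (\<lambda>n. 1 / 2 * sqrt (real n)) at_top sequentially"
      by (rule filterlim_tendsto_pos_mult_at_top[OF tendsto_const])
         (auto intro: filterlim_compose[OF sqrt_at_top filterlim_real_sequentially])
    show "\<forall>\<^sub>F n in sequentially. 1 / 2 * sqrt (real n) \<le> edge_var n r (\<beta> n) i"
      using ev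
    proof eventually_elim
      case (elim n)
      interpret curvature_bound n "\<beta> n" "b n" using elim by (intro curv) simp
      \<comment> \<open>As \<kappa> is eventually below 1, b is at most sqrt n, and the lower bound
        n / (2b) of the variance diverges.\<close>
      have "b n * 1 \<le> b n ^ 4 * (ln (real n))\<^sup>2"
        using elim b4 by (intro mult_mono self_le_power one_le_power) auto
      also have "\<dots> = \<kappa> n * sqrt (real n)" using n4 by (simp add: \<kappa>_def)
      also have "\<dots> \<le> 1 * sqrt (real n)" using elim by (intro mult_right_mono) auto
      finally have bs: "b n \<le> sqrt (real n)" by simp
      have "1 / 2 * sqrt (real n) \<le> real n / (2 * b n)"
      proof -
        have "b n * sqrt (real n) \<le> sqrt (real n) * sqrt (real n)" using bs by (intro mult_right_mono) auto
        thus ?thesis using b4 by (simp add: field_simps)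
      qed
      also have "\<dots> \<le> edge_var n r (\<beta> n) i" using i elim by (intro edge_var_ge) auto
      finally show ?case .
    qed
  qed
  have chi: "real_distribution (chi_sq k)" if "1 \<le> k" for k
    using prob_space_chi_sq[OF that] by (simp add: real_distribution_def real_distribution_axioms_def)
  \<comment> \<open>The probabilistic conclusion common to both nulls, which differ in the null set
    \<open>N\<close>, the limiting functional \<open>F\<close> and the degrees of freedom
    \<open>k\<close>.\<close>
  have conclude: "weak_conv_m (\<lambda>n. LRT_law n (\<beta> n) (N n)) (chi_sq k) \<and> (\<lambda>n. prob_mle_exist n (\<beta> n) (N n)) \<longlonglongrightarrow> 1"
    if k: "1 \<le> k" and F: "F \<in> borel_measurable (PiM {1..r} (\<lambda>_. borel))" "distr (normal_vector r) borel F = chi_sq k"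
      "\<And>z z'. (\<And>i. i \<in> {1..r} \<Longrightarrow> (\<lambda>n. z n i) \<longlonglongrightarrow> z' i) \<Longrightarrow> (\<lambda>n. F (z n)) \<longlonglongrightarrow> F z'"
    and approx: "\<forall>\<^sub>F n in sequentially. \<forall>A\<in>S n. has_max (loglik n A) UNIV \<and> has_max (loglik n A) (N n) \<and>
       \<bar>LRT n A (N n) - F (edge_zscore n r (\<beta> n) A)\<bar> \<le> C * \<kappa> n"
    for k F N
  proof
    show "weak_conv_m (\<lambda>n. LRT_law n (\<beta> n) (N n)) (chi_sq k)"
      unfolding LRT_law_def
    proof (rule weak_conv_close[OF chi[OF k] _ _ C\<kappa> PS])
      show "(\<lambda>n. char (distr (measure_pmf (beta_graph n (\<beta> n))) borel (\<lambda>A. F (edge_zscore n r (\<beta> n) A))) t)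
          \<longlonglongrightarrow> char (chi_sq k) t" for t
        using char_function_of_zscores[OF r_pos var F(1,3)] unfolding F(2) .
      show "\<forall>\<^sub>F n in sequentially. \<forall>A\<in>S n. \<bar>LRT n A (N n) - F (edge_zscore n r (\<beta> n) A)\<bar> \<le> C * \<kappa> n"
        using approx by eventually_elim blast
    qed
    show "(\<lambda>n. prob_mle_exist n (\<beta> n) (N n)) \<longlonglongrightarrow> 1"
    proof (rule tendsto_sandwich[OF _ _ PS tendsto_const])
      show "\<forall>\<^sub>F n in sequentially. measure_pmf.prob (beta_graph n (\<beta> n)) (S n) \<le> prob_mle_exist n (\<beta> n) (N n)"
        using approx unfolding prob_mle_exist_def
        by eventually_elim (auto intro!: measure_pmf.finite_measure_mono)
    qed (simp add: prob_mle_exist_def)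
  qed
  show ?thesis
  proof (rule conjI; rule impI)
    assume null: "\<forall>n. \<forall>i\<in>{1..r}. i \<le> n \<longrightarrow> \<beta> n i = \<beta>0 n i"
    show "weak_conv_m (\<lambda>n. LRT_law n (\<beta> n) (fixed_null_set r (\<beta>0 n))) (chi_sq r) \<and>
        (\<lambda>n. prob_mle_exist n (\<beta> n) (fixed_null_set r (\<beta>0 n))) \<longlonglongrightarrow> 1"
    proof (rule conclude[OF r_pos sum_sq_measurable distr_sum_sq[OF r_pos]])
      show "(\<lambda>n. sum_sq r (z n)) \<longlonglongrightarrow> sum_sq r z'" if "\<And>i. i \<in> {1..r} \<Longrightarrow> (\<lambda>n. z n i) \<longlonglongrightarrow> z' i" for z z'
        unfolding sum_sq_def by (intro tendsto_intros that)
      show "\<forall>\<^sub>F n in sequentially. \<forall>A\<in>S n. has_max (loglik n A) UNIV \<and>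
         has_max (loglik n A) (fixed_null_set r (\<beta>0 n)) \<and>
         \<bar>LRT n A (fixed_null_set r (\<beta>0 n)) - sum_sq r (edge_zscore n r (\<beta> n) A)\<bar> \<le> C * \<kappa> n"
        using regular ev
      proof eventually_elim
        case (elim n)
        show ?case
        proof
          fix A assume "A \<in> S n"
          then obtain G t W B E v0 where reg: "regular_sample n (\<beta> n) (b n) A r G t W B E v0 (w n)"
            and le: "real r * (6 * (G + r) * E + 64 * t * (G + r)\<^sup>2) / v0 \<le> C * \<kappa> n" using elim by blast
          have "\<beta> n i = \<beta>0 n i" if "i \<in> {1..r}" for i
          proof -
            have "i \<le> n" using that elim(2) by auto
            thus ?thesis using null that by blast
          qed
          note approx = regular_sample.fixed_null_approx[OF reg this]
          show "has_max (loglik n A) UNIV \<and> has_max (loglik n A) (fixed_null_set r (\<beta>0 n)) \<and>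
             \<bar>LRT n A (fixed_null_set r (\<beta>0 n)) - sum_sq r (edge_zscore n r (\<beta> n) A)\<bar> \<le> C * \<kappa> n"
            by (intro conjI conjunct1[OF approx] conjunct1[OF conjunct2[OF approx]]
                order_trans[OF conjunct2[OF conjunct2[OF approx]] le])
        qed
      qed
    qed
  next
    assume null: "r \<ge> 2 \<and> (\<forall>n. \<forall>i\<in>{1..r}. i \<le> n \<longrightarrow> \<beta> n i = \<beta> n 1)"
    hence r2: "2 \<le> r" "1 \<le> r - 1" by auto
    show "weak_conv_m (\<lambda>n. LRT_law n (\<beta> n) (homog_null_set r)) (chi_sq (r - 1)) \<and>
        (\<lambda>n. prob_mle_exist n (\<beta> n) (homog_null_set r)) \<longlonglongrightarrow> 1"
    proof (rule conclude[OF r2(2) centred_sum_sq_measurable distr_centred_sum_sq[OF r2(1)]])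
      show "(\<lambda>n. centred_sum_sq r (z n)) \<longlonglongrightarrow> centred_sum_sq r z'"
        if "\<And>i. i \<in> {1..r} \<Longrightarrow> (\<lambda>n. z n i) \<longlonglongrightarrow> z' i" for z z'
        unfolding centred_sum_sq_def using r2 by (intro tendsto_intros that) auto
      show "\<forall>\<^sub>F n in sequentially. \<forall>A\<in>S n. has_max (loglik n A) UNIV \<and>
         has_max (loglik n A) (homog_null_set r) \<and>
         \<bar>LRT n A (homog_null_set r) - centred_sum_sq r (edge_zscore n r (\<beta> n) A)\<bar> \<le> C * \<kappa> n"
        using regular ev
      proof eventually_elim
        case (elim n)
        show ?case
        proof
          fix A assume "A \<in> S n"
          then obtain G t W B E v0 where reg: "regular_sample n (\<beta> n) (b n) A r G t W B E v0 (w n)"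
            and le: "real r * (6 * (G + r) * E + 64 * t * (G + r)\<^sup>2) / v0 \<le> C * \<kappa> n" using elim by blast
          have "\<beta> n i = \<beta> n 1" if "i \<in> {1..r}" for i
          proof -
            have "i \<le> n" using that elim(2) by auto
            thus ?thesis using null that by blast
          qed
          note approx = regular_sample.homog_null_approx[OF reg this]
          show "has_max (loglik n A) UNIV \<and> has_max (loglik n A) (homog_null_set r) \<and>
             \<bar>LRT n A (homog_null_set r) - centred_sum_sq r (edge_zscore n r (\<beta> n) A)\<bar> \<le> C * \<kappa> n"
            by (intro conjI conjunct1[OF approx] conjunct1[OF conjunct2[OF approx]]
                order_trans[OF conjunct2[OF conjunct2[OF approx]] le])
        qed
      qed
    qed
  qed
qed

end
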